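(* Let $\{\mathcal M_n\}_{n\in\mathbb N}$ be a family of sets satisfying properties (P1)–(P5) and let $\rho\in\mathcal D(\mathcal H)$. (Direct part) For every $\epsilon>0$ there exists a sequence of two-outcome POVMs $\{A_n,\mathbb 1-A_n\}_{n\in\mathbb N}$ ($0\le A_n\le \mathbb 1$ on $\mathcal H^{\otimes n}$) such that $\lim_{n\to\infty}\mathrm{tr}\big((\mathbb 1-A_n)\rho^{\otimes n}\big)=0$ and, for every $n\in\mathbb N$ and every $\omega_n\in\mathcal M_n$, $$-\frac{\log\mathrm{tr}(A_n\omega_n)}{n}+\epsilon\ \ge\ E^{\infty}_{\mathcal M}(\rho).$$ (Strong converse) If a real number $\epsilon>0$ and a sequence of POVMs $\{A_n,\mathbb 1-A_n\}_{n\in\mathbb N}$ satisfy, for every $n\in\mathbb N$ and every $\omega_n\in\mathcal M_n$, $$-\frac{\log\mathrm{tr}(A_n\omega_n)}{n}-\epsilon\ \ge\ E^{\infty}_{\mathcal M}(\rho),$$ then $\lim_{n\to\infty}\mathrm{tr}\big((\mathbb 1-A_n)\rho^{\otimes n}\big)=1$.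
   Context: $\mathcal H$ is a finite-dimensional Hilbert space, $\mathcal D(\mathcal K)$ denotes the set of density operators on $\mathcal K$, and $\log$ is base 2. For $\pi\in S_n$, $P_\pi$ is the unitary on $\mathcal H^{\otimes n}$ permuting the tensor factors. A family $\{\mathcal M_n\}_{n\in\mathbb N}$ with $\mathcal M_n\subseteq\mathcal D(\mathcal H^{\otimes n})$ satisfies properties (P1)–(P5) if: (P1) each $\mathcal M_n$ is convex and closed; (P2) there is a full-rank $\sigma\in\mathcal D(\mathcal H)$ with $\sigma^{\otimes n}\in\mathcal M_n$ for every $n$; (P3) if $\rho\in\mathcal M_{n+1}$ then $\mathrm{tr}_k(\rho)\in\mathcal M_n$ for every $k\in\{1,\dots,n+1\}$, where $\mathrm{tr}_k$ is the partial trace over the $k$-th tensor factor; (P4) if $\rho\in\mathcal M_n$ and $\nu\in\mathcal M_m$ then $\rho\otimes\nu\in\mathcal M_{n+m}$; (P5) if $\rho\in\mathcal M_n$ then $P_\pi\rho P_\pi^{*}\in\mathcal M_n$ for every $\pi\in S_n$. The quantum relative entropy is $S(\rho\|\sigma)=\mathrm{tr}(\rho(\log\rho-\log\sigma))$ if $\mathrm{supp}\rho\subseteq\mathrm{supp}\sigma$ and $+\infty$ otherwise. Define $E_{\mathcal M_n}(\rho)=\inf_{\sigma\in\mathcal M_n}S(\rho\|\sigma)$ and $E^\infty_{\mathcal M}(\rho)=\lim_{n\to\infty}\frac1n E_{\mathcal M_n}(\rho^{\otimes n})$ (this limit exists under (P4) by subadditivity). *)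

theory Defs
  imports Complex_Main "HOL-Library.Extended_Real" "HOL-Combinatorics.Permutations"
    "Jordan_Normal_Form.Schur_Decomposition" "Jordan_Normal_Form.DL_Rank"
begin

text \<open>The Hilbert space H is modelled as C^d; H^{\<otimes>n} as C^(d^n), where a basis
  index i < d^n is identified with its base-d digit string (first tensor factor =
  most significant digit).  Operators are complex d^n x d^n matrices.\<close>

definition mtrace :: "complex mat \<Rightarrow> complex" where
  "mtrace A = (\<Sum>i<dim_row A. A $$ (i,i))"

definition hermitian :: "complex mat \<Rightarrow> bool" where
  "hermitian A \<longleftrightarrow> mat_adjoint A = A"

definition unitary :: "nat \<Rightarrow> complex mat \<Rightarrow> bool" where
  "unitary N U \<longleftrightarrow> U \<in> carrier_mat N N \<and> U * mat_adjoint U = 1\<^sub>m N \<and> mat_adjoint U * U = 1\<^sub>m N"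

definition psd :: "nat \<Rightarrow> complex mat \<Rightarrow> bool" where
  "psd N A \<longleftrightarrow> A \<in> carrier_mat N N \<and> hermitian A \<and>
     (\<forall>v \<in> carrier_vec N. Im ((A *\<^sub>v v) \<bullet>c v) = 0 \<and> Re ((A *\<^sub>v v) \<bullet>c v) \<ge> 0)"

definition density :: "nat \<Rightarrow> complex mat set" where
  "density N = {A. psd N A \<and> mtrace A = 1}"

definition povm_elem :: "nat \<Rightarrow> complex mat \<Rightarrow> bool" where
  "povm_elem N A \<longleftrightarrow> psd N A \<and> psd N (1\<^sub>m N - A)"

definition full_rank :: "nat \<Rightarrow> complex mat \<Rightarrow> bool" where
  "full_rank N A \<longleftrightarrow> A \<in> carrier_mat N N \<and> vec_space.rank N A = N"

definition mat_fun :: "nat \<Rightarrow> (real \<Rightarrow> real) \<Rightarrow> complex mat \<Rightarrow> complex mat" where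
  "mat_fun N f A = (SOME B. \<exists>U D. unitary N U \<and> D \<in> carrier_mat N N \<and> diagonal_mat D \<and>
      A = U * D * mat_adjoint U \<and>
      B = U * mat_diag N (\<lambda>i. complex_of_real (f (Re (D $$ (i,i))))) * mat_adjoint U)"

text \<open>Base-2 matrix logarithm; on the kernel it is set to 0 (only used on supports).\<close>
definition mat_log2 :: "nat \<Rightarrow> complex mat \<Rightarrow> complex mat" where
  "mat_log2 N A = mat_fun N (\<lambda>x. if x > 0 then log 2 x else 0) A"

definition supp :: "nat \<Rightarrow> complex mat \<Rightarrow> complex vec set" where
  "supp N A = {A *\<^sub>v v | v. v \<in> carrier_vec N}"

definition rel_entropy :: "nat \<Rightarrow> complex mat \<Rightarrow> complex mat \<Rightarrow> ereal" where
  "rel_entropy N \<rho> \<sigma> = (if supp N \<rho> \<subseteq> supp N \<sigma>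
      then ereal (Re (mtrace (\<rho> * (mat_log2 N \<rho> - mat_log2 N \<sigma>)))) else \<infinity>)"

definition kron :: "complex mat \<Rightarrow> complex mat \<Rightarrow> complex mat" where
  "kron A B = mat (dim_row A * dim_row B) (dim_col A * dim_col B)
     (\<lambda>(i,j). A $$ (i div dim_row B, j div dim_col B) * B $$ (i mod dim_row B, j mod dim_col B))"

primrec tpow :: "nat \<Rightarrow> complex mat \<Rightarrow> complex mat" where
  "tpow 0 A = 1\<^sub>m 1"
| "tpow (Suc n) A = kron A (tpow n A)"

text \<open>Insert digit a at tensor position k (1-based) into an index of H^{\<otimes>n}, giving an
  index of H^{\<otimes>(n+1)}.\<close>
definition ins_digit :: "nat \<Rightarrow> nat \<Rightarrow> nat \<Rightarrow> nat \<Rightarrow> nat \<Rightarrow> nat" where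
  "ins_digit d n k a i = (i div d ^ (n + 1 - k)) * d ^ (n + 2 - k) + a * d ^ (n + 1 - k)
      + i mod d ^ (n + 1 - k)"

text \<open>Partial trace over the k-th tensor factor (1 \<le> k \<le> n+1) of an operator on H^{\<otimes>(n+1)}.\<close>
definition ptrace :: "nat \<Rightarrow> nat \<Rightarrow> nat \<Rightarrow> complex mat \<Rightarrow> complex mat" where
  "ptrace d n k \<rho> = mat (d ^ n) (d ^ n)
     (\<lambda>(i,j). \<Sum>a<d. \<rho> $$ (ins_digit d n k a i, ins_digit d n k a j))"

text \<open>The k-th digit (0-based, k < n) of a basis index of H^{\<otimes>n}.\<close>
definition digit :: "nat \<Rightarrow> nat \<Rightarrow> nat \<Rightarrow> nat \<Rightarrow> nat" where
  "digit d n i k = (i div d ^ (n - 1 - k)) mod d"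

text \<open>Unitary P_\<pi> permuting the tensor factors (\<pi> a permutation of the positions {0..<n}).\<close>
definition perm_op :: "nat \<Rightarrow> nat \<Rightarrow> (nat \<Rightarrow> nat) \<Rightarrow> complex mat" where
  "perm_op d n \<pi> = mat (d ^ n) (d ^ n)
     (\<lambda>(i,j). if \<forall>k<n. digit d n i (\<pi> k) = digit d n j k then 1 else 0)"

definition convex_mat_set :: "complex mat set \<Rightarrow> bool" where
  "convex_mat_set S \<longleftrightarrow> (\<forall>A\<in>S. \<forall>B\<in>S. \<forall>t::real. 0 \<le> t \<and> t \<le> 1 \<longrightarrow>
      complex_of_real t \<cdot>\<^sub>m A + complex_of_real (1 - t) \<cdot>\<^sub>m B \<in> S)"

definition closed_mat_set :: "nat \<Rightarrow> complex mat set \<Rightarrow> bool" where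
  "closed_mat_set N S \<longleftrightarrow> (\<forall>X A. (\<forall>k. X k \<in> S) \<and> A \<in> carrier_mat N N \<and>
      (\<forall>i<N. \<forall>j<N. (\<lambda>k. X k $$ (i,j)) \<longlonglongrightarrow> A $$ (i,j)) \<longrightarrow> A \<in> S)"

definition props_P1_P5 :: "nat \<Rightarrow> (nat \<Rightarrow> complex mat set) \<Rightarrow> bool" where
  "props_P1_P5 d M \<longleftrightarrow>
     (\<forall>n\<ge>1. M n \<subseteq> density (d ^ n) \<and> convex_mat_set (M n) \<and> closed_mat_set (d ^ n) (M n))
   \<and> (\<exists>\<sigma>. \<sigma> \<in> density d \<and> full_rank d \<sigma> \<and> (\<forall>n\<ge>1. tpow n \<sigma> \<in> M n))
   \<and> (\<forall>n\<ge>1. \<forall>\<rho>\<in>M (n + 1). \<forall>k\<in>{1..n+1}. ptrace d n k \<rho> \<in> M n)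
   \<and> (\<forall>n\<ge>1. \<forall>m\<ge>1. \<forall>\<rho>\<in>M n. \<forall>\<nu>\<in>M m. kron \<rho> \<nu> \<in> M (n + m))
   \<and> (\<forall>n\<ge>1. \<forall>\<pi>. \<pi> permutes {..<n} \<longrightarrow>
        (\<forall>\<rho>\<in>M n. perm_op d n \<pi> * \<rho> * mat_adjoint (perm_op d n \<pi>) \<in> M n))"

definition E_M :: "nat \<Rightarrow> (nat \<Rightarrow> complex mat set) \<Rightarrow> nat \<Rightarrow> complex mat \<Rightarrow> ereal" where
  "E_M d M n \<rho> = (INF \<sigma>\<in>M n. rel_entropy (d ^ n) \<rho> \<sigma>)"

definition E_inf :: "nat \<Rightarrow> (nat \<Rightarrow> complex mat set) \<Rightarrow> complex mat \<Rightarrow> ereal" where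
  "E_inf d M \<rho> = lim (\<lambda>n. E_M d M n (tpow n \<rho>) / ereal (real n))"

end

theory Submission
  imports Defs "Jordan_Normal_Form.Spectral_Radius" "HOL-Analysis.Convex" "HOL-Real_Asymp.Real_Asymp"
begin

text \<open>
  Write \<open>L\<close> for the regularised relative entropy, which by subadditivity is the infimum of
  \<open>E n / n\<close>. For the strong converse, block product states \<open>\<omega> \<in> M n\<close> built from a near-optimal
  \<open>\<sigma>\<^sub>m \<in> M m\<close> suffice: by Chebyshev's inequality \<open>\<rho>\<^sup>\<otimes>\<^sup>n\<close> is concentrated on eigenvectors with
  eigenvalue about \<open>2\<^sup>n\<^sup>a\<close> and on the span of eigenvectors of \<open>\<omega>\<close> with eigenvalue about \<open>2\<^sup>n\<^sup>b\<close>, where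
  \<open>a - b\<close> is close to \<open>L\<close>, and this bounds \<open>tr (A \<rho>\<^sup>\<otimes>\<^sup>n)\<close> by \<open>2\<^sup>n\<^sup>(\<^sup>a\<^sup>-\<^sup>b\<^sup>) tr (A \<omega>)\<close> up to small errors.

  For the direct part, a minimax argument reduces the claim to one adversary \<open>\<omega>\<^sub>1 \<in> M n\<close> against which
  every test is bad. Mix \<open>\<omega>\<^sub>1\<close> with the block product state \<open>\<omega>\<^sub>2\<close> and a full-rank state to get \<open>\<tau>\<close>,
  whose spectrum is covered by linearly many dyadic bins. Pinching \<open>\<rho>\<^sup>\<otimes>\<^sup>n\<close> in these bins costs only
  \<open>O(log n)\<close> of entropy and makes the log-likelihood ratio classical; its level sets are tests.
  The adversary forces the ratio below about \<open>n (L - \<epsilon>)\<close> with probability bounded below, and the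
  strong converse for \<open>\<omega>\<^sub>2\<close> forces it below about \<open>n L\<close> almost surely, so that the relative entropy
  of \<open>\<rho>\<^sup>\<otimes>\<^sup>n\<close> with respect to \<open>\<tau>\<close> is less than \<open>n L\<close>, a contradiction.
\<close>

subsection \<open>Matrices, traces and unitaries\<close>

text \<open>The tensor power of \<open>\<rho>\<close> need not commute with the states in
  \<open>M n\<close>. This is paid for twice: by a factor 2 from a two-block pinching of the test in
  the converse, and by the logarithm of the number of bins in the direct part. The full-rank
  component is what makes the second price negligible: it keeps the eigenvalues of
  \<open>\<tau>\<close> above an exponentially small bound, so linearly many dyadic bins suffice and
  the logarithm of their number vanishes after division by \<open>n\<close>. The same bound caps the
  log-likelihood ratio by a linear function of \<open>n\<close>, so an exceptional event whose
  probability merely tends to 0 shifts its mean by \<open>o(n)\<close>; Chebyshev is therefore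
  enough and no exponential decay of the errors is required. The contradiction is quantitative: the
  adversary lowers the ratio by about \<open>n \<epsilon>\<close> on a fixed fraction
  \<open>\<delta> / 2\<close> of the mass, and every other loss is made small against
  \<open>\<epsilon> \<delta>\<close>. It arises at each large \<open>n\<close> separately, because
  \<open>L\<close> is the infimum of the rates and not only their limit. Since
  \<open>\<delta>\<close> stays fixed there, a last step is needed to obtain one sequence of tests
  whose error tends to 0.\<close>

abbreviation adj :: "complex mat \<Rightarrow> complex mat" where "adj \<equiv> mat_adjoint"

lemma adj_dim [simp]: "dim_row (adj A) = dim_col A" "dim_col (adj A) = dim_row A"
  by (auto simp: mat_adjoint_def)

lemma adj_index [simp]:
  "i < dim_col A \<Longrightarrow> j < dim_row A \<Longrightarrow> adj A $$ (i,j) = cnj (A $$ (j,i))"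
  by (auto simp: mat_adjoint_def mat_of_rows_def)

lemma adj_carrier [simp]: "A \<in> carrier_mat n m \<Longrightarrow> adj A \<in> carrier_mat m n"
  by auto

lemma adj_adj [simp]: "adj (adj A) = A"
  by (rule eq_matI) auto

lemma index_mult_mat_sum:
  assumes "A \<in> carrier_mat n m" "B \<in> carrier_mat m k" "i < n" "j < k"
  shows "(A * B) $$ (i,j) = (\<Sum>l<m. A $$ (i,l) * B $$ (l,j))"
  using assms by (auto simp: scalar_prod_def atLeast0LessThan)

lemma adj_mult:
  assumes "A \<in> carrier_mat n m" "B \<in> carrier_mat m k"
  shows "adj (A * B) = adj B * adj A"
  using assms
  by (intro eq_matI) (auto simp: scalar_prod_def mult.commute)

lemma adj_add:
  "A \<in> carrier_mat n m \<Longrightarrow> B \<in> carrier_mat n m \<Longrightarrow> adj (A + B) = adj A + adj B"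
  by (rule eq_matI) auto

lemma adj_minus:
  "A \<in> carrier_mat n m \<Longrightarrow> B \<in> carrier_mat n m \<Longrightarrow> adj (A - B) = adj A - adj B"
  by (rule eq_matI) auto

lemma adj_smult: "adj (c \<cdot>\<^sub>m A) = cnj c \<cdot>\<^sub>m adj A"
  by (rule eq_matI) auto

lemma adj_one [simp]: "adj (1\<^sub>m n) = 1\<^sub>m n"
  by (rule eq_matI) auto

text \<open>Products of two self-adjoint matrices have real trace, so passing to the real part loses
  nothing where it is used and gives access to inequalities.\<close>

definition rtr :: "complex mat \<Rightarrow> real" where "rtr A = Re (mtrace A)"

lemma mtrace_mult_comm:
  assumes "A \<in> carrier_mat n m" "B \<in> carrier_mat m n"
  shows "mtrace (A * B) = mtrace (B * A)"
proof -
  have "mtrace (A * B) = (\<Sum>i<n. \<Sum>l<m. A $$ (i,l) * B $$ (l,i))"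
    using assms by (auto simp: mtrace_def scalar_prod_def atLeast0LessThan)
  also have "\<dots> = (\<Sum>l<m. \<Sum>i<n. A $$ (i,l) * B $$ (l,i))"
    by (rule sum.swap)
  also have "\<dots> = mtrace (B * A)"
    using assms by (auto simp: mtrace_def scalar_prod_def atLeast0LessThan mult.commute)
  finally show ?thesis .
qed

lemma mtrace_add:
  "A \<in> carrier_mat n n \<Longrightarrow> B \<in> carrier_mat n n \<Longrightarrow> mtrace (A + B) = mtrace A + mtrace B"
  by (auto simp: mtrace_def sum.distrib)

lemma mtrace_minus:
  "A \<in> carrier_mat n n \<Longrightarrow> B \<in> carrier_mat n n \<Longrightarrow> mtrace (A - B) = mtrace A - mtrace B"
  by (auto simp: mtrace_def sum_subtractf)

lemma mtrace_smult: "A \<in> carrier_mat n n \<Longrightarrow> mtrace (c \<cdot>\<^sub>m A) = c * mtrace A"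
  by (auto simp: mtrace_def sum_distrib_left)

lemma mtrace_adj: "A \<in> carrier_mat n n \<Longrightarrow> mtrace (adj A) = cnj (mtrace A)"
  by (auto simp: mtrace_def)

section \<open>Real diagonal matrices and unitaries\<close>

definition dg :: "nat \<Rightarrow> (nat \<Rightarrow> real) \<Rightarrow> complex mat" where
  "dg N f = mat_diag N (\<lambda>i. complex_of_real (f i))"

lemma dg_carrier [simp]: "dg N f \<in> carrier_mat N N"
  and dg_dim [simp]: "dim_row (dg N f) = N" "dim_col (dg N f) = N"
  by (auto simp: dg_def mat_diag_def)

lemma dg_index [simp]:
  "i < N \<Longrightarrow> j < N \<Longrightarrow> dg N f $$ (i,j) = (if i = j then complex_of_real (f i) else 0)"
  by (auto simp: dg_def mat_diag_def)

lemma adj_dg [simp]: "adj (dg N f) = dg N f"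
  by (rule eq_matI) auto

lemma dg_mult [simp]: "dg N f * dg N g = dg N (\<lambda>i. f i * g i)"
  by (simp add: dg_def)

lemma dg_one [simp]: "dg N (\<lambda>i. 1) = 1\<^sub>m N"
  by (simp add: dg_def)

lemma dg_cong: "(\<And>i. i < N \<Longrightarrow> f i = g i) \<Longrightarrow> dg N f = dg N g"
  by (rule eq_matI) auto

lemma dg_mult_left_index:
  "A \<in> carrier_mat N M \<Longrightarrow> i < N \<Longrightarrow> j < M \<Longrightarrow> (dg N f * A) $$ (i,j) = of_real (f i) * A $$ (i,j)"
  unfolding dg_def by (subst mat_diag_mult_left) auto

lemma dg_mult_right_index:
  "A \<in> carrier_mat M N \<Longrightarrow> i < M \<Longrightarrow> j < N \<Longrightarrow> (A * dg N f) $$ (i,j) = A $$ (i,j) * of_real (f j)"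
  unfolding dg_def by (subst mat_diag_mult_right) auto

lemma unitaryD:
  assumes "unitary N U"
  shows "U \<in> carrier_mat N N" "U * adj U = 1\<^sub>m N" "adj U * U = 1\<^sub>m N"
  using assms by (auto simp: unitary_def)

lemma unitaryI:
  assumes "U \<in> carrier_mat N N" "adj U * U = 1\<^sub>m N"
  shows "unitary N U"
  using assms mat_mult_left_right_inverse[of "adj U" N U] by (auto simp: unitary_def)

lemma mult_assoc4:
  assumes "A \<in> carrier_mat n n" "B \<in> carrier_mat n n" "C \<in> carrier_mat n n" "D \<in> carrier_mat n n"
  shows "(A * B) * (C * D) = A * (B * C) * D"
  using assms by (simp add: assoc_mult_mat[of _ n n _ n _ n] mult_carrier_mat[of _ n n _ n])

lemma unitary_mult: "unitary N U \<Longrightarrow> unitary N V \<Longrightarrow> unitary N (U * V)"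
proof (rule unitaryI)
  assume U: "unitary N U" and V: "unitary N V"
  note c = unitaryD(1)[OF U] unitaryD(1)[OF V]
  show "U * V \<in> carrier_mat N N" using c by auto
  have "adj (U * V) * (U * V) = (adj V * adj U) * (U * V)"
    using c by (simp add: adj_mult[of _ N N _ N])
  also have "\<dots> = adj V * (adj U * U) * V"
    using c by (intro mult_assoc4[of _ N]) auto
  also have "\<dots> = 1\<^sub>m N"
    using c unitaryD[OF U] unitaryD[OF V] by simp
  finally show "adj (U * V) * (U * V) = 1\<^sub>m N" .
qed

subsection \<open>The spectral theorem\<close>

text \<open>The block-diagonal matrix with blocks \<open>a\<close> and \<open>X\<close>, the shape
  left after splitting off one eigenvector.\<close>

definition bordered :: "complex \<Rightarrow> complex mat \<Rightarrow> complex mat" where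
  "bordered a X = mat (Suc (dim_row X)) (Suc (dim_col X))
     (\<lambda>(i,j). case i of 0 \<Rightarrow> (case j of 0 \<Rightarrow> a | Suc _ \<Rightarrow> 0)
        | Suc i' \<Rightarrow> (case j of 0 \<Rightarrow> 0 | Suc j' \<Rightarrow> X $$ (i',j')))"

lemma bordered_carrier [simp]:
  "X \<in> carrier_mat n n \<Longrightarrow> bordered a X \<in> carrier_mat (Suc n) (Suc n)"
  by (auto simp: bordered_def)

lemma bordered_mult:
  assumes "X \<in> carrier_mat n n" "Y \<in> carrier_mat n n"
  shows "bordered a X * bordered b Y = bordered (a * b) (X * Y)"
  using assms
  by (intro eq_matI)
    (auto simp: bordered_def scalar_prod_def sum.atLeast0_lessThan_Suc_shift
      simp del: sum.op_ivl_Suc split: nat.splits)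

lemma adj_bordered: "X \<in> carrier_mat n n \<Longrightarrow> adj (bordered a X) = bordered (cnj a) (adj X)"
  by (intro eq_matI) (auto simp: bordered_def split: nat.splits)

lemma bordered_one: "bordered 1 (1\<^sub>m n) = 1\<^sub>m (Suc n)"
  by (intro eq_matI) (auto simp: bordered_def split: nat.splits)

lemma bordered_dg: "bordered (of_real e) (dg n p) = dg (Suc n) (case_nat e p)"
  by (intro eq_matI) (auto simp: bordered_def split: nat.splits)

text \<open>Completing \<open>v\<close> to a basis and orthogonalising keeps the first vector. The
  columns are then orthogonal but not normalised, so a diagonal factor rescales them; this is why
  \<open>v\<close> reappears only up to a scalar \<open>c\<close>.\<close>

lemma unitary_with_first_column:
  assumes v: "v \<in> carrier_vec n" "v \<noteq> 0\<^sub>v n"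
  obtains W c where "unitary n W" "col W 0 = c \<cdot>\<^sub>v v"
proof -
  interpret cof_vec_space n "TYPE(complex)" .
  define b where "b = basis_completion v"
  define ws where "ws = gram_schmidt n b"
  from v have n: "n > 0" by (cases n) auto
  from basis_completion[OF v, folded b_def]
  have dist_b: "distinct b" and indep: "\<not> lin_dep (set b)" and b: "set b \<subseteq> carrier_vec n"
    and hdb: "hd b = v" and len_b: "length b = n" by auto
  from hdb len_b n obtain vs where bv: "b = v # vs" by (cases b) auto
  from gram_schmidt_result[OF b dist_b indep refl, folded ws_def]
  have ws: "set ws \<subseteq> carrier_vec n" "corthogonal ws" "length ws = n"
    by (auto simp: len_b)
  from gram_schmidt_hd[OF v(1), of vs, folded bv] have hdws: "hd ws = v" unfolding ws_def by simp
  define W0 where "W0 = mat_of_cols n ws"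
  have W0: "W0 \<in> carrier_mat n n" using ws(3) unfolding W0_def by auto
  define s where "s i = (\<Sum>k<n. (cmod (W0 $$ (k,i)))\<^sup>2)" for i
  have wsi: "ws ! i \<in> carrier_vec n" if "i < n" for i using ws that by auto
  have colW: "col W0 i = ws ! i" if "i < n" for i
    using that ws wsi unfolding W0_def by (simp add: col_mat_of_cols)
  have gram: "(adj W0 * W0) $$ (i,j) = ws ! j \<bullet>c ws ! i" if "i < n" "j < n" for i j
    using that W0 wsi[OF that(1)] wsi[OF that(2)]
    by (auto simp: scalar_prod_def colW[OF that(1), symmetric] colW[OF that(2), symmetric] mult.commute
        intro!: sum.cong)
  have off: "(adj W0 * W0) $$ (i,j) = 0" if "i < n" "j < n" "i \<noteq> j" for i j
    using gram[OF that(1,2)] corthogonalD[OF ws(2)] that ws(3) by auto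
  have diag: "(adj W0 * W0) $$ (i,i) = of_real (s i)" if "i < n" for i
    using that W0
    by (auto simp: s_def scalar_prod_def atLeast0LessThan complex_norm_square mult.commute simp del: of_real_power)
  have s_pos: "s i > 0" if "i < n" for i
  proof -
    have "s i \<noteq> 0"
      using diag[OF that] gram[OF that that] corthogonalD[OF ws(2), of i i] that ws(3) by auto
    moreover have "s i \<ge> 0" unfolding s_def by (rule sum_nonneg) auto
    ultimately show ?thesis by simp
  qed
  define W where "W = W0 * dg n (\<lambda>i. 1 / sqrt (s i))"
  have W: "W \<in> carrier_mat n n" unfolding W_def using W0 by auto
  have "adj W * W = dg n (\<lambda>i. 1 / sqrt (s i)) * (adj W0 * W0) * dg n (\<lambda>i. 1 / sqrt (s i))"
    unfolding W_def using W0
    by (simp add: adj_mult[of _ n n _ n] mult_assoc4[of _ n])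
  also have "\<dots> = 1\<^sub>m n"
  proof (rule eq_matI)
    fix i j assume ij: "i < dim_row (1\<^sub>m n)" "j < dim_col (1\<^sub>m n)"
    have "(dg n (\<lambda>i. 1 / sqrt (s i)) * (adj W0 * W0) * dg n (\<lambda>i. 1 / sqrt (s i))) $$ (i,j)
       = of_real (1 / sqrt (s i)) * (adj W0 * W0) $$ (i,j) * of_real (1 / sqrt (s j))"
    proof -
      have "adj W0 * W0 \<in> carrier_mat n n" using W0 by auto
      then show ?thesis using ij
        by (simp add: dg_mult_right_index[of _ n n] dg_mult_left_index[of _ n n] mult_carrier_mat[of _ n n _ n]
            del: index_mult_mat(1))
    qed
    also have "\<dots> = (if i = j then 1 else 0)"
    proof (cases "i = j")
      case True
      have "sqrt (s j) * sqrt (s j) = s j" "s j > 0" using s_pos[of j] ij by auto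
      then show ?thesis using True ij diag[of j]
        by (simp add: field_simps flip: of_real_mult) 
    qed (use ij off in auto)
    finally show "(dg n (\<lambda>i. 1 / sqrt (s i)) * (adj W0 * W0) * dg n (\<lambda>i. 1 / sqrt (s i))) $$ (i,j)
       = 1\<^sub>m n $$ (i,j)" using ij by simp
  qed (use W0 in auto)
  finally have "unitary n W" by (intro unitaryI W)
  moreover have "col W 0 = of_real (1 / sqrt (s 0)) \<cdot>\<^sub>v v"
  proof -
    have v0: "v = col W0 0" using colW[OF n] hdws ws(3) n by (cases ws) auto
    show ?thesis unfolding v0 W_def using W0 n
      by (intro eq_vecI) (auto simp: dg_mult_right_index[of _ n n] simp del: index_mult_mat(1))
  qed
  ultimately show ?thesis using that by blast
qed

text \<open>A spectral decomposition as a relation: eigenvectors in the columns of \<open>U\<close>,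
  eigenvalues in any order, \<open>p\<close> arbitrary beyond \<open>N\<close>. Since
  \<open>U\<close> is explicit, several commuting matrices can share it.\<close>

definition spec :: "nat \<Rightarrow> complex mat \<Rightarrow> (nat \<Rightarrow> real) \<Rightarrow> complex mat \<Rightarrow> bool" where
  "spec N U p A \<longleftrightarrow> unitary N U \<and> A = U * dg N p * adj U"

lemma specD:
  assumes "spec N U p A"
  shows "unitary N U" "U \<in> carrier_mat N N" "A \<in> carrier_mat N N" "A = U * dg N p * adj U"
    "adj U * A * U = dg N p"
proof -
  show U: "unitary N U" and A: "A = U * dg N p * adj U" using assms by (auto simp: spec_def)
  show c: "U \<in> carrier_mat N N" by (rule unitaryD[OF U])
  show cA: "A \<in> carrier_mat N N" unfolding A using c by auto
  have "adj U * A * U = (adj U * U) * dg N p * (adj U * U)" unfolding A using c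
    by (simp add: assoc_mult_mat[of _ N N _ N _ N] mult_carrier_mat[of _ N N _ N])
  then show "adj U * A * U = dg N p" using unitaryD[OF U] c by (simp add: left_mult_one_mat[of _ N N] right_mult_one_mat[of _ N N])
qed

lemma spec_transform:
  assumes W: "unitary N W" and "A \<in> carrier_mat N N" and "spec N V p (adj W * A * W)"
  shows "spec N (W * V) p A"
proof -
  note c = unitaryD(1)[OF W] assms(2) specD(2)[OF assms(3)]
  have "A = (W * adj W) * A * (W * adj W)" using c unitaryD[OF W] by simp
  also have "\<dots> = W * (adj W * A * W) * adj W"
    using c by (simp add: assoc_mult_mat[of _ N N _ N _ N] mult_carrier_mat[of _ N N _ N])
  also have "\<dots> = W * (V * dg N p * adj V) * adj W"
    using specD(4)[OF assms(3)] by simp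
  also have "\<dots> = (W * V) * dg N p * adj (W * V)"
    using c by (simp add: adj_mult[of _ N N _ N] assoc_mult_mat[of _ N N _ N _ N] mult_carrier_mat[of _ N N _ N])
  finally show ?thesis
    using unitary_mult[OF W specD(1)[OF assms(3)]] by (simp add: spec_def)
qed

text \<open>Deflation: conjugation by a unitary whose first column is an eigenvector clears the
  first column below the diagonal. Self-adjointness then clears the first row and makes the
  eigenvalue real, and the remaining block is handled by induction.\<close>

theorem hermitian_spec:
  assumes "A \<in> carrier_mat N N" "hermitian A"
  shows "\<exists>U p. spec N U p A"
  using assms
proof (induction N arbitrary: A)
  case 0
  then have "spec 0 (1\<^sub>m 0) (\<lambda>_. 0) A"
    by (auto simp: spec_def unitary_def intro!: eq_matI)
  then show ?case by blast
next
  case (Suc n)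
  note A = Suc.prems(1) and herm = Suc.prems(2)
  from spectrum_non_empty[OF A] obtain e where "eigenvalue A e" by (auto simp: spectrum_def)
  then obtain v where v: "v \<in> carrier_vec (Suc n)" "v \<noteq> 0\<^sub>v (Suc n)" "A *\<^sub>v v = e \<cdot>\<^sub>v v"
    using A by (auto simp: eigenvalue_def eigenvector_def)
  obtain W c where W: "unitary (Suc n) W" and col: "col W 0 = c \<cdot>\<^sub>v v"
    using unitary_with_first_column[OF v(1,2)] .
  note cW = unitaryD(1)[OF W]
  define A' where "A' = adj W * A * W"
  have A': "A' \<in> carrier_mat (Suc n) (Suc n)" unfolding A'_def using cW A by auto
  have adjA': "adj A' = A'" unfolding A'_def using cW A herm
    by (simp add: adj_mult[of _ "Suc n" "Suc n" _ "Suc n"] hermitian_def assoc_mult_mat[of _ "Suc n" "Suc n" _ "Suc n" _ "Suc n"])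
  have A'0: "A' $$ (i,0) = (if i = 0 then e else 0)" if i: "i < Suc n" for i
  proof -
    have "A' $$ (i,0) = row (adj W) i \<bullet> col (A * W) 0"
      unfolding A'_def using cW A i by (simp add: assoc_mult_mat[of _ "Suc n" "Suc n" _ "Suc n" _ "Suc n"])
    also have "col (A * W) 0 = A *\<^sub>v col W 0"
      using cW A by (intro col_mult2[of _ "Suc n" "Suc n" _ "Suc n"]) auto
    also have "\<dots> = e \<cdot>\<^sub>v col W 0"
      unfolding col using A v by (simp add: mult_mat_vec[of _ "Suc n" "Suc n"] smult_smult_assoc mult.commute)
    also have "row (adj W) i \<bullet> (e \<cdot>\<^sub>v col W 0) = e * (adj W * W) $$ (i,0)"
      using cW i by simp
    also have "\<dots> = (if i = 0 then e else 0)" using unitaryD(3)[OF W] i by simp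
    finally show ?thesis .
  qed
  have sym: "A' $$ (i,j) = cnj (A' $$ (j,i))" if "i < Suc n" "j < Suc n" for i j
    using adjA' adj_index[of i A' j] A' that by auto
  have A'0r: "A' $$ (0, Suc j) = 0" if "j < n" for j
    using sym[of 0 "Suc j"] A'0[of "Suc j"] that by simp
  have ereal: "e = of_real (Re e)"
    using sym[of 0 0] A'0[of 0] by (simp add: complex_eq_iff)
  define B where "B = mat n n (\<lambda>(i,j). A' $$ (Suc i, Suc j))"
  have B: "B \<in> carrier_mat n n" unfolding B_def by auto
  have "hermitian B" unfolding hermitian_def
    by (rule eq_matI) (auto simp: B_def intro!: sym[symmetric])
  from Suc.IH[OF B this] obtain U p where U: "spec n U p B" by blast
  note cU = specD(2)[OF U]
  have "A' = bordered e B"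
    using A' A'0 A'0r by (intro eq_matI) (auto simp: bordered_def B_def split: nat.splits)
  also have "\<dots> = bordered 1 U * bordered e (dg n p) * bordered 1 (adj U)"
    using cU specD(4)[OF U] by (simp add: bordered_mult[of _ n])
  also have "\<dots> = bordered 1 U * dg (Suc n) (case_nat (Re e) p) * adj (bordered 1 U)"
    using cU ereal bordered_dg[of "Re e" n p] by (simp add: adj_bordered[of _ n])
  finally have eq: "A' = bordered 1 U * dg (Suc n) (case_nat (Re e) p) * adj (bordered 1 U)" .
  have "unitary (Suc n) (bordered 1 U)"
    using cU unitaryD[OF specD(1)[OF U]]
    by (intro unitaryI) (auto simp: adj_bordered[of _ n] bordered_mult[of _ n] bordered_one)
  then have "spec (Suc n) (bordered 1 U) (case_nat (Re e) p) A'"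
    using eq by (simp add: spec_def)
  then show ?case using spec_transform[OF W A] unfolding A'_def by blast
qed

subsection \<open>Positive semidefinite matrices\<close>

lemma row_adj: "i < dim_col X \<Longrightarrow> row (adj X) i = conjugate (col X i)"
  by (rule eq_vecI) auto

lemma quad_form_index:
  assumes "X \<in> carrier_mat N M" "A \<in> carrier_mat N N" "i < M"
  shows "(adj X * A * X) $$ (i,i) = (A *\<^sub>v col X i) \<bullet>c col X i"
proof -
  have "(adj X * A * X) $$ (i,i) = row (adj X) i \<bullet> col (A * X) i"
    using assms by (simp add: assoc_mult_mat[of _ M N _ N _ M])
  also have "col (A * X) i = A *\<^sub>v col X i"
    using assms by (intro col_mult2[of _ N N _ M]) auto
  also have "row (adj X) i \<bullet> (A *\<^sub>v col X i) = (A *\<^sub>v col X i) \<bullet>c col X i"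
    using assms by (subst row_adj) (auto intro!: comm_scalar_prod[of _ N])
  finally show ?thesis .
qed

lemma gram_diag:
  assumes "Y \<in> carrier_mat M K" "i < K"
  shows "(adj Y * Y) $$ (i,i) = of_real (\<Sum>k<M. (cmod (Y $$ (k,i)))\<^sup>2)"
  using assms
  by (auto simp: scalar_prod_def atLeast0LessThan complex_norm_square mult.commute simp del: of_real_power)

lemma psd_gram:
  assumes B: "B \<in> carrier_mat M N"
  shows "psd N (adj B * B)"
  unfolding psd_def
proof (intro conjI ballI)
  show "adj B * B \<in> carrier_mat N N" using B by auto
  show "hermitian (adj B * B)" using B by (simp add: hermitian_def adj_mult[of _ N M _ N])
  fix v :: "complex vec" assume v: "v \<in> carrier_vec N"
  \<comment> \<open>The vector becomes a one-column matrix, so that the quadratic form is a diagonal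
    entry of the Gram matrix of \<open>B * X\<close>.\<close>
  define X where "X = mat_of_cols N [v]"
  have X: "X \<in> carrier_mat N 1" unfolding X_def by auto
  have col: "col X 0 = v" using v unfolding X_def by (simp add: col_mat_of_cols)
  have "((adj B * B) *\<^sub>v v) \<bullet>c v = (adj X * (adj B * B) * X) $$ (0,0)"
    using quad_form_index[of X N 1 "adj B * B" 0] X B col by (simp del: index_mult_mat(1) add: mult_carrier_mat[of _ N M _ N])
  also have "adj X * (adj B * B) * X = adj (B * X) * (B * X)"
    using B X by (simp add: adj_mult[of _ M N _ "Suc 0"] assoc_mult_mat[of _ "Suc 0" N _ M _ "Suc 0"]
       assoc_mult_mat[of _ "Suc 0" N _ N _ "Suc 0"] assoc_mult_mat[of _ N M _ N _ "Suc 0"]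
       mult_carrier_mat[of _ N M _ N])
  finally have e: "((adj B * B) *\<^sub>v v) \<bullet>c v = of_real (\<Sum>k<M. (cmod ((B * X) $$ (k,0)))\<^sup>2)"
    using gram_diag[of "B * X" M 1 0] B X by simp
  show "Im (((adj B * B) *\<^sub>v v) \<bullet>c v) = 0" "Re (((adj B * B) *\<^sub>v v) \<bullet>c v) \<ge> 0"
    unfolding e by (auto intro: sum_nonneg)
qed

lemma psdD:
  assumes "psd N A"
  shows "A \<in> carrier_mat N N" "adj A = A"
  using assms by (auto simp: psd_def hermitian_def)

lemma spec_hermitian: "spec N U p A \<Longrightarrow> adj A = A"
  using specD(2)[of N U p A] specD(4)[of N U p A]
  by (simp add: adj_mult[of _ N N _ N] mult_carrier_mat[of _ N N _ N] assoc_mult_mat[of _ N N _ N _ N])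

lemma psd_spec_nonneg:
  assumes "psd N A" "spec N U p A" "i < N"
  shows "p i \<ge> 0"
proof -
  have "of_real (p i) = (A *\<^sub>v col U i) \<bullet>c col U i"
    using quad_form_index[OF specD(2,3)[OF assms(2)] assms(3)] assms(3)
    unfolding specD(5)[OF assms(2)] by simp
  moreover have "col U i \<in> carrier_vec N" using specD(2)[OF assms(2)] by auto
  ultimately have "Re (complex_of_real (p i)) \<ge> 0" using assms(1) unfolding psd_def by simp
  then show ?thesis by simp
qed

lemma psd_spec:
  assumes "psd N A"
  obtains U p where "spec N U p A" "\<And>i. i < N \<Longrightarrow> p i \<ge> 0"
  using hermitian_spec[of A N] psd_spec_nonneg[OF assms] assms unfolding psd_def by blast

lemma spec_factor:
  assumes "spec N U p A" "\<And>i. i < N \<Longrightarrow> p i \<ge> 0"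
  shows "A = adj (dg N (\<lambda>i. sqrt (p i)) * adj U) * (dg N (\<lambda>i. sqrt (p i)) * adj U)"
proof -
  note c = specD(2)[OF assms(1)]
  have "adj (dg N (\<lambda>i. sqrt (p i)) * adj U) * (dg N (\<lambda>i. sqrt (p i)) * adj U)
     = U * (dg N (\<lambda>i. sqrt (p i)) * dg N (\<lambda>i. sqrt (p i))) * adj U"
    using c by (simp add: adj_mult[of _ N N _ N] mult_assoc4[of _ N] del: dg_mult)
  also have "dg N (\<lambda>i. sqrt (p i)) * dg N (\<lambda>i. sqrt (p i)) = dg N p"
    using assms(2) by (auto intro: dg_cong)
  finally show ?thesis using specD(4)[OF assms(1)] by simp
qed

lemma spec_psd: "spec N U p A \<Longrightarrow> (\<And>i. i < N \<Longrightarrow> p i \<ge> 0) \<Longrightarrow> psd N A"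
  using spec_factor[of N U p A] psd_gram[of "dg N (\<lambda>i. sqrt (p i)) * adj U" N N] specD(2)[of N U p A]
  by (metis adj_carrier dg_carrier mult_carrier_mat)

lemma psd_factor:
  assumes "psd N A"
  obtains B where "B \<in> carrier_mat N N" "A = adj B * B"
  using psd_spec[OF assms] spec_factor specD(2) by (metis adj_carrier dg_carrier mult_carrier_mat)

lemma psd_congruence:
  assumes "psd N A" "X \<in> carrier_mat N M"
  shows "psd M (adj X * A * X)"
proof -
  obtain B where B: "B \<in> carrier_mat N N" "A = adj B * B" using psd_factor[OF assms(1)] .
  have "adj X * A * X = adj (B * X) * (B * X)" unfolding B(2) using B(1) assms(2)
    by (simp add: adj_mult[of _ N N _ M] assoc_mult_mat[of _ M N _ N _ M] assoc_mult_mat[of _ M N _ N _ N]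
       assoc_mult_mat[of _ N N _ N _ M] mult_carrier_mat[of _ N N _ N] mult_carrier_mat[of _ N N _ M])
  then show ?thesis using psd_gram[of "B * X" N M] B assms(2) by auto
qed

lemma psd_add:
  assumes "psd N A" "psd N B"
  shows "psd N (A + B)"
proof -
  note c = psdD[OF assms(1)] psdD[OF assms(2)]
  show ?thesis
    using assms c adj_add[of A N N B]
    by (auto simp: psd_def hermitian_def add_mult_distrib_mat_vec[of _ N N] add_scalar_prod_distrib[of _ N])
qed

lemma psd_smult:
  assumes "psd N A" "c \<ge> 0"
  shows "psd N (complex_of_real c \<cdot>\<^sub>m A)"
proof -
  obtain B where B: "B \<in> carrier_mat N N" "A = adj B * B" using psd_factor[OF assms(1)] .
  have "complex_of_real c \<cdot>\<^sub>m A = adj (complex_of_real (sqrt c) \<cdot>\<^sub>m B) * (complex_of_real (sqrt c) \<cdot>\<^sub>m B)"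
    unfolding B(2) using B(1) assms(2)
    by (intro eq_matI)
      (auto simp: adj_smult mult_smult_distrib[of _ N N _ N] mult_smult_assoc_mat[of _ N N _ N]
        simp flip: of_real_mult mult.assoc)
  then show ?thesis using psd_gram[of "complex_of_real (sqrt c) \<cdot>\<^sub>m B" N N] B by simp
qed

lemma psd_one: "psd N (1\<^sub>m N)"
  using psd_gram[of "1\<^sub>m N" N N] by simp

lemma psd_zero: "psd N (0\<^sub>m N N)"
  using psd_gram[of "0\<^sub>m N N" N N] by simp

lemma psd_diag_nonneg: "psd N A \<Longrightarrow> i < N \<Longrightarrow> Re (A $$ (i,i)) \<ge> 0"
  by (erule psd_factor) (auto simp: gram_diag simp del: index_mult_mat(1) intro: sum_nonneg)

section \<open>Real traces and trace inequalities\<close>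

lemma rtr_linear:
  assumes "A \<in> carrier_mat N N" "B \<in> carrier_mat N N"
  shows "rtr (A + B) = rtr A + rtr B" "rtr (A - B) = rtr A - rtr B" "rtr (complex_of_real c \<cdot>\<^sub>m A) = c * rtr A"
  using assms by (auto simp: rtr_def mtrace_add mtrace_minus mtrace_smult)

lemma rtr_mult_comm: "A \<in> carrier_mat n m \<Longrightarrow> B \<in> carrier_mat m n \<Longrightarrow> rtr (A * B) = rtr (B * A)"
  by (simp add: rtr_def mtrace_mult_comm)

lemma rtr_mult_right:
  assumes "A \<in> carrier_mat N N" "B \<in> carrier_mat N N" "C \<in> carrier_mat N N"
  shows "rtr (A * (B + C)) = rtr (A * B) + rtr (A * C)" "rtr (A * (B - C)) = rtr (A * B) - rtr (A * C)"
    "rtr (A * (complex_of_real c \<cdot>\<^sub>m B)) = c * rtr (A * B)"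
  using assms
  by (auto simp: mult_add_distrib_mat[of _ N N _ N] mult_minus_distrib_mat[of _ N N _ N]
      mult_smult_distrib[of _ N N _ N] rtr_linear[of _ N])

lemma rtr_mult_left:
  assumes "A \<in> carrier_mat N N" "B \<in> carrier_mat N N" "C \<in> carrier_mat N N"
  shows "rtr ((B + C) * A) = rtr (B * A) + rtr (C * A)" "rtr ((B - C) * A) = rtr (B * A) - rtr (C * A)"
    "rtr ((complex_of_real c \<cdot>\<^sub>m B) * A) = c * rtr (B * A)"
  using assms
  by (auto simp: add_mult_distrib_mat[of _ N N _ _ N] minus_mult_distrib_mat[of _ N N _ _ N]
      mult_smult_assoc_mat[of _ N N _ N] rtr_linear[of _ N])

lemma rtr_gram_nonneg: "Y \<in> carrier_mat M K \<Longrightarrow> rtr (adj Y * Y) \<ge> 0"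
  by (auto simp: rtr_def mtrace_def gram_diag simp del: index_mult_mat(1) intro!: sum_nonneg)

text \<open>By cyclicity the trace is the squared Hilbert-Schmidt norm of \<open>C * adj D\<close>,
  where \<open>C\<close> and \<open>D\<close> are Gram factors of \<open>A\<close> and
  \<open>B\<close>.\<close>

lemma rtr_psd_mult_nonneg:
  assumes "psd N A" "psd N B"
  shows "rtr (A * B) \<ge> 0"
proof -
  obtain C where C: "C \<in> carrier_mat N N" "A = adj C * C" using psd_factor[OF assms(1)] .
  obtain D where D: "D \<in> carrier_mat N N" "B = adj D * D" using psd_factor[OF assms(2)] .
  have "rtr (A * B) = rtr ((adj C * C * adj D) * D)"
    unfolding C(2) D(2) using C(1) D(1)
    by (simp add: assoc_mult_mat[of _ N N _ N _ N] mult_carrier_mat[of _ N N _ N])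
  also have "\<dots> = rtr (D * (adj C * C * adj D))"
    using C D by (intro rtr_mult_comm[of _ N N]) auto
  also have "D * (adj C * C * adj D) = adj (C * adj D) * (C * adj D)"
    using C(1) D(1)
    by (simp add: adj_mult[of _ N N _ N] assoc_mult_mat[of _ N N _ N _ N] mult_carrier_mat[of _ N N _ N])
  also have "rtr \<dots> \<ge> 0" using C D by (intro rtr_gram_nonneg[of _ N N]) auto
  finally show ?thesis .
qed

lemma rtr_mono_right:
  assumes "psd N A" "psd N (C - B)" "B \<in> carrier_mat N N" "C \<in> carrier_mat N N"
  shows "rtr (A * B) \<le> rtr (A * C)"
  using rtr_psd_mult_nonneg[OF assms(1,2)] rtr_mult_right(2)[of A N C B] psdD[OF assms(1)] assms(3,4) by simp

lemma rtr_mono_left: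
  assumes "psd N A" "psd N (C - B)" "B \<in> carrier_mat N N" "C \<in> carrier_mat N N"
  shows "rtr (B * A) \<le> rtr (C * A)"
  using rtr_mono_right[OF assms] rtr_mult_comm[of A N N] psdD[OF assms(1)] assms(3,4) by simp

lemma mtrace_hermitian_mult_real:
  assumes "A \<in> carrier_mat N N" "adj A = A" "B \<in> carrier_mat N N" "adj B = B"
  shows "mtrace (A * B) = of_real (rtr (A * B))"
proof -
  have "cnj (mtrace (A * B)) = mtrace (adj (A * B))"
    using assms by (simp add: mtrace_adj[of _ N])
  also have "\<dots> = mtrace (A * B)"
    using assms by (simp add: adj_mult[of _ N N _ N] mtrace_mult_comm[of B N N])
  finally show ?thesis by (simp add: rtr_def complex_eq_iff)
qed

text \<open>In the eigenbasis of \<open>A\<close> only the diagonal of \<open>B\<close> contributes.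
  Through this identity quantum traces become finite weighted sums.\<close>

lemma rtr_spec_mult:
  assumes "spec N U p A" "B \<in> carrier_mat N N"
  shows "rtr (B * A) = (\<Sum>i<N. p i * Re ((adj U * B * U) $$ (i,i)))"
proof -
  note c = specD(2)[OF assms(1)] assms(2)
  have "rtr (B * A) = rtr ((B * U * dg N p) * adj U)"
    using specD(4)[OF assms(1)] c by (simp add: assoc_mult_mat[of _ N N _ N _ N] mult_carrier_mat[of _ N N _ N])
  also have "\<dots> = rtr (adj U * (B * U * dg N p))"
    using c by (intro rtr_mult_comm[of _ N N]) auto
  also have "adj U * (B * U * dg N p) = (adj U * B * U) * dg N p"
    using c by (simp add: assoc_mult_mat[of _ N N _ N _ N] mult_carrier_mat[of _ N N _ N])
  also have "rtr \<dots> = (\<Sum>i<N. p i * Re ((adj U * B * U) $$ (i,i)))"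
    using c
    by (simp add: rtr_def mtrace_def dg_mult_right_index[of _ N N] mult_carrier_mat[of _ N N _ N] mult.commute
        del: index_mult_mat(1))
  finally show ?thesis .
qed

lemma rtr_spec:
  assumes "spec N U p A" shows "rtr A = (\<Sum>i<N. p i)"
  using rtr_spec_mult[OF assms, of "1\<^sub>m N"] specD[OF assms] unitaryD(3)[OF specD(1)[OF assms]]
  by simp

lemma unitary_diag_sum:
  assumes "unitary N V" "B \<in> carrier_mat N N"
  shows "(\<Sum>i<N. Re ((adj V * B * V) $$ (i,i))) = rtr B"
proof -
  have "spec N V (\<lambda>_. 1) (1\<^sub>m N)"
    using assms(1) unitaryD[OF assms(1)] by (simp add: spec_def right_mult_one_mat[of _ N N])
  from rtr_spec_mult[OF this assms(2)] show ?thesis using assms(2) by simp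
qed

section \<open>Density operators and tests\<close>

lemma densityD:
  assumes "A \<in> density N"
  shows "psd N A" "A \<in> carrier_mat N N" "adj A = A" "rtr A = 1" "N > 0"
proof -
  show *: "psd N A" "A \<in> carrier_mat N N" "adj A = A" "rtr A = 1"
    using assms psdD[of N A] by (auto simp: density_def rtr_def)
  show "N > 0" using *(2,4) by (cases N) (auto simp: rtr_def mtrace_def)
qed

lemma densityI:
  assumes "psd N A" "rtr A = 1"
  shows "A \<in> density N"
  using assms mtrace_hermitian_mult_real[of A N "1\<^sub>m N"] psdD[OF assms(1)]
  by (simp add: density_def)

lemma density_spec:
  assumes "A \<in> density N" "spec N U p A"
  shows "\<And>i. i < N \<Longrightarrow> p i \<ge> 0" "(\<Sum>i<N. p i) = 1" "\<And>i. i < N \<Longrightarrow> p i \<le> 1"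
proof -
  show *: "\<And>i. i < N \<Longrightarrow> p i \<ge> 0" by (rule psd_spec_nonneg[OF densityD(1)[OF assms(1)] assms(2)])
  show s: "(\<Sum>i<N. p i) = 1" using rtr_spec[OF assms(2)] densityD[OF assms(1)] by simp
  show "p i \<le> 1" if "i < N" for i
    using member_le_sum[of i "{..<N}" p] * that s by auto
qed

lemma spec_minus:
  assumes "spec N U p A" "spec N U q B"
  shows "spec N U (\<lambda>i. p i - q i) (A - B)"
proof -
  note c = specD(2)[OF assms(1)]
  have "dg N (\<lambda>i. p i - q i) = dg N p - dg N q" by (rule eq_matI) auto
  moreover have "U * (dg N p - dg N q) * adj U = U * dg N p * adj U - U * dg N q * adj U"
    using c by (simp add: mult_minus_distrib_mat[of _ N N _ N] minus_mult_distrib_mat[of _ N N _ _ N] mult_carrier_mat[of _ N N _ N])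
  ultimately show ?thesis using assms by (simp add: spec_def)
qed

lemma spec_smult: "spec N U p A \<Longrightarrow> spec N U (\<lambda>i. c * p i) (complex_of_real c \<cdot>\<^sub>m A)"
proof -
  assume a: "spec N U p A"
  note c = specD(2)[OF a]
  have "dg N (\<lambda>i. c * p i) = complex_of_real c \<cdot>\<^sub>m dg N p" by (rule eq_matI) auto
  moreover have "U * (complex_of_real c \<cdot>\<^sub>m dg N p) * adj U = complex_of_real c \<cdot>\<^sub>m (U * dg N p * adj U)"
    using c by (simp add: mult_smult_distrib[of _ N N _ N] mult_smult_assoc_mat[of _ N N _ N] mult_carrier_mat[of _ N N _ N])
  ultimately show ?thesis using a by (simp add: spec_def)
qed

lemma spec_one: "unitary N U \<Longrightarrow> spec N U (\<lambda>_. 1) (1\<^sub>m N)"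
  using unitaryD[of N U] by (simp add: spec_def right_mult_one_mat[of _ N N])

lemma density_le_one: "A \<in> density N \<Longrightarrow> psd N (1\<^sub>m N - A)"
  using psd_spec[OF densityD(1)] density_spec spec_psd spec_minus[OF spec_one[OF specD(1)]]
  by (metis diff_ge_0_iff_ge)

lemma spec_exists: "unitary N U \<Longrightarrow> spec N U p (U * dg N p * adj U)"
  by (simp add: spec_def)

lemma povm_spec:
  assumes "unitary N U" "\<And>i. i < N \<Longrightarrow> 0 \<le> p i" "\<And>i. i < N \<Longrightarrow> p i \<le> 1"
  shows "povm_elem N (U * dg N p * adj U)"
  unfolding povm_elem_def
  using spec_psd[OF spec_exists[OF assms(1)], of p] assms(2,3)
    spec_psd[OF spec_minus[OF spec_one[OF assms(1)] spec_exists[OF assms(1), of p]]] by simp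

lemma povmD:
  assumes "povm_elem N A"
  shows "psd N A" "psd N (1\<^sub>m N - A)" "A \<in> carrier_mat N N" "adj A = A"
  using assms psdD[of N A] by (auto simp: povm_elem_def)

lemma povm_rtr_bounds:
  assumes "povm_elem N A" "psd N \<omega>"
  shows "0 \<le> rtr (A * \<omega>)" "rtr (A * \<omega>) \<le> rtr \<omega>"
  using rtr_psd_mult_nonneg[OF povmD(1)[OF assms(1)] assms(2)]
    rtr_mono_left[OF assms(2) povmD(2)[OF assms(1)]] povmD(3)[OF assms(1)] psdD[OF assms(2)] by auto

subsection \<open>Functional calculus\<close>

text \<open>\<open>mat_fun\<close> chooses some diagonalisation, so independence of the choice is
  needed. The matrix \<open>W\<close> intertwines \<open>D\<close> and \<open>E\<close>; hence it
  has nonzero entries only between equal eigenvalues, and it intertwines the images under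
  \<open>f\<close> as well.\<close>

lemma mat_fun_unique:
  fixes f :: "real \<Rightarrow> real"
  assumes U: "unitary N U" and V: "unitary N V"
    and D: "D \<in> carrier_mat N N" "diagonal_mat D" and E: "E \<in> carrier_mat N N" "diagonal_mat E"
    and eq: "U * D * adj U = V * E * adj V"
  shows "U * dg N (\<lambda>i. f (Re (D $$ (i,i)))) * adj U = V * dg N (\<lambda>i. f (Re (E $$ (i,i)))) * adj V"
proof -
  note cU = unitaryD[OF U] and cV = unitaryD[OF V]
  note asc = assoc_mult_mat[of _ N N _ N _ N] mult_carrier_mat[of _ N N _ N]
  define W where "W = adj V * U"
  have W: "W \<in> carrier_mat N N" unfolding W_def using cU cV by auto
  have VW: "V * W = U" unfolding W_def using cU cV by (simp flip: assoc_mult_mat[of _ N N _ N _ N])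
  have WU: "W * adj U = adj V" unfolding W_def using cU cV by (simp add: asc)
  have WD: "W * D = E * W"
  proof -
    have "W * D = adj V * (U * D * adj U) * U"
      unfolding W_def using cU cV D by (simp add: asc)
    also have "\<dots> = adj V * (V * E * adj V) * U" by (simp add: eq)
    also have "\<dots> = (adj V * V) * E * W"
      unfolding W_def using cU cV(1) E by (simp add: asc)
    finally show ?thesis using cV E W by simp
  qed
  have entry: "W $$ (i,j) = 0 \<or> D $$ (j,j) = E $$ (i,i)" if ij: "i < N" "j < N" for i j
  proof -
    have "(W * D) $$ (i,j) = (\<Sum>l<N. W $$ (i,l) * D $$ (l,j))"
      using index_mult_mat_sum[OF W D(1) ij] .
    also have "\<dots> = (\<Sum>l<N. if l = j then W $$ (i,j) * D $$ (j,j) else 0)"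
      using D ij by (intro sum.cong) (auto simp: diagonal_mat_def)
    finally have 1: "(W * D) $$ (i,j) = W $$ (i,j) * D $$ (j,j)" using ij by simp
    have "(E * W) $$ (i,j) = (\<Sum>l<N. E $$ (i,l) * W $$ (l,j))"
      using index_mult_mat_sum[OF E(1) W ij] .
    also have "\<dots> = (\<Sum>l<N. if l = i then E $$ (i,i) * W $$ (i,j) else 0)"
      using E ij by (intro sum.cong) (auto simp: diagonal_mat_def)
    finally have 2: "(E * W) $$ (i,j) = E $$ (i,i) * W $$ (i,j)" using ij by simp
    show ?thesis using 1 2 WD by auto
  qed
  let ?fD = "dg N (\<lambda>i. f (Re (D $$ (i,i))))" and ?fE = "dg N (\<lambda>i. f (Re (E $$ (i,i))))"
  have WfD: "W * ?fD = ?fE * W"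
    using W entry
    by (intro eq_matI)
      (fastforce simp: dg_mult_right_index[of _ N N] dg_mult_left_index[of _ N N] simp del: index_mult_mat(1))+
  have "U * ?fD * adj U = V * (W * ?fD) * adj U"
    unfolding VW[symmetric] using W cU cV(1) by (simp add: asc)
  also have "\<dots> = V * ?fE * (W * adj U)"
    unfolding WfD using W cU cV(1) by (simp add: asc)
  finally show ?thesis by (simp add: WU)
qed

lemma mat_fun_spec:
  assumes "spec N U p A"
  shows "mat_fun N f A = U * dg N (\<lambda>i. f (p i)) * adj U"
  unfolding mat_fun_def
proof (rule some_equality)
  have d: "diagonal_mat (dg N p)" by (auto simp: diagonal_mat_def)
  have eq: "mat_diag N (\<lambda>i. complex_of_real (f (Re (dg N p $$ (i, i))))) = dg N (\<lambda>i. f (p i))"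
    by (rule eq_matI) (auto simp: mat_diag_def)
  show "\<exists>U' D. unitary N U' \<and> D \<in> carrier_mat N N \<and> diagonal_mat D \<and> A = U' * D * adj U' \<and>
     U * dg N (\<lambda>i. f (p i)) * adj U = U' * mat_diag N (\<lambda>i. complex_of_real (f (Re (D $$ (i, i))))) * adj U'"
    using assms d eq by (intro exI[of _ U] exI[of _ "dg N p"]) (auto simp: spec_def)
  fix B assume "\<exists>U D. unitary N U \<and> D \<in> carrier_mat N N \<and> diagonal_mat D \<and> A = U * D * adj U \<and>
     B = U * mat_diag N (\<lambda>i. complex_of_real (f (Re (D $$ (i, i))))) * adj U"
  then obtain V D where V: "unitary N V" "D \<in> carrier_mat N N" "diagonal_mat D" "A = V * D * adj V"
    and B: "B = V * dg N (\<lambda>i. f (Re (D $$ (i, i)))) * adj V" by (auto simp: dg_def)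
  have "U * dg N (\<lambda>i. f (Re (dg N p $$ (i, i)))) * adj U = B"
    unfolding B using assms V d by (intro mat_fun_unique) (auto simp: spec_def)
  moreover have "dg N (\<lambda>i. f (Re (dg N p $$ (i, i)))) = dg N (\<lambda>i. f (p i))" by (rule dg_cong) auto
  ultimately show "B = U * dg N (\<lambda>i. f (p i)) * adj U" by simp
qed

text \<open>The case distinction in \<open>mat_log2\<close> disappears on nonnegative spectra
  because \<open>log 2 0 = 0\<close>.\<close>

lemma mat_log2_spec:
  assumes "spec N U p A" "\<And>i. i < N \<Longrightarrow> p i \<ge> 0"
  shows "spec N U (\<lambda>i. log 2 (p i)) (mat_log2 N A)"
proof -
  have "dg N (\<lambda>i. if 0 < p i then log 2 (p i) else 0) = dg N (\<lambda>i. log 2 (p i))"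
    using assms(2) by (intro dg_cong) (force simp: log_def dest: order.antisym)
  then show ?thesis
    unfolding mat_log2_def mat_fun_spec[OF assms(1)] using specD(1)[OF assms(1)] by (simp add: spec_def)
qed

subsection \<open>Kronecker products\<close>

lemma kron_carrier [simp]:
  "A \<in> carrier_mat n m \<Longrightarrow> B \<in> carrier_mat p q \<Longrightarrow> kron A B \<in> carrier_mat (n * p) (m * q)"
  by (auto simp: kron_def)

lemma kron_dim [simp]:
  "dim_row (kron A B) = dim_row A * dim_row B" "dim_col (kron A B) = dim_col A * dim_col B"
  by (auto simp: kron_def)

lemma kron_index:
  "i < dim_row A * dim_row B \<Longrightarrow> j < dim_col A * dim_col B \<Longrightarrow>
    kron A B $$ (i,j) = A $$ (i div dim_row B, j div dim_col B) * B $$ (i mod dim_row B, j mod dim_col B)"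
  by (auto simp: kron_def)

lemma div_mod_less:
  fixes i a b :: nat assumes "i < a * b" shows "i div b < a" "i mod b < b"
proof -
  have "b > 0" using assms by (cases b) auto
  then show "i div b < a" "i mod b < b" using assms by (auto simp: less_mult_imp_div_less)
qed

lemma sum_div_mod:
  fixes f :: "nat \<Rightarrow> nat \<Rightarrow> 'a :: comm_monoid_add"
  shows "(\<Sum>l<m * q. f (l div q) (l mod q)) = (\<Sum>a<m. \<Sum>b<q. f a b)"
proof -
  have "(\<Sum>a<m. \<Sum>b<q. f a b) = (\<Sum>(a,b)\<in>{..<m} \<times> {..<q}. f a b)"
    by (simp add: sum.cartesian_product)
  also have "\<dots> = (\<Sum>l<m * q. f (l div q) (l mod q))"
  proof (rule sum.reindex_bij_witness[where i = "\<lambda>l. (l div q, l mod q)" and j = "\<lambda>(a,b). a * q + b"])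
    fix x assume "x \<in> {..<m} \<times> {..<q}"
    then obtain a b where x: "x = (a,b)" "a < m" "b < q" by auto
    have "a * q + b < (a + 1) * q" using x by simp
    also have "\<dots> \<le> m * q" using x by (intro mult_le_mono1) auto
    finally show "(case x of (a, b) \<Rightarrow> a * q + b) \<in> {..<m * q}" using x by simp
  qed (auto dest: div_mod_less)
  finally show ?thesis by simp
qed

lemma kron_mult:
  assumes "A \<in> carrier_mat n m" "C \<in> carrier_mat m k" "B \<in> carrier_mat p q" "D \<in> carrier_mat q r"
  shows "kron A B * kron C D = kron (A * C) (B * D)"
proof (rule eq_matI)
  fix i j assume "i < dim_row (kron (A * C) (B * D))" "j < dim_col (kron (A * C) (B * D))"
  then have ij: "i < n * p" "j < k * r" using assms by auto
  have "(kron A B * kron C D) $$ (i,j) = (\<Sum>l<m * q. kron A B $$ (i,l) * kron C D $$ (l,j))"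
    using assms ij by (intro index_mult_mat_sum[of _ "n*p" _ _ "k*r"]) auto
  also have "\<dots> = (\<Sum>l<m * q. (\<lambda>a b. (A $$ (i div p, a) * C $$ (a, j div r)) * (B $$ (i mod p, b) * D $$ (b, j mod r)))
     (l div q) (l mod q))"
    using assms ij by (intro sum.cong) (auto simp: kron_index)
  also have "\<dots> = (\<Sum>a<m. \<Sum>b<q. (A $$ (i div p, a) * C $$ (a, j div r)) * (B $$ (i mod p, b) * D $$ (b, j mod r)))"
    by (rule sum_div_mod)
  also have "\<dots> = (A * C) $$ (i div p, j div r) * (B * D) $$ (i mod p, j mod r)"
    using assms div_mod_less[OF ij(1)] div_mod_less[OF ij(2)]
    by (simp add: index_mult_mat_sum[of _ n m _ k] index_mult_mat_sum[of _ p q _ r] sum_product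
         del: index_mult_mat(1))
  finally show "(kron A B * kron C D) $$ (i,j) = kron (A * C) (B * D) $$ (i,j)"
    using assms ij by (subst kron_index) auto
qed (use assms in auto)

lemma adj_kron: "adj (kron A B) = kron (adj A) (adj B)"
  by (rule eq_matI) (simp_all add: kron_index div_mod_less)

lemma kron_dg: "kron (dg n p) (dg m q) = dg (n * m) (\<lambda>i. p (i div m) * q (i mod m))"
proof (rule eq_matI)
  fix i j assume "i < dim_row (dg (n * m) (\<lambda>i. p (i div m) * q (i mod m)))"
    "j < dim_col (dg (n * m) (\<lambda>i. p (i div m) * q (i mod m)))"
  then have ij: "i < n * m" "j < n * m" by auto
  have "i = j" if "i div m = j div m" "i mod m = j mod m"
    using that by (metis div_mult_mod_eq)
  then show "kron (dg n p) (dg m q) $$ (i,j) = dg (n * m) (\<lambda>i. p (i div m) * q (i mod m)) $$ (i,j)"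
    using ij div_mod_less[OF ij(1)] div_mod_less[OF ij(2)] by (auto simp: kron_index)
qed auto

lemma kron_one: "kron (1\<^sub>m n) (1\<^sub>m m) = 1\<^sub>m (n * m)"
  using kron_dg[of n "\<lambda>_. 1" m "\<lambda>_. 1"] by simp

lemma unitary_kron: "unitary n U \<Longrightarrow> unitary m V \<Longrightarrow> unitary (n * m) (kron U V)"
  using unitaryD[of n U] unitaryD[of m V]
  by (intro unitaryI) (auto simp: adj_kron kron_mult[of _ n n _ n _ m m _ m] kron_one)

lemma spec_kron:
  assumes "spec n U p A" "spec m V q B"
  shows "spec (n * m) (kron U V) (\<lambda>i. p (i div m) * q (i mod m)) (kron A B)"
proof -
  note c = specD(2)[OF assms(1)] specD(2)[OF assms(2)]
  have "kron A B = kron (U * dg n p * adj U) (V * dg m q * adj V)"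
    using specD(4)[OF assms(1)] specD(4)[OF assms(2)] by simp
  also have "\<dots> = kron U V * kron (dg n p) (dg m q) * adj (kron U V)"
    using c by (simp add: adj_kron kron_mult[of _ n n _ n _ m m _ m] mult_carrier_mat[of _ n n _ n] mult_carrier_mat[of _ m m _ m])
  finally show ?thesis
    using unitary_kron[OF specD(1)[OF assms(1)] specD(1)[OF assms(2)]] by (simp add: spec_def kron_dg)
qed

lemma density_kron:
  assumes "A \<in> density n" "B \<in> density m"
  shows "kron A B \<in> density (n * m)"
proof -
  obtain U p where U: "spec n U p A" using psd_spec[OF densityD(1)[OF assms(1)]] by metis
  obtain V q where V: "spec m V q B" using psd_spec[OF densityD(1)[OF assms(2)]] by metis
  note s = spec_kron[OF U V]
  have "psd (n * m) (kron A B)"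
    using density_spec[OF assms(1) U] density_spec[OF assms(2) V]
    by (intro spec_psd[OF s] mult_nonneg_nonneg) (auto simp: div_mod_less)
  moreover have "rtr (kron A B) = 1"
    unfolding rtr_spec[OF s] sum_div_mod[of "\<lambda>a b. p a * q b"] sum_product[symmetric]
    using density_spec[OF assms(1) U] density_spec[OF assms(2) V] by simp
  ultimately show ?thesis by (rule densityI)
qed

lemma kron_assoc: "kron A (kron B C) = kron (kron A B) C"
proof (rule eq_matI)
  have key: "i mod (b * c) div c = i div c mod b" "i div (b * c) = i div c div b" 
    "i mod (b * c) mod c = i mod c" for i b c :: nat
    by (cases "c = 0"; auto simp: mod_mult2_eq div_mult2_eq mult.commute[of b c] mod_mod_cancel)+
  fix i j assume "i < dim_row (kron (kron A B) C)" "j < dim_col (kron (kron A B) C)"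
  then have ij: "i < dim_row A * dim_row B * dim_row C" "j < dim_col A * dim_col B * dim_col C"
     "i < dim_row A * (dim_row B * dim_row C)" "j < dim_col A * (dim_col B * dim_col C)" by (auto simp: mult.assoc)
  show "kron A (kron B C) $$ (i,j) = kron (kron A B) C $$ (i,j)"
    using ij div_mod_less[OF ij(1)] div_mod_less[OF ij(2)] div_mod_less[OF ij(3)] div_mod_less[OF ij(4)]
    by (simp add: kron_index key)
qed auto

lemma kron_one_left: "kron (1\<^sub>m 1) A = A"
  by (rule eq_matI) (auto simp: kron_index)

lemma tpow_add: "tpow (m + n) A = kron (tpow m A) (tpow n A)"
  by (induction m) (auto simp: kron_one_left kron_assoc simp del: One_nat_def)

lemma density_one: "1\<^sub>m 1 \<in> density 1"
  by (rule densityI[OF psd_one]) (simp add: rtr_def mtrace_def)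

lemma tpow_density: "A \<in> density d \<Longrightarrow> tpow n A \<in> density (d ^ n)"
  by (induction n) (auto simp: density_kron density_one simp del: One_nat_def)

subsection \<open>Spectral form of the relative entropy\<close>

definition moments :: "nat \<Rightarrow> (nat \<Rightarrow> real) \<Rightarrow> (nat \<Rightarrow> real) \<Rightarrow> real \<Rightarrow> real \<Rightarrow> bool" where
  "moments N w f a s \<longleftrightarrow> (\<forall>i<N. 0 \<le> w i) \<and> (\<Sum>i<N. w i) = 1 \<and>
     (\<Sum>i<N. w i * f i) = a \<and> (\<Sum>i<N. w i * (f i - a)\<^sup>2) = s"

lemma momentsI:
  assumes "\<And>i. i < N \<Longrightarrow> 0 \<le> w i" "(\<Sum>i<N. w i) = 1"
  shows "\<exists>a s. moments N w f a s"
  using assms by (auto simp: moments_def)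

text \<open>Mean and variance of a sum of independent variables. Additivity of \<open>h\<close> is
  only demanded where the weight is nonzero, since the product rule for the logarithm fails at zero
  eigenvalues.\<close>

lemma moments_kron:
  assumes 1: "moments n w f a s" and 2: "moments m w' f' a' s'"
    and w: "\<And>i. i < n * m \<Longrightarrow> v i = w (i div m) * w' (i mod m)"
    and h: "\<And>i. i < n * m \<Longrightarrow> v i \<noteq> 0 \<Longrightarrow> h i = f (i div m) + f' (i mod m)"
  shows "moments (n * m) v h (a + a') (s + s')"
proof -
  note d = 1[unfolded moments_def] 2[unfolded moments_def]
  have prod: "(\<Sum>i<n * m. x (i div m) * y (i mod m)) = (\<Sum>i<n. x i) * (\<Sum>i<m. y i)" for x y :: "nat \<Rightarrow> real"
    using sum_div_mod[of "\<lambda>a b. x a * y b" m n] by (simp add: sum_product)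
  have "0 \<le> v i" if "i < n * m" for i
    using that d div_mod_less[OF that] by (auto simp: w intro!: mult_nonneg_nonneg)
  moreover have "(\<Sum>i<n * m. v i) = 1"
    using prod[of w w'] d by (simp add: w)
  moreover have "(\<Sum>i<n * m. v i * h i) = a + a'"
  proof -
    have "(\<Sum>i<n * m. v i * h i)
       = (\<Sum>i<n * m. (w (i div m) * f (i div m)) * w' (i mod m) + w (i div m) * (w' (i mod m) * f' (i mod m)))"
      using w h by (intro sum.cong refl) (fastforce simp: algebra_simps)
    also have "\<dots> = a + a'"
      unfolding sum.distrib prod[of "\<lambda>i. w i * f i" w'] prod[of w "\<lambda>i. w' i * f' i"] using d by simp
    finally show ?thesis .
  qed
  moreover have "(\<Sum>i<n * m. v i * (h i - (a + a'))\<^sup>2) = s + s'"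
  proof -
    have "(\<Sum>i<n * m. v i * (h i - (a + a'))\<^sup>2)
       = (\<Sum>i<n * m. (w (i div m) * (f (i div m) - a)\<^sup>2) * w' (i mod m)
            + w (i div m) * (w' (i mod m) * (f' (i mod m) - a')\<^sup>2)
            + (2 * w (i div m) * (f (i div m) - a)) * (w' (i mod m) * (f' (i mod m) - a')))"
    proof (intro sum.cong refl)
      fix i assume i: "i \<in> {..<n * m}"
      show "v i * (h i - (a + a'))\<^sup>2 = (w (i div m) * (f (i div m) - a)\<^sup>2) * w' (i mod m)
            + w (i div m) * (w' (i mod m) * (f' (i mod m) - a')\<^sup>2)
            + (2 * w (i div m) * (f (i div m) - a)) * (w' (i mod m) * (f' (i mod m) - a'))"
      proof (cases "v i = 0")
        case True
        then have "w (i div m) = 0 \<or> w' (i mod m) = 0" using w i by auto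
        then show ?thesis using True by auto
      next
        case False
        then have "h i = f (i div m) + f' (i mod m)" using h i by simp
        moreover have "v i = w (i div m) * w' (i mod m)" using w i by simp
        ultimately show ?thesis by (simp add: power2_eq_square algebra_simps)
      qed
    qed
    also have "\<dots> = s + s'"
    proof -
      \<comment> \<open>The covariance term factorises, and its first factor vanishes because
        \<open>f - a\<close> is centred.\<close>
      have "(\<Sum>i<n. 2 * w i * (f i - a)) = 0"
      proof -
        have "(\<Sum>i<n. 2 * w i * (f i - a)) = 2 * ((\<Sum>i<n. w i * f i) - a * (\<Sum>i<n. w i))"
          by (simp add: sum_distrib_left sum_subtractf algebra_simps)
        then show ?thesis using d by simp
      qed
      then show ?thesis
        unfolding sum.distrib prod[of "\<lambda>i. w i * (f i - a)\<^sup>2" w'] prod[of w "\<lambda>i. w' i * (f' i - a')\<^sup>2"]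
          prod[of "\<lambda>i. 2 * w i * (f i - a)" "\<lambda>i. w' i * (f' i - a')"] using d by simp
    qed
    finally show ?thesis .
  qed
  ultimately show ?thesis by (simp add: moments_def)
qed

lemma moments_chebyshev:
  assumes m: "moments N w f a s" and x: "x > 0" and S: "S \<subseteq> {..<N}"
    and far: "\<And>i. i \<in> S \<Longrightarrow> w i \<noteq> 0 \<Longrightarrow> \<bar>f i - a\<bar> \<ge> x"
  shows "(\<Sum>i\<in>S. w i) \<le> s / x\<^sup>2"
proof -
  have w: "w i \<ge> 0" if "i < N" for i using m that by (auto simp: moments_def)
  have "(\<Sum>i\<in>S. w i) * x\<^sup>2 = (\<Sum>i\<in>S. w i * x\<^sup>2)" by (rule sum_distrib_right)
  also have "\<dots> \<le> (\<Sum>i\<in>S. w i * (f i - a)\<^sup>2)"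
  proof (rule sum_mono)
    fix i assume i: "i \<in> S"
    show "w i * x\<^sup>2 \<le> w i * (f i - a)\<^sup>2"
    proof (cases "w i = 0")
      case False
      have "x\<^sup>2 \<le> \<bar>f i - a\<bar>\<^sup>2" using far[OF i False] x by (intro power_mono) auto
      then show ?thesis using w[of i] i S by (auto intro!: mult_left_mono)
    qed simp
  qed
  also have "\<dots> \<le> (\<Sum>i<N. w i * (f i - a)\<^sup>2)" using S w by (intro sum_mono2) auto
  also have "\<dots> = s" using m by (simp add: moments_def)
  finally show ?thesis using x by (simp add: field_simps)
qed

text \<open>The outcome distribution of a measurement of \<open>\<rho>\<close> in the orthonormal
  basis formed by the columns of \<open>V\<close>.\<close>

definition wt :: "complex mat \<Rightarrow> complex mat \<Rightarrow> nat \<Rightarrow> real" where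
  "wt V \<rho> j = Re ((adj V * \<rho> * V) $$ (j,j))"

lemma wt_psd:
  assumes "psd N \<rho>" "V \<in> carrier_mat N N" "j < N"
  shows "wt V \<rho> j \<ge> 0" "(adj V * \<rho> * V) $$ (j,j) = of_real (wt V \<rho> j)"
proof -
  have p: "psd N (adj V * \<rho> * V)" using psd_congruence[OF assms(1,2)] .
  show "wt V \<rho> j \<ge> 0" using psd_diag_nonneg[OF p assms(3)] by (simp add: wt_def)
  have "adj (adj V * \<rho> * V) $$ (j,j) = (adj V * \<rho> * V) $$ (j,j)" using psdD[OF p] by simp
  then have "cnj ((adj V * \<rho> * V) $$ (j,j)) = (adj V * \<rho> * V) $$ (j,j)"
    using psdD(1)[OF p] assms(3) by (subst (asm) adj_index) auto
  then show "(adj V * \<rho> * V) $$ (j,j) = of_real (wt V \<rho> j)" by (simp add: wt_def complex_eq_iff)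
qed

lemma wt_kron:
  assumes "psd n \<rho>" "V \<in> carrier_mat n n" "psd m \<rho>'" "V' \<in> carrier_mat m m" "j < n * m"
  shows "wt (kron V V') (kron \<rho> \<rho>') j = wt V \<rho> (j div m) * wt V' \<rho>' (j mod m)"
proof -
  note c = psdD(1)[OF assms(1)] psdD(1)[OF assms(3)] assms(2,4)
  have "adj (kron V V') * kron \<rho> \<rho>' * kron V V' = kron (adj V * \<rho> * V) (adj V' * \<rho>' * V')"
    using c by (simp add: adj_kron kron_mult[of _ n n _ n _ m m _ m] mult_carrier_mat[of _ n n _ n] mult_carrier_mat[of _ m m _ m])
  then have "wt (kron V V') (kron \<rho> \<rho>') j
     = Re ((adj V * \<rho> * V) $$ (j div m, j div m) * (adj V' * \<rho>' * V') $$ (j mod m, j mod m))"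
    using c assms(5) by (simp add: wt_def kron_index del: index_mult_mat(1))
  then show ?thesis
    using wt_psd(2)[OF assms(1,2)] wt_psd(2)[OF assms(3,4)] div_mod_less[OF assms(5)] by simp
qed

text \<open>
  \<open>a\<close> and \<open>s\<close> are mean and variance of \<open>log p\<close> under the spectrum \<open>p\<close> of \<open>\<rho>\<close>, and \<open>b\<close> and \<open>t\<close> those of
  \<open>log q\<close> under the diagonal of \<open>\<rho>\<close> in the eigenbasis of \<open>\<sigma>\<close>; the relative entropy is \<open>a - b\<close>. All
  four are additive under tensor products. The junk value \<open>log 2 0 = 0\<close> only occurs with weight \<open>0\<close>.
\<close>

definition entropy_data :: "nat \<Rightarrow> complex mat \<Rightarrow> complex mat \<Rightarrow> real \<Rightarrow> real \<Rightarrow> real \<Rightarrow> real \<Rightarrow> bool" where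
  "entropy_data N \<rho> \<sigma> a b s t \<longleftrightarrow> (\<exists>U p V q. spec N U p \<rho> \<and> spec N V q \<sigma> \<and>
     (\<forall>j<N. q j \<ge> 0) \<and> (\<forall>j<N. q j = 0 \<longrightarrow> wt V \<rho> j = 0) \<and>
     moments N p (\<lambda>i. log 2 (p i)) a s \<and> moments N (wt V \<rho>) (\<lambda>j. log 2 (q j)) b t)"

lemma entropy_dataI:
  assumes "\<rho> \<in> density N" "spec N U p \<rho>" "\<sigma> \<in> density N" "spec N V q \<sigma>"
    and "\<And>j. j < N \<Longrightarrow> q j = 0 \<Longrightarrow> wt V \<rho> j = 0"
  shows "\<exists>a b s t. entropy_data N \<rho> \<sigma> a b s t"
proof -
  have "\<exists>a s. moments N p (\<lambda>i. log 2 (p i)) a s"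
    using density_spec[OF assms(1,2)] by (intro momentsI) auto
  moreover have "\<exists>b t. moments N (wt V \<rho>) (\<lambda>j. log 2 (q j)) b t"
    using wt_psd(1)[OF densityD(1)[OF assms(1)] specD(2)[OF assms(4)]]
      unitary_diag_sum[OF specD(1)[OF assms(4)] densityD(2)[OF assms(1)]] densityD(4)[OF assms(1)]
    by (intro momentsI) (auto simp: wt_def)
  ultimately show ?thesis
    using assms density_spec(1)[OF assms(3,4)] unfolding entropy_data_def by blast
qed

text \<open>An eigenvector of \<open>\<sigma>\<close> with eigenvalue 0 is orthogonal to the range
  of \<open>\<sigma>\<close>, hence to its own image under \<open>\<rho>\<close>; so it carries no
  weight.\<close>

lemma entropy_data_exists:
  assumes "\<rho> \<in> density N" "\<sigma> \<in> density N" and supp: "supp N \<rho> \<subseteq> supp N \<sigma>"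
  shows "\<exists>a b s t. entropy_data N \<rho> \<sigma> a b s t"
proof -
  obtain U p where U: "spec N U p \<rho>" using psd_spec[OF densityD(1)[OF assms(1)]] by metis
  obtain V q where V: "spec N V q \<sigma>" using psd_spec[OF densityD(1)[OF assms(2)]] by metis
  note c = specD(2)[OF V] densityD(2)[OF assms(1)] densityD(2)[OF assms(2)]
  have "wt V \<rho> j = 0" if j: "j < N" and q: "q j = 0" for j
  proof -
    have v: "col V j \<in> carrier_vec N" using c by auto
    then obtain x where x: "x \<in> carrier_vec N" "\<rho> *\<^sub>v col V j = \<sigma> *\<^sub>v x"
      using supp by (auto simp: supp_def)
    have row0: "row (adj V * \<sigma>) j = 0\<^sub>v N"
    proof -
      have "adj V * \<sigma> = (adj V * \<sigma> * V) * adj V"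
        using c unitaryD(2)[OF specD(1)[OF V]]
        by (simp add: assoc_mult_mat[of _ N N _ N _ N] mult_carrier_mat[of _ N N _ N])
      also have "\<dots> = dg N q * adj V" using specD(5)[OF V] by simp
      finally show ?thesis
        using c j q by (intro eq_vecI) (auto simp: dg_mult_left_index[of _ N N] simp del: index_mult_mat(1))
    qed
    have "(adj V * \<rho> * V) $$ (j,j) = (\<rho> *\<^sub>v col V j) \<bullet>c col V j"
      using c j by (intro quad_form_index[of _ N N]) auto
    also have "\<dots> = row (adj V) j \<bullet> (\<sigma> *\<^sub>v x)"
      using c j x by (subst row_adj) (auto intro!: comm_scalar_prod[of _ N])
    also have "\<dots> = (adj V *\<^sub>v (\<sigma> *\<^sub>v x)) $ j" using c j by simp
    also have "\<dots> = ((adj V * \<sigma>) *\<^sub>v x) $ j"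
      using c x by (simp add: assoc_mult_mat_vec[of _ N N _ N])
    also have "\<dots> = 0" using row0 c x j by simp
    finally show ?thesis by (simp add: wt_def)
  qed
  then show ?thesis using entropy_dataI[OF assms(1) U assms(2) V] by blast
qed

text \<open>The diagonal entry is the squared norm of a column of a Gram factor, so that column is
  zero.\<close>

lemma psd_zero_diag_row:
  assumes "psd N G" "j < N" "Re (G $$ (j,j)) = 0" "l < N"
  shows "G $$ (j,l) = 0"
proof -
  obtain B where B: "B \<in> carrier_mat N N" "G = adj B * B" using psd_factor[OF assms(1)] .
  have "(\<Sum>k<N. (cmod (B $$ (k,j)))\<^sup>2) = 0"
    using assms(3) gram_diag[OF B(1) assms(2)] B(2) by simp
  then have z: "B $$ (k,j) = 0" if "k < N" for k
    using that by (subst (asm) sum_nonneg_eq_0_iff) auto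
  have "G $$ (j,l) = (\<Sum>k<N. adj B $$ (j,k) * B $$ (k,l))"
    unfolding B(2) using B(1) assms by (intro index_mult_mat_sum[of _ N _ _ N]) auto
  also have "\<dots> = 0" using z B(1) assms by (intro sum.neutral) auto
  finally show ?thesis .
qed

lemma supp_subsetI:
  assumes \<rho>: "psd N \<rho>" and V: "spec N V q \<sigma>"
    and z: "\<And>j. j < N \<Longrightarrow> q j = 0 \<Longrightarrow> wt V \<rho> j = 0"
  shows "supp N \<rho> \<subseteq> supp N \<sigma>"
proof -
  note c = specD(2,3)[OF V] psdD(1)[OF \<rho>] and u = unitaryD[OF specD(1)[OF V]]
  note asc = assoc_mult_mat[of _ N N _ N _ N] mult_carrier_mat[of _ N N _ N]
  define G where "G = adj V * \<rho> * V"
  \<comment> \<open>Because \<open>1 / 0 = 0\<close>, this is the pseudo-inverse: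
    \<open>\<sigma> * S\<close> projects onto the range of \<open>\<sigma>\<close>, and the
    vanishing weights say that this projection fixes \<open>\<rho>\<close> from the left.\<close>
  define S where "S = V * dg N (\<lambda>j. 1 / q j) * adj V"
  have G: "psd N G" "G \<in> carrier_mat N N" unfolding G_def using psd_congruence[OF \<rho> c(1)] c by auto
  have S: "S \<in> carrier_mat N N" unfolding S_def using c by auto
  have row: "G $$ (j,l) = 0" if "j < N" "l < N" "q j = 0" for j l
    using psd_zero_diag_row[OF G(1) that(1) _ that(2)] z[OF that(1,3)] by (simp add: wt_def G_def)
  have dG: "dg N (\<lambda>j. q j * (1 / q j)) * G = G"
    using G(2) row by (intro eq_matI) (auto simp: dg_mult_left_index[of _ N N] simp del: index_mult_mat(1))
  have \<rho>G: "\<rho> = V * G * adj V"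
  proof -
    have "\<rho> = (V * adj V) * \<rho> * (V * adj V)" using u c by simp
    then show ?thesis unfolding G_def using c by (simp add: asc)
  qed
  have "\<sigma> * S = V * (dg N q * (adj V * V) * dg N (\<lambda>j. 1 / q j)) * adj V"
    unfolding S_def by (subst specD(4)[OF V]) (use c in \<open>simp add: asc\<close>)
  also have "\<dots> = V * dg N (\<lambda>j. q j * (1 / q j)) * adj V"
    using u by (simp add: right_mult_one_mat[of _ N N])
  finally have "\<sigma> * S * \<rho> = V * dg N (\<lambda>j. q j * (1 / q j)) * (adj V * V) * G * adj V"
    unfolding \<rho>G using c G by (simp add: asc)
  also have "\<dots> = V * (dg N (\<lambda>j. q j * (1 / q j)) * G) * adj V"
    using u c G by (simp add: asc right_mult_one_mat[of _ N N])
  also have "\<dots> = \<rho>" unfolding dG using \<rho>G by simp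
  finally have key: "\<sigma> * (S * \<rho>) = \<rho>" using c S by (simp add: asc)
  show ?thesis
  proof
    fix y assume "y \<in> supp N \<rho>"
    then obtain x where x: "x \<in> carrier_vec N" "y = \<rho> *\<^sub>v x" by (auto simp: supp_def)
    have "(\<sigma> * (S * \<rho>)) *\<^sub>v x = \<sigma> *\<^sub>v ((S * \<rho>) *\<^sub>v x)"
      using x c S by (intro assoc_mult_mat_vec[of _ N N _ N]) auto
    then have "y = \<sigma> *\<^sub>v ((S * \<rho>) *\<^sub>v x)" using key x(2) by simp
    moreover have "(S * \<rho>) *\<^sub>v x \<in> carrier_vec N" using S c x by auto
    ultimately show "y \<in> supp N \<sigma>" by (auto simp: supp_def)
  qed
qed

lemma entropy_data_psd: "entropy_data N \<rho> \<sigma> a b s t \<Longrightarrow> psd N \<rho> \<and> psd N \<sigma>"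
proof -
  assume "entropy_data N \<rho> \<sigma> a b s t"
  then obtain U p V q where U: "spec N U p \<rho>" and V: "spec N V q \<sigma>" and q: "\<forall>j<N. q j \<ge> 0"
    and m: "moments N p (\<lambda>i. log 2 (p i)) a s"
    unfolding entropy_data_def by blast
  show ?thesis using spec_psd[OF U] spec_psd[OF V] q m by (simp add: moments_def)
qed

lemma entropy_data_self:
  assumes "entropy_data N \<rho> \<sigma> a b s t"
  shows "a = rtr (\<rho> * mat_log2 N \<rho>)"
proof -
  obtain U p where U: "spec N U p \<rho>" and m: "moments N p (\<lambda>i. log 2 (p i)) a s"
    using assms by (auto simp: entropy_data_def)
  have l: "spec N U (\<lambda>i. log 2 (p i)) (mat_log2 N \<rho>)"
    using m by (intro mat_log2_spec[OF U]) (auto simp: moments_def)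
  show ?thesis using m specD(3)[OF U]
    by (simp add: rtr_spec_mult[OF l] specD(5)[OF U] moments_def mult.commute del: index_mult_mat(1))
qed

text \<open>The cross term \<open>tr (\<rho> log \<sigma>)\<close> sees only the diagonal of
  \<open>\<rho>\<close> in the eigenbasis of \<open>\<sigma>\<close>. The vanishing weights built
  into \<open>entropy_data\<close> exclude the infinite case.\<close>

lemma rel_entropy_entropy_data:
  assumes "entropy_data N \<rho> \<sigma> a b s t"
  shows "rel_entropy N \<rho> \<sigma> = ereal (a - b)"
proof -
  obtain U p V q where U: "spec N U p \<rho>" and V: "spec N V q \<sigma>"
    and q: "\<forall>j<N. q j \<ge> 0" "\<forall>j<N. q j = 0 \<longrightarrow> wt V \<rho> j = 0"
    and m: "moments N p (\<lambda>i. log 2 (p i)) a s" "moments N (wt V \<rho>) (\<lambda>j. log 2 (q j)) b t"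
    using assms unfolding entropy_data_def by blast
  have \<rho>: "psd N \<rho>" using entropy_data_psd[OF assms] by simp
  have supp: "supp N \<rho> \<subseteq> supp N \<sigma>" using supp_subsetI[OF \<rho> V] q by blast
  have l: "spec N V (\<lambda>j. log 2 (q j)) (mat_log2 N \<sigma>)"
    using q by (intro mat_log2_spec[OF V]) auto
  have l': "spec N U (\<lambda>i. log 2 (p i)) (mat_log2 N \<rho>)"
    using m by (intro mat_log2_spec[OF U]) (auto simp: moments_def)
  have "rtr (\<rho> * mat_log2 N \<sigma>) = b"
    using m psdD(1)[OF \<rho>] by (simp add: rtr_spec_mult[OF l] moments_def wt_def mult.commute)
  moreover have "rtr (\<rho> * mat_log2 N \<rho>) = a" using entropy_data_self[OF assms] by simp
  ultimately have "rtr (\<rho> * (mat_log2 N \<rho> - mat_log2 N \<sigma>)) = a - b"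
    using psdD(1)[OF \<rho>] specD(3)[OF l] specD(3)[OF l'] by (simp add: rtr_mult_right[of _ N])
  then show ?thesis using supp by (simp add: rel_entropy_def rtr_def)
qed

lemma entropy_data_kron:
  assumes "entropy_data n \<rho> \<sigma> a b s t" "entropy_data m \<rho>' \<sigma>' a' b' s' t'"
  shows "entropy_data (n * m) (kron \<rho> \<rho>') (kron \<sigma> \<sigma>') (a + a') (b + b') (s + s') (t + t')"
proof -
  obtain U p V q where U: "spec n U p \<rho>" and V: "spec n V q \<sigma>"
    and q: "\<forall>j<n. q j \<ge> 0" "\<forall>j<n. q j = 0 \<longrightarrow> wt V \<rho> j = 0"
    and m: "moments n p (\<lambda>i. log 2 (p i)) a s" "moments n (wt V \<rho>) (\<lambda>j. log 2 (q j)) b t"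
    using assms(1) unfolding entropy_data_def by blast
  obtain U' p' V' q' where U': "spec m U' p' \<rho>'" and V': "spec m V' q' \<sigma>'"
    and q': "\<forall>j<m. q' j \<ge> 0" "\<forall>j<m. q' j = 0 \<longrightarrow> wt V' \<rho>' j = 0"
    and m': "moments m p' (\<lambda>i. log 2 (p' i)) a' s'" "moments m (wt V' \<rho>') (\<lambda>j. log 2 (q' j)) b' t'"
    using assms(2) unfolding entropy_data_def by blast
  have psd: "psd n \<rho>" "psd m \<rho>'" using assms entropy_data_psd by auto
  note wk = wt_kron[OF psd(1) specD(2)[OF V] psd(2) specD(2)[OF V']]
  note dm = div_mod_less[of _ n m]
  have lg: "log 2 (x * y) = log 2 x + log 2 y" if "x \<ge> 0" "y \<ge> 0" "x \<noteq> 0" "y \<noteq> 0" for x y :: real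
    using that by (simp add: log_def ln_mult add_divide_distrib)
  have mp: "moments (n * m) (\<lambda>i. p (i div m) * p' (i mod m)) (\<lambda>i. log 2 (p (i div m) * p' (i mod m))) (a + a') (s + s')"
    using m m' dm by (intro moments_kron[OF m(1) m'(1)] lg) (auto simp: moments_def)
  have mq: "moments (n * m) (wt (kron V V') (kron \<rho> \<rho>')) (\<lambda>i. log 2 (q (i div m) * q' (i mod m))) (b + b') (t + t')"
    using m m' dm q q' wk by (intro moments_kron[OF m(2) m'(2)] lg) (auto simp: moments_def)
  have "\<forall>j<n*m. q (j div m) * q' (j mod m) \<ge> 0" using q q' dm by auto
  moreover have "\<forall>j<n*m. q (j div m) * q' (j mod m) = 0 \<longrightarrow> wt (kron V V') (kron \<rho> \<rho>') j = 0"
    using q q' dm wk by auto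
  ultimately show ?thesis
    using spec_kron[OF U U'] spec_kron[OF V V'] mp mq unfolding entropy_data_def by blast
qed

subsection \<open>A one-shot converse bound\<close>

text \<open>The matrix in question equals \<open>(P - Q) * A * (P - Q)\<close>: the off-diagonal
  blocks of \<open>A\<close> enter with the opposite sign.\<close>

lemma pinching_two:
  assumes "psd N A" "P \<in> carrier_mat N N" "adj P = P"
  defines "Q \<equiv> 1\<^sub>m N - P"
  shows "psd N (complex_of_real 2 \<cdot>\<^sub>m (P * A * P) + complex_of_real 2 \<cdot>\<^sub>m (Q * A * Q) - A)"
proof -
  have Q: "Q \<in> carrier_mat N N" "adj Q = Q"
    using assms by (auto simp: Q_def adj_minus[of _ N N])
  note A = psdD[OF assms(1)]
  note asc = assoc_mult_mat[of _ N N _ N _ N] mult_carrier_mat[of _ N N _ N]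
  have PQ: "P + Q = 1\<^sub>m N" unfolding Q_def using assms(2) by (intro eq_matI) auto
  have "A = (P + Q) * A * (P + Q)" unfolding PQ using A by simp
  also have "\<dots> = P * A * P + P * A * Q + (Q * A * P + Q * A * Q)"
    using A Q assms(2)
    by (simp add: add_mult_distrib_mat[of _ N N _ _ N] mult_add_distrib_mat[of _ N N _ N] asc)
       (intro eq_matI, auto)
  finally have e1: "A = P * A * P + P * A * Q + (Q * A * P + Q * A * Q)" .
  have e2: "(P - Q) * A * (P - Q) = (P * A * P - P * A * Q) - (Q * A * P - Q * A * Q)"
  proof -
    have e: "(P - Q) * A = P * A - Q * A"
      using A Q assms(2) by (intro minus_mult_distrib_mat[of _ N N _ _ N]) auto
    have "(P - Q) * A * (P - Q) = (P * A - Q * A) * P - (P * A - Q * A) * Q"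
      unfolding e using A Q assms(2) by (intro mult_minus_distrib_mat[of _ N N _ N]) auto
    also have "(P * A - Q * A) * P = P * A * P - Q * A * P"
      using A Q assms(2) by (intro minus_mult_distrib_mat[of _ N N _ _ N]) auto
    also have "(P * A - Q * A) * Q = P * A * Q - Q * A * Q"
      using A Q assms(2) by (intro minus_mult_distrib_mat[of _ N N _ _ N]) auto
    also have "P * A * P - Q * A * P - (P * A * Q - Q * A * Q) = (P * A * P - P * A * Q) - (Q * A * P - Q * A * Q)"
      using A Q assms(2) by (intro eq_matI) (auto simp del: index_mult_mat(1))
    finally show ?thesis .
  qed
  have c: "P * A * P \<in> carrier_mat N N" "P * A * Q \<in> carrier_mat N N" "Q * A * P \<in> carrier_mat N N" "Q * A * Q \<in> carrier_mat N N"
    using A Q assms(2) by auto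
  have "complex_of_real 2 \<cdot>\<^sub>m (P * A * P) + complex_of_real 2 \<cdot>\<^sub>m (Q * A * Q) - A
     = complex_of_real 2 \<cdot>\<^sub>m (P * A * P) + complex_of_real 2 \<cdot>\<^sub>m (Q * A * Q) - (P * A * P + P * A * Q + (Q * A * P + Q * A * Q))"
    using e1 by simp
  also have "\<dots> = (P * A * P - P * A * Q) - (Q * A * P - Q * A * Q)"
  proof -
    have "complex_of_real 2 \<cdot>\<^sub>m X + complex_of_real 2 \<cdot>\<^sub>m W - (X + Y + (Z + W)) = (X - Y) - (Z - W)"
      if "X \<in> carrier_mat N N" "Y \<in> carrier_mat N N" "Z \<in> carrier_mat N N" "W \<in> carrier_mat N N"
      for X Y Z W :: "complex mat"
      using that by (intro eq_matI) auto
    then show ?thesis using c by blast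
  qed
  also have "\<dots> = adj (P - Q) * A * (P - Q)"
    using e2 assms(2,3) Q by (simp add: adj_minus[of _ N N])
  finally show ?thesis using psd_congruence[OF assms(1), of "P - Q" N] Q by (simp add: minus_carrier_mat)
qed

text \<open>Eigenvalues of \<open>\<rho>\<close> above \<open>\<alpha>\<close> and eigenvectors of
  \<open>\<sigma>\<close> below \<open>\<beta>\<close> are cut off at the cost of the first two
  sums. On what remains \<open>\<rho>\<close> is at most \<open>\<alpha>\<close> times the identity
  and the spectral projection \<open>P\<close> of \<open>\<sigma>\<close> is at most
  \<open>\<sigma> / \<beta>\<close>. As \<open>P\<close> need not commute with \<open>A\<close>, the
  test is first pinched, which causes both factors 2.\<close>

lemma one_shot_converse:
  assumes U: "spec N U p \<rho>" "\<And>i. i < N \<Longrightarrow> p i \<ge> 0"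
    and V: "spec N V q \<sigma>" "\<And>i. i < N \<Longrightarrow> q i \<ge> 0"
    and A: "povm_elem N A" and \<alpha>: "\<alpha> > 0" and \<beta>: "\<beta> > 0"
  shows "rtr (A * \<rho>) \<le> (\<Sum>i\<in>{i. i < N \<and> p i > \<alpha>}. p i) + 2 * (\<Sum>j\<in>{j. j < N \<and> q j < \<beta>}. wt V \<rho> j)
     + 2 * (\<alpha> / \<beta>) * rtr (A * \<sigma>)"
proof -
  note uU = specD(1)[OF U(1)] and uV = specD(1)[OF V(1)]
  note cA = povmD[OF A]
  note asc = assoc_mult_mat[of _ N N _ N _ N] mult_carrier_mat[of _ N N _ N]
  define P where "P = V * dg N (\<lambda>j. if q j < \<beta> then 0 else 1) * adj V"
  define Q where "Q = 1\<^sub>m N - P"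
  define Rg where "Rg = U * dg N (\<lambda>i. if p i > \<alpha> then 0 else p i) * adj U"
  define Rb where "Rb = U * dg N (\<lambda>i. if p i > \<alpha> then p i else 0) * adj U"
  have P: "spec N V (\<lambda>j. if q j < \<beta> then 0 else 1) P" unfolding P_def by (rule spec_exists[OF uV])
  have Q: "spec N V (\<lambda>j. 1 - (if q j < \<beta> then 0 else 1)) Q"
    unfolding Q_def by (rule spec_minus[OF spec_one[OF uV] P])
  have Rg: "spec N U (\<lambda>i. if p i > \<alpha> then 0 else p i) Rg" unfolding Rg_def by (rule spec_exists[OF uU])
  have Rb: "spec N U (\<lambda>i. if p i > \<alpha> then p i else 0) Rb" unfolding Rb_def by (rule spec_exists[OF uU])
  note c = cA(3) specD(3)[OF P] specD(3)[OF Q] specD(3)[OF Rg] specD(3)[OF Rb] specD(3)[OF U(1)] specD(3)[OF V(1)]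
  have adjP: "adj P = P" and adjQ: "adj Q = Q" by (rule spec_hermitian[OF P], rule spec_hermitian[OF Q])
  have psdg: "psd N Rg" using spec_psd[OF Rg] U(2) by auto
  have psdb: "psd N Rb" using spec_psd[OF Rb] U(2) by auto
  have psdQ: "psd N Q" by (rule spec_psd[OF Q]) auto
  have QQ: "Q * Q = Q"
  proof -
    have "Q * Q = V * (dg N (\<lambda>j. 1 - (if q j < \<beta> then 0 else 1)) * (adj V * V) * dg N (\<lambda>j. 1 - (if q j < \<beta> then 0 else 1))) * adj V"
      using specD(2)[OF V(1)] by (subst (1 2) specD(4)[OF Q]) (simp add: asc)
    also have "\<dots> = V * dg N (\<lambda>j. 1 - (if q j < \<beta> then 0 else 1)) * adj V"
      using unitaryD(3)[OF uV] by (simp add: right_mult_one_mat[of _ N N] if_distrib cong: if_cong)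
    finally show ?thesis using specD(4)[OF Q] by simp
  qed
  have PP: "P * P = P"
  proof -
    have "P * P = V * (dg N (\<lambda>j. if q j < \<beta> then 0 else 1) * (adj V * V) * dg N (\<lambda>j. if q j < \<beta> then 0 else 1)) * adj V"
      using specD(2)[OF V(1)] by (subst (1 2) specD(4)[OF P]) (simp add: asc)
    also have "\<dots> = V * dg N (\<lambda>j. if q j < \<beta> then 0 else 1) * adj V"
      using unitaryD(3)[OF uV] by (simp add: right_mult_one_mat[of _ N N] if_distrib cong: if_cong)
    finally show ?thesis using specD(4)[OF P] by simp
  qed
  have diff: "\<rho> - Rb = Rg"
  proof -
    have "dg N (\<lambda>i. p i - (if p i > \<alpha> then p i else 0)) = dg N (\<lambda>i. if p i > \<alpha> then 0 else p i)"
      by (rule dg_cong) auto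
    then show ?thesis using specD(4)[OF spec_minus[OF U(1) Rb]] specD(4)[OF Rg] by simp
  qed
  have split: "rtr (A * \<rho>) = rtr (A * Rb) + rtr (A * Rg)"
    unfolding diff[symmetric] using c by (simp add: rtr_mult_right[of _ N])
  have bad: "rtr (A * Rb) \<le> (\<Sum>i\<in>{i. i < N \<and> p i > \<alpha>}. p i)"
  proof -
    have "rtr (A * Rb) \<le> rtr Rb" by (rule povm_rtr_bounds(2)[OF A psdb])
    also have "\<dots> = (\<Sum>i<N. if p i > \<alpha> then p i else 0)" by (rule rtr_spec[OF Rb])
    also have "\<dots> = (\<Sum>i\<in>{..<N} \<inter> {i. p i > \<alpha>}. p i)" by (simp add: sum.inter_restrict)
    also have "{..<N} \<inter> {i. p i > \<alpha>} = {i. i < N \<and> p i > \<alpha>}" by auto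
    finally show ?thesis .
  qed
  have good: "rtr (A * Rg) \<le> 2 * rtr (P * A * P * Rg) + 2 * rtr (Q * A * Q * Rg)"
  proof -
    have "psd N (complex_of_real 2 \<cdot>\<^sub>m (P * A * P) + complex_of_real 2 \<cdot>\<^sub>m (Q * A * Q) - A)"
      unfolding Q_def by (rule pinching_two[OF cA(1) c(2) adjP])
    from rtr_mono_left[OF psdg this cA(3)]
    have "rtr (A * Rg) \<le> rtr ((complex_of_real 2 \<cdot>\<^sub>m (P * A * P) + complex_of_real 2 \<cdot>\<^sub>m (Q * A * Q)) * Rg)"
      using c by auto
    also have "\<dots> = rtr (complex_of_real 2 \<cdot>\<^sub>m (P * A * P) * Rg) + rtr (complex_of_real 2 \<cdot>\<^sub>m (Q * A * Q) * Rg)"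
      using c by (intro rtr_mult_left(1)[of _ N]) auto
    also have "rtr (complex_of_real 2 \<cdot>\<^sub>m (P * A * P) * Rg) = 2 * rtr (P * A * P * Rg)"
      using c by (intro rtr_mult_left(3)[of _ N]) auto
    also have "rtr (complex_of_real 2 \<cdot>\<^sub>m (Q * A * Q) * Rg) = 2 * rtr (Q * A * Q * Rg)"
      using c by (intro rtr_mult_left(3)[of _ N]) auto
    finally show ?thesis .
  qed
  \<comment> \<open>Cyclicity moves both copies of \<open>Q\<close> onto the truncated state; then
    \<open>A\<close> is bounded by the identity and \<open>Rg\<close> by
    \<open>\<rho>\<close>.\<close>
  have Qpart: "rtr (Q * A * Q * Rg) \<le> (\<Sum>j\<in>{j. j < N \<and> q j < \<beta>}. wt V \<rho> j)"
  proof -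
    have "rtr (Q * A * Q * Rg) = rtr (Q * (A * Q * Rg))" using c by (simp add: asc)
    also have "\<dots> = rtr (A * Q * Rg * Q)" using c by (intro rtr_mult_comm[of _ N N]) auto
    also have "\<dots> = rtr (A * (adj Q * Rg * Q))" using c by (simp add: asc adjQ)
    also have "\<dots> \<le> rtr (adj Q * Rg * Q)"
      by (rule povm_rtr_bounds(2)[OF A psd_congruence[OF psdg c(3)]])
    also have "\<dots> = rtr (Q * (Rg * Q))" using c by (simp add: asc adjQ)
    also have "\<dots> = rtr (Rg * Q * Q)" using c by (intro rtr_mult_comm[of _ N N]) auto
    also have "\<dots> = rtr (Rg * Q)" using c QQ by (simp add: asc)
    also have "\<dots> \<le> rtr (\<rho> * Q)"
    proof (rule rtr_mono_left[OF psdQ _ c(4) c(6)])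
      show "psd N (\<rho> - Rg)" by (rule spec_psd[OF spec_minus[OF U(1) Rg]]) (use U(2) in auto)
    qed
    also have "\<dots> = (\<Sum>j<N. (1 - (if q j < \<beta> then 0 else 1)) * wt V \<rho> j)"
      unfolding wt_def by (rule rtr_spec_mult[OF Q c(6)])
    also have "\<dots> = (\<Sum>j<N. if q j < \<beta> then wt V \<rho> j else 0)" by (intro sum.cong) auto
    also have "\<dots> = (\<Sum>j\<in>{..<N} \<inter> {j. q j < \<beta>}. wt V \<rho> j)" by (simp add: sum.inter_restrict)
    also have "{..<N} \<inter> {j. q j < \<beta>} = {j. j < N \<and> q j < \<beta>}" by auto
    finally show ?thesis .
  qed
  \<comment> \<open>Here \<open>Rg\<close> is replaced by its upper bound \<open>\<alpha>\<close>
    before cyclicity merges the two copies of \<open>P\<close>, which leaves a trace against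
    \<open>P\<close> alone.\<close>
  have Ppart: "rtr (P * A * P * Rg) \<le> (\<alpha> / \<beta>) * rtr (A * \<sigma>)"
  proof -
    have psdPAP: "psd N (P * A * P)" using psd_congruence[OF cA(1) c(2)] adjP by simp
    have "psd N (complex_of_real \<alpha> \<cdot>\<^sub>m 1\<^sub>m N - Rg)"
      using \<alpha> by (intro spec_psd[OF spec_minus[OF spec_smult[OF spec_one[OF uU]] Rg]]) auto
    from rtr_mono_right[OF psdPAP this c(4)]
    have "rtr (P * A * P * Rg) \<le> rtr (P * A * P * (complex_of_real \<alpha> \<cdot>\<^sub>m 1\<^sub>m N))" by simp
    also have "\<dots> = \<alpha> * rtr (P * A * P * 1\<^sub>m N)"
      using c by (intro rtr_mult_right(3)[of _ N]) auto
    also have "P * A * P * 1\<^sub>m N = P * (A * P)" using c by (simp add: asc)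
    also have "rtr (P * (A * P)) = rtr (A * P * P)" using c by (intro rtr_mult_comm[of _ N N]) auto
    also have "\<dots> = rtr (A * P)" using c PP by (simp add: asc)
    also have "rtr (A * P) \<le> rtr (A * (complex_of_real (1 / \<beta>) \<cdot>\<^sub>m \<sigma>))"
    proof (rule rtr_mono_right[OF cA(1) _ c(2)])
      show "psd N (complex_of_real (1 / \<beta>) \<cdot>\<^sub>m \<sigma> - P)"
        using V(2) \<beta> by (intro spec_psd[OF spec_minus[OF spec_smult[OF V(1)] P]]) (auto simp: field_simps)
    qed (use c in auto)
    also have "rtr (A * (complex_of_real (1 / \<beta>) \<cdot>\<^sub>m \<sigma>)) = (1 / \<beta>) * rtr (A * \<sigma>)"
      using c by (intro rtr_mult_right(3)[of _ N]) auto
    finally show ?thesis using \<alpha> by simp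
  qed
  show ?thesis using split bad good Qpart Ppart by simp
qed

text \<open>The cutoffs lie at distance \<open>x\<close> from the means on the logarithmic scale,
  \<open>\<alpha> = 2 powr (a + x)\<close> and \<open>\<beta> = 2 powr (b - x)\<close>, so Chebyshev
  controls both discarded weights.\<close>

lemma entropy_data_converse:
  assumes L: "entropy_data N \<rho> \<sigma> a b s t" and A: "povm_elem N A" and x: "x > 0"
  shows "rtr (A * \<rho>) \<le> s / x\<^sup>2 + 2 * (t / x\<^sup>2) + 2 * 2 powr (a - b + 2 * x) * rtr (A * \<sigma>)"
proof -
  obtain U p V q where U: "spec N U p \<rho>" and V: "spec N V q \<sigma>"
    and q: "\<forall>j<N. q j \<ge> 0" "\<forall>j<N. q j = 0 \<longrightarrow> wt V \<rho> j = 0"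
    and m: "moments N p (\<lambda>i. log 2 (p i)) a s" "moments N (wt V \<rho>) (\<lambda>j. log 2 (q j)) b t"
    using L unfolding entropy_data_def by blast
  have "(\<Sum>i\<in>{i. i < N \<and> p i > 2 powr (a + x)}. p i) \<le> s / x\<^sup>2"
  proof (rule moments_chebyshev[OF m(1) x])
    fix i assume i: "i \<in> {i. i < N \<and> p i > 2 powr (a + x)}"
    then have "0 < p i" by (auto intro: less_trans[rotated])
    then have "log 2 (p i) > a + x" using i by (auto simp: less_log_iff)
    then show "x \<le> \<bar>log 2 (p i) - a\<bar>" by simp
  qed auto
  moreover have "(\<Sum>j\<in>{j. j < N \<and> q j < 2 powr (b - x)}. wt V \<rho> j) \<le> t / x\<^sup>2"
  proof (rule moments_chebyshev[OF m(2) x])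
    fix i assume i: "i \<in> {j. j < N \<and> q j < 2 powr (b - x)}" "wt V \<rho> i \<noteq> 0"
    \<comment> \<open>Without positive weight \<open>q i\<close> could be 0, where the logarithm
      takes its default value and the deviation could be small.\<close>
    then have "0 < q i" using q by force
    then have "log 2 (q i) < b - x" using i by (auto simp: log_less_iff)
    then show "x \<le> \<bar>log 2 (q i) - b\<bar>" by simp
  qed auto
  moreover have "rtr (A * \<rho>) \<le> (\<Sum>i\<in>{i. i < N \<and> p i > 2 powr (a + x)}. p i)
     + 2 * (\<Sum>j\<in>{j. j < N \<and> q j < 2 powr (b - x)}. wt V \<rho> j)
     + 2 * (2 powr (a + x) / 2 powr (b - x)) * rtr (A * \<sigma>)"
    using q m by (intro one_shot_converse[OF U _ V _ A]) (auto simp: moments_def)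
  moreover have "2 powr (a + x) / 2 powr (b - x) = 2 powr (a - b + 2 * x)"
    by (simp add: powr_diff[symmetric] algebra_simps)
  ultimately show ?thesis by simp
qed

subsection \<open>Minimax tests\<close>

text \<open>Young's inequality for the Hilbert-Schmidt inner product, from the nonnegative square of
  \<open>\<mu> Y - Z\<close>.\<close>

lemma hs_young:
  assumes "Y \<in> carrier_mat N N" "adj Y = Y" "Z \<in> carrier_mat N N" "adj Z = Z" and \<mu>: "\<mu> > 0"
  shows "rtr (Y * Z) \<le> \<mu> / 2 * rtr (Y * Y) + rtr (Z * Z) / (2 * \<mu>)"
proof -
  define W where "W = complex_of_real \<mu> \<cdot>\<^sub>m Y - Z"
  have W: "W \<in> carrier_mat N N" "adj W = W"
    unfolding W_def using assms by (auto simp: adj_minus[of _ N N] adj_smult)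
  have "rtr (W * W) = rtr (W * (complex_of_real \<mu> \<cdot>\<^sub>m Y)) - rtr (W * Z)"
    using W assms by (subst (2) W_def, intro rtr_mult_right(2)[of _ N]) auto
  also have "rtr (W * (complex_of_real \<mu> \<cdot>\<^sub>m Y)) = \<mu> * rtr (W * Y)"
    using W assms by (intro rtr_mult_right(3)[of _ N]) auto
  also have "rtr (W * Y) = \<mu> * rtr (Y * Y) - rtr (Z * Y)"
    unfolding W_def using assms by (simp add: rtr_mult_left[of _ N])
  also have "rtr (W * Z) = \<mu> * rtr (Y * Z) - rtr (Z * Z)"
    unfolding W_def using assms by (simp add: rtr_mult_left[of _ N])
  also have "rtr (Z * Y) = rtr (Y * Z)" using assms by (intro rtr_mult_comm[of _ N N]) auto
  finally have "rtr (W * W) = \<mu> * (\<mu> * rtr (Y * Y) - rtr (Y * Z)) - (\<mu> * rtr (Y * Z) - rtr (Z * Z))" .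
  moreover have "rtr (W * W) \<ge> 0" using rtr_gram_nonneg[OF W(1)] W(2) by simp
  ultimately have "2 * \<mu> * rtr (Y * Z) \<le> \<mu> * \<mu> * rtr (Y * Y) + rtr (Z * Z)"
    by (simp add: algebra_simps)
  then show ?thesis using \<mu> by (simp add: field_simps)
qed

text \<open>The maximiser clips the eigenvalues of \<open>X / \<mu>\<close> to the unit interval.
  The payoff is a concave quadratic with curvature \<open>\<mu>\<close>, so every competitor loses
  at least \<open>\<mu> / 2\<close> times its squared distance; this surplus is what later controls
  how the best response moves.\<close>

lemma clip_optimal:
  assumes X: "spec N U x X" and \<mu>: "\<mu> > 0"
  shows "\<exists>A0. povm_elem N A0 \<and> (\<forall>A. povm_elem N A \<longrightarrow>
     rtr (A * X) - \<mu> / 2 * rtr (A * A) + \<mu> / 2 * rtr ((A - A0) * (A - A0))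
       \<le> rtr (A0 * X) - \<mu> / 2 * rtr (A0 * A0))"
proof -
  define a where "a i = min 1 (max 0 (x i / \<mu>))" for i
  define A0 where "A0 = U * dg N a * adj U"
  note uU = specD(1)[OF X]
  have A0: "spec N U a A0" unfolding A0_def by (rule spec_exists[OF uU])
  have p0: "povm_elem N A0"
    unfolding A0_def by (rule povm_spec[OF uU]) (auto simp: a_def)
  note c0 = povmD(3)[OF p0] specD(3)[OF X]
  have "rtr (A * X) - \<mu> / 2 * rtr (A * A) + \<mu> / 2 * rtr ((A - A0) * (A - A0))
       \<le> rtr (A0 * X) - \<mu> / 2 * rtr (A0 * A0)" if A: "povm_elem N A" for A
  proof -
    note c = povmD(3)[OF A] c0
    \<comment> \<open>The gradient of the payoff at \<open>A0\<close>. In the eigenbasis of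
      \<open>X\<close> it is negative where \<open>A0\<close> is clipped to 0, positive where it is
      clipped to 1, and zero elsewhere, so first-order optimality holds entry by entry.\<close>
    define B where "B = X - complex_of_real \<mu> \<cdot>\<^sub>m A0"
    have B: "spec N U (\<lambda>i. x i - \<mu> * a i) B" unfolding B_def by (rule spec_minus[OF X spec_smult[OF A0]])
    note cB = specD(3)[OF B]
    have d: "adj U * (A0 - A) * U = adj U * A0 * U - adj U * A * U"
      using c specD(2)[OF X]
      by (simp add: mult_minus_distrib_mat[of _ N N _ N] minus_mult_distrib_mat[of _ N N _ _ N] mult_carrier_mat[of _ N N _ N])
    have "0 \<le> (x i - \<mu> * a i) * Re ((adj U * (A0 - A) * U) $$ (i,i))" if i: "i < N" for i
    proof -
      have e: "Re ((adj U * (A0 - A) * U) $$ (i,i)) = a i - Re ((adj U * A * U) $$ (i,i))"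
        unfolding d specD(5)[OF A0] using i c specD(2)[OF X] by (simp del: index_mult_mat(1))
      have 1: "Re ((adj U * A * U) $$ (i,i)) \<ge> 0"
        by (rule psd_diag_nonneg[OF psd_congruence[OF povmD(1)[OF A] specD(2)[OF X]] i])
      have "adj U * (1\<^sub>m N - A) * U = 1\<^sub>m N - adj U * A * U"
        using c specD(2)[OF X] unitaryD(3)[OF uU]
        by (simp add: mult_minus_distrib_mat[of _ N N _ N] minus_mult_distrib_mat[of _ N N _ _ N] mult_carrier_mat[of _ N N _ N])
      then have 2: "Re ((adj U * A * U) $$ (i,i)) \<le> 1"
        using psd_diag_nonneg[OF psd_congruence[OF povmD(2)[OF A] specD(2)[OF X]] i] i c specD(2)[OF X]
        by (simp del: index_mult_mat(1))
      consider "x i < 0" | "0 \<le> x i" "x i \<le> \<mu>" | "\<mu> < x i" by linarith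
      then show ?thesis
      proof cases
        case 1
        then have "a i = 0" using \<mu> by (auto simp: a_def field_simps max_def min_def)
        then show ?thesis unfolding e using 1 \<open>Re _ \<ge> 0\<close> by (intro mult_nonpos_nonpos) auto
      next
        case 2
        then have "\<mu> * a i = x i" using \<mu> by (auto simp: a_def field_simps max_def min_def)
        then show ?thesis by simp
      next
        case 3
        then have "a i = 1" using \<mu> by (auto simp: a_def field_simps max_def min_def)
        then show ?thesis unfolding e using 3 2 by (intro mult_nonneg_nonneg) auto
      qed
    qed
    then have "0 \<le> rtr ((A0 - A) * B)"
      unfolding rtr_spec_mult[OF B minus_carrier_mat[OF c(1)]] by (intro sum_nonneg) auto
    also have "rtr ((A0 - A) * B) = rtr (A0 * B) - rtr (A * B)"
      using c cB by (intro rtr_mult_left(2)[of _ N]) auto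
    also have "rtr (A0 * B) = rtr (A0 * X) - \<mu> * rtr (A0 * A0)"
      unfolding B_def using c by (simp add: rtr_mult_right[of _ N])
    also have "rtr (A * B) = rtr (A * X) - \<mu> * rtr (A * A0)"
      unfolding B_def using c by (simp add: rtr_mult_right[of _ N])
    finally have 1: "0 \<le> rtr (A0 * X) - \<mu> * rtr (A0 * A0) - (rtr (A * X) - \<mu> * rtr (A * A0))" .
    have "rtr ((A - A0) * (A - A0)) = rtr (A * (A - A0)) - rtr (A0 * (A - A0))"
      using c by (intro rtr_mult_left(2)[of _ N]) auto
    also have "\<dots> = rtr (A * A) - rtr (A * A0) - (rtr (A0 * A) - rtr (A0 * A0))"
      using c by (simp add: rtr_mult_right[of _ N])
    also have "rtr (A0 * A) = rtr (A * A0)" using c by (intro rtr_mult_comm[of _ N N]) auto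
    finally have 2: "rtr ((A - A0) * (A - A0)) = rtr (A * A) - rtr (A * A0) - (rtr (A * A0) - rtr (A0 * A0))" .
    show ?thesis unfolding 2 using 1 by (simp add: algebra_simps)
  qed
  then show ?thesis using p0 by blast
qed

lemma povm_zero: "povm_elem N (0\<^sub>m N N)"
proof -
  have "1\<^sub>m N - 0\<^sub>m N N = (1\<^sub>m N :: complex mat)" by (intro eq_matI) auto
  then show ?thesis using psd_zero psd_one by (simp add: povm_elem_def)
qed

lemma povm_rtr_square: "povm_elem N A \<Longrightarrow> rtr (A * A) \<le> real N"
proof -
  assume A: "povm_elem N A"
  have "rtr (A * A) \<le> rtr A" by (rule povm_rtr_bounds(2)[OF A povmD(1)[OF A]])
  also have "\<dots> \<le> rtr (1\<^sub>m N)" using povm_rtr_bounds(2)[OF A psd_one] povmD(3)[OF A] by simp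
  also have "\<dots> = real N" by (simp add: rtr_def mtrace_def)
  finally show ?thesis .
qed

text \<open>Both squares have trace at most 1, and the cross terms enter with a negative
  sign.\<close>

lemma density_rtr_diff_square:
  assumes "\<omega> \<in> density N" "\<omega>' \<in> density N"
  shows "rtr ((\<omega> - \<omega>') * (\<omega> - \<omega>')) \<le> 2"
proof -
  note c = densityD[OF assms(1)] densityD[OF assms(2)]
  have p: "povm_elem N \<omega>" "povm_elem N \<omega>'" using c density_le_one assms by (auto simp: povm_elem_def)
  have "rtr ((\<omega> - \<omega>') * (\<omega> - \<omega>')) = rtr (\<omega> * (\<omega> - \<omega>')) - rtr (\<omega>' * (\<omega> - \<omega>'))"
    using c by (intro rtr_mult_left(2)[of _ N]) auto
  also have "\<dots> = rtr (\<omega> * \<omega>) - rtr (\<omega> * \<omega>') - (rtr (\<omega>' * \<omega>) - rtr (\<omega>' * \<omega>'))"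
    using c by (simp add: rtr_mult_right[of _ N])
  also have "\<dots> \<le> 2"
    using povm_rtr_bounds[OF p(1) c(1)] povm_rtr_bounds[OF p(1) c(6)] povm_rtr_bounds[OF p(2) c(1)] povm_rtr_bounds[OF p(2) c(6)] c
    by simp
  finally show ?thesis .
qed

text \<open>
  Subtracting \<open>\<mu>/2 tr A\<^sup>2\<close> from the payoff makes the best response to \<open>\<omega>\<close> an explicit spectral
  truncation and the value of the game a smooth convex function of \<open>\<omega>\<close>; the best response to a
  near-minimiser is then nearly optimal against all of \<open>K\<close>, without any compactness.
\<close>

lemma minimax_test:
  fixes \<delta> c :: real
  assumes \<rho>: "\<rho> \<in> density N" and K: "K \<subseteq> density N" "K \<noteq> {}" "convex_mat_set K"
    and c: "c > 0" and \<delta>: "0 < \<delta>" "\<delta> \<le> 1 / 2"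
  shows "(\<exists>A. povm_elem N A \<and> rtr (A * \<rho>) \<ge> 1 - \<delta> \<and> (\<forall>\<omega>\<in>K. c * rtr (A * \<omega>) \<le> 1)) \<or>
    (\<exists>\<omega>\<in>K. \<forall>A. povm_elem N A \<longrightarrow> rtr (A * \<rho>) \<le> 1 - \<delta> / 2 + c * rtr (A * \<omega>))"
proof -
  note R = densityD[OF \<rho>]
  \<comment> \<open>As \<open>tr (A * A)\<close> is at most \<open>N\<close>, this makes the total
    penalty at most \<open>\<delta> / 2\<close>, the gap between the two alternatives of the
    statement.\<close>
  define \<mu> where "\<mu> = \<delta> / real N"
  have \<mu>: "\<mu> > 0" using \<delta> R(5) by (simp add: \<mu>_def)
  define g where "g A \<omega> = rtr (A * \<rho>) - c * rtr (A * \<omega>) - \<mu> / 2 * rtr (A * A)" for A \<omega>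
  have "\<exists>A0. povm_elem N A0 \<and> (\<forall>A. povm_elem N A \<longrightarrow>
      g A \<omega> + \<mu> / 2 * rtr ((A - A0) * (A - A0)) \<le> g A0 \<omega>)" if \<omega>: "\<omega> \<in> K" for \<omega>
  proof -
    note W = densityD[OF subsetD[OF K(1) \<omega>]]
    define X where "X = \<rho> - complex_of_real c \<cdot>\<^sub>m \<omega>"
    have X: "X \<in> carrier_mat N N" unfolding X_def using R W by auto
    have "hermitian X" unfolding X_def hermitian_def using R W by (simp add: adj_minus[of _ N N] adj_smult)
    then obtain U x where U: "spec N U x X" using hermitian_spec[OF X] by blast
    have e: "rtr (A * X) = rtr (A * \<rho>) - c * rtr (A * \<omega>)" if "povm_elem N A" for A
      unfolding X_def using povmD(3)[OF that] R W by (simp add: rtr_mult_right[of _ N])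
    from clip_optimal[OF U \<mu>] obtain A0 where "povm_elem N A0"
      "\<And>A. povm_elem N A \<Longrightarrow> rtr (A * X) - \<mu> / 2 * rtr (A * A) + \<mu> / 2 * rtr ((A - A0) * (A - A0))
       \<le> rtr (A0 * X) - \<mu> / 2 * rtr (A0 * A0)" by blast
    then show ?thesis by (intro exI[of _ A0]) (auto simp: g_def e)
  qed
  then obtain B where B: "\<And>\<omega>. \<omega> \<in> K \<Longrightarrow> povm_elem N (B \<omega>)"
    and opt: "\<And>\<omega> A. \<omega> \<in> K \<Longrightarrow> povm_elem N A \<Longrightarrow>
       g A \<omega> + \<mu> / 2 * rtr ((A - B \<omega>) * (A - B \<omega>)) \<le> g (B \<omega>) \<omega>"
    by metis
  have sq: "rtr ((A - A') * (A - A')) \<ge> 0" if "povm_elem N A" "povm_elem N A'" for A A'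
    using rtr_gram_nonneg[of "A - A'" N N] povmD[OF that(1)] povmD[OF that(2)] by (simp add: adj_minus[of _ N N] minus_carrier_mat)
  have F_nonneg: "g (B \<omega>) \<omega> \<ge> 0" if \<omega>: "\<omega> \<in> K" for \<omega>
  proof -
    note z = povm_zero[of N]
    have "g (0\<^sub>m N N) \<omega> = 0" using R densityD[OF subsetD[OF K(1) \<omega>]]
      by (simp add: g_def rtr_def mtrace_def)
    then show ?thesis using opt[OF \<omega> z] sq[OF z B[OF \<omega>]] \<mu> by (smt (verit) mult_nonneg_nonneg divide_nonneg_pos)
  qed
  \<comment> \<open>The step length towards another state of \<open>K\<close>: at most 1 for
    convexity, and so short that the second-order error, divided by \<open>t\<close>, stays below
    \<open>\<delta>\<close>.\<close>
  define t where "t = min 1 (\<delta> * \<mu> / (2 * c\<^sup>2))"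
  have t: "0 < t" "t \<le> 1" using \<delta> \<mu> c by (auto simp: t_def)
  have t2: "2 * c\<^sup>2 * t \<le> \<delta> * \<mu>"
  proof -
    have "t \<le> \<delta> * \<mu> / (2 * c\<^sup>2)" by (simp add: t_def)
    then show ?thesis using c by (simp add: field_simps)
  qed
  define I where "I = (INF \<omega>\<in>K. g (B \<omega>) \<omega>)"
  have bdd: "bdd_below ((\<lambda>\<omega>. g (B \<omega>) \<omega>) ` K)" using F_nonneg by (intro bdd_belowI[of _ 0]) auto
  have "I < I + (c * t)\<^sup>2 / \<mu>" using c t \<mu> by simp
  \<comment> \<open>The tolerance has the same order in \<open>t\<close> as the Young remainder
    below, so one division by \<open>t\<close> disposes of both.\<close>
  then obtain w where w: "w \<in> K" "g (B w) w < I + (c * t)\<^sup>2 / \<mu>"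
    unfolding I_def using cINF_less_iff[OF K(2) bdd] by blast
  have near: "g (B w) w \<le> g (B \<omega>) \<omega> + (c * t)\<^sup>2 / \<mu>" if "\<omega> \<in> K" for \<omega>
    using w(2) cINF_lower[OF bdd that] unfolding I_def by simp
  note W = densityD[OF subsetD[OF K(1) w(1)]] and pB = B[OF w(1)]
  \<comment> \<open>A small move from \<open>w\<close> towards \<open>\<omega>\<close> cannot lower
    the value by more than the tolerance. The induced change \<open>Y\<close> of the best response
    is absorbed by the quadratic surplus, which leaves the first-order inequality for the fixed test
    \<open>B w\<close>.\<close>
  have saddle: "c * rtr (B w * \<omega>) \<le> c * rtr (B w * w) + \<delta>" if \<omega>: "\<omega> \<in> K" for \<omega>
  proof -
    note O = densityD[OF subsetD[OF K(1) \<omega>]]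
    define \<omega>t where "\<omega>t = complex_of_real t \<cdot>\<^sub>m \<omega> + complex_of_real (1 - t) \<cdot>\<^sub>m w"
    have \<omega>t: "\<omega>t \<in> K" unfolding \<omega>t_def using K(3) \<omega> w(1) t unfolding convex_mat_set_def by simp
    define A where "A = B \<omega>t"
    have A: "povm_elem N A" unfolding A_def by (rule B[OF \<omega>t])
    note cA = povmD[OF A] and cB = povmD[OF pB]
    define Z where "Z = w - \<omega>"
    define Y where "Y = A - B w"
    have Z: "Z \<in> carrier_mat N N" "adj Z = Z" unfolding Z_def using O W by (auto simp: adj_minus[of _ N N])
    have Y: "Y \<in> carrier_mat N N" "adj Y = Y" unfolding Y_def using cA cB by (auto simp: adj_minus[of _ N N])
    have tr_t: "rtr (A * \<omega>t) = t * rtr (A * \<omega>) + (1 - t) * rtr (A * w)"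
    proof -
      have "rtr (A * \<omega>t) = rtr (A * (complex_of_real t \<cdot>\<^sub>m \<omega>)) + rtr (A * (complex_of_real (1 - t) \<cdot>\<^sub>m w))"
        unfolding \<omega>t_def using cA W O by (intro rtr_mult_right(1)[of _ N]) auto
      also have "rtr (A * (complex_of_real t \<cdot>\<^sub>m \<omega>)) = t * rtr (A * \<omega>)"
        using cA W O by (intro rtr_mult_right(3)[of _ N]) auto
      also have "rtr (A * (complex_of_real (1 - t) \<cdot>\<^sub>m w)) = (1 - t) * rtr (A * w)"
        using cA W O by (intro rtr_mult_right(3)[of _ N]) auto
      finally show ?thesis .
    qed
    have AZ: "rtr (A * Z) = rtr (A * w) - rtr (A * \<omega>)"
      unfolding Z_def using cA W O by (simp add: rtr_mult_right[of _ N])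
    have BZ: "rtr (B w * Z) = rtr (B w * w) - rtr (B w * \<omega>)"
      unfolding Z_def using cB W O by (simp add: rtr_mult_right[of _ N])
    have YZ: "rtr (Y * Z) = rtr (A * Z) - rtr (B w * Z)"
      unfolding Y_def using cA cB Z by (simp add: rtr_mult_left[of _ N])
    have "rtr (Y * (complex_of_real (c * t) \<cdot>\<^sub>m Z))
      \<le> \<mu> / 2 * rtr (Y * Y) + rtr ((complex_of_real (c * t) \<cdot>\<^sub>m Z) * (complex_of_real (c * t) \<cdot>\<^sub>m Z)) / (2 * \<mu>)"
      using Y Z \<mu> by (intro hs_young[of _ N]) (auto simp: adj_smult)
    also have "rtr (Y * (complex_of_real (c * t) \<cdot>\<^sub>m Z)) = c * t * rtr (Y * Z)"
      using Y Z by (intro rtr_mult_right(3)[of _ N]) auto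
    also have "rtr ((complex_of_real (c * t) \<cdot>\<^sub>m Z) * (complex_of_real (c * t) \<cdot>\<^sub>m Z)) = c * t * rtr ((complex_of_real (c * t) \<cdot>\<^sub>m Z) * Z)"
      using Z by (intro rtr_mult_right(3)[of _ N]) auto
    also have "rtr ((complex_of_real (c * t) \<cdot>\<^sub>m Z) * Z) = c * t * rtr (Z * Z)"
      using Z by (intro rtr_mult_left(3)[of _ N]) auto
    finally have young: "c * t * rtr (Y * Z) \<le> \<mu> / 2 * rtr (Y * Y) + c * t * (c * t * rtr (Z * Z)) / (2 * \<mu>)" .
    have "rtr (Z * Z) \<le> 2"
      unfolding Z_def using K(1) w(1) \<omega> by (intro density_rtr_diff_square[of _ N]) auto
    then have "c * t * (c * t * rtr (Z * Z)) / (2 * \<mu>) \<le> c * t * (c * t * 2) / (2 * \<mu>)"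
      using c t \<mu> by (intro divide_right_mono mult_left_mono) auto
    also have "\<dots> = (c * t)\<^sup>2 / \<mu>" by (simp add: power2_eq_square field_simps)
    finally have ZZ: "c * t * (c * t * rtr (Z * Z)) / (2 * \<mu>) \<le> (c * t)\<^sup>2 / \<mu>" .
    have "g A \<omega>t = g A w + c * t * rtr (A * Z)"
      unfolding g_def tr_t AZ by (simp add: algebra_simps)
    moreover have "g A w + \<mu> / 2 * rtr (Y * Y) \<le> g (B w) w"
      unfolding Y_def by (rule opt[OF w(1) A])
    moreover have "g (B w) w \<le> g A \<omega>t + (c * t)\<^sup>2 / \<mu>" unfolding A_def by (rule near[OF \<omega>t])
    moreover have "c * t * rtr (A * Z) = c * t * rtr (Y * Z) + c * t * rtr (B w * Z)"
      unfolding YZ by (simp add: algebra_simps)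
    ultimately have "- (2 * ((c * t)\<^sup>2 / \<mu>)) \<le> c * t * rtr (B w * Z)"
      using young ZZ by linarith
    also have "c * t * rtr (B w * Z) = t * (c * (rtr (B w * w) - rtr (B w * \<omega>)))"
      unfolding BZ by simp
    also have "- (2 * ((c * t)\<^sup>2 / \<mu>)) = t * (- (2 * c\<^sup>2 * t / \<mu>))"
      by (simp add: power2_eq_square)
    finally have "t * (- (2 * c\<^sup>2 * t / \<mu>)) \<le> t * (c * (rtr (B w * w) - rtr (B w * \<omega>)))" .
    then have "- (2 * c\<^sup>2 * t / \<mu>) \<le> c * (rtr (B w * w) - rtr (B w * \<omega>))"
      by (rule mult_left_le_imp_le[OF _ t(1)])
    moreover have "2 * c\<^sup>2 * t / \<mu> \<le> \<delta>" using t2 \<mu> by (simp add: field_simps)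
    ultimately show ?thesis by (simp add: algebra_simps)
  qed
  define \<gamma> where "\<gamma> = rtr (B w * \<rho>) - c * rtr (B w * w)"
  have Bw: "0 \<le> rtr (B w * w)" "rtr (B w * \<rho>) \<le> 1"
    using povm_rtr_bounds[OF pB W(1)] povm_rtr_bounds[OF pB R(1)] R by auto
  show ?thesis
  proof (cases "\<gamma> \<ge> 1 - \<delta>")
    case True
    have "1 - \<delta> \<le> rtr (B w * \<rho>)" using True Bw c by (smt (verit) \<gamma>_def mult_nonneg_nonneg)
    \<comment> \<open>The value being at least \<open>1 - \<delta>\<close> gives
      \<open>c * rtr (B w * w) \<le> \<delta>\<close>, hence a bound of \<open>2 * \<delta>\<close>
      on all of \<open>K\<close>; this is where \<open>\<delta> \<le> 1 / 2\<close> enters.\<close>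
    moreover have "c * rtr (B w * \<omega>) \<le> 1" if "\<omega> \<in> K" for \<omega>
      using saddle[OF that] True Bw \<delta> unfolding \<gamma>_def by linarith
    ultimately show ?thesis using pB by blast
  next
    case False
    have "rtr (A * \<rho>) \<le> 1 - \<delta> / 2 + c * rtr (A * w)" if A: "povm_elem N A" for A
    proof -
      have "g A w \<le> g (B w) w"
        using opt[OF w(1) A] sq[OF A pB] \<mu> by (smt (verit) mult_nonneg_nonneg divide_nonneg_pos)
      also have "\<dots> \<le> \<gamma>"
      proof -
        have "0 \<le> rtr (B w * B w)" by (rule povm_rtr_bounds(1)[OF pB povmD(1)[OF pB]])
        then show ?thesis unfolding g_def \<gamma>_def using \<mu> by simp
      qed
      finally have "rtr (A * \<rho>) \<le> 1 - \<delta> + c * rtr (A * w) + \<mu> / 2 * rtr (A * A)"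
        using False unfolding g_def by linarith
      moreover have "\<mu> / 2 * rtr (A * A) \<le> \<mu> / 2 * real N"
        using povm_rtr_square[OF A] \<mu> by (intro mult_left_mono) auto
      moreover have "\<mu> / 2 * real N = \<delta> / 2" using R(5) by (simp add: \<mu>_def)
      ultimately show ?thesis by linarith
    qed
    then show ?thesis using w(1) by blast
  qed
qed

subsection \<open>Pinching in the eigenspaces of a state\<close>

text \<open>With \<open>X l i\<close> the coordinates of the eigenvectors of a state in a basis that
  diagonalises its pinching, with eigenvalues \<open>r\<close>, this is the pinching inequality: the
  state is at most \<open>v\<close> times its pinching. It is tested on the inverse of the pinching
  applied to the \<open>i\<close>-th eigenvector; terms with \<open>r l = 0\<close> vanish by the
  convention for division.\<close>

lemma pinching_coefficient_bound:
  fixes X :: "nat \<Rightarrow> nat \<Rightarrow> complex" and p r :: "nat \<Rightarrow> real" and k :: "nat \<Rightarrow> nat"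
  assumes p: "\<And>i. i < N \<Longrightarrow> p i \<ge> 0"
    and r: "\<And>l. l < N \<Longrightarrow> (\<Sum>i<N. complex_of_real (p i) * (X l i * cnj (X l i))) = complex_of_real (r l)"
    and off: "\<And>l l'. l < N \<Longrightarrow> l' < N \<Longrightarrow> l \<noteq> l' \<Longrightarrow> k l = k l' \<Longrightarrow>
       (\<Sum>i<N. complex_of_real (p i) * (X l i * cnj (X l' i))) = 0"
    and k: "\<And>l. l < N \<Longrightarrow> k l < v" and i: "i < N"
  shows "p i * (\<Sum>l<N. (cmod (X l i))\<^sup>2 / r l) \<le> real v"
proof -
  define z where "z l = X l i / complex_of_real (r l)" for l
  define s where "s = (\<Sum>l<N. (cmod (X l i))\<^sup>2 / r l)"
  \<comment> \<open>The overlap of the \<open>j\<close>-th eigenvector with the part of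
    \<open>z\<close> in block \<open>\<kappa>\<close>. Cauchy-Schwarz over the \<open>v\<close>
    blocks produces the factor \<open>v\<close>, and \<open>block\<close> shows that the blockwise
    quadratic forms add up to \<open>s\<close> again.\<close>
  define Y where "Y \<kappa> j = (\<Sum>l\<in>{l\<in>{..<N}. k l = \<kappa>}. cnj (z l) * X l j)" for \<kappa> j
  have Ysum: "(\<Sum>\<kappa><v. Y \<kappa> j) = (\<Sum>l<N. cnj (z l) * X l j)" for j
    unfolding Y_def using k by (intro sum.group) auto
  have "(\<Sum>l<N. cnj (z l) * X l i) = complex_of_real s"
    unfolding s_def z_def of_real_sum
    by (intro sum.cong) (simp_all add: complex_norm_square mult.commute del: of_real_power)
  then have Yi: "(\<Sum>\<kappa><v. Y \<kappa> i) = complex_of_real s" using Ysum by simp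
  have r_nonneg: "r l \<ge> 0" if "l < N" for l
  proof -
    have "complex_of_real (r l) = complex_of_real (\<Sum>i<N. p i * (cmod (X l i))\<^sup>2)"
      unfolding r[OF that, symmetric] by (simp add: complex_norm_square del: of_real_power)
    then have "r l = (\<Sum>i<N. p i * (cmod (X l i))\<^sup>2)" using of_real_eq_iff by blast
    then show ?thesis using p by (auto intro!: sum_nonneg)
  qed
  have block: "(\<Sum>j<N. p j * (cmod (Y \<kappa> j))\<^sup>2) = (\<Sum>l\<in>{l\<in>{..<N}. k l = \<kappa>}. (cmod (X l i))\<^sup>2 / r l)" for \<kappa>
  proof -
    let ?S = "{l\<in>{..<N}. k l = \<kappa>}"
    have "complex_of_real (\<Sum>j<N. p j * (cmod (Y \<kappa> j))\<^sup>2)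
       = (\<Sum>j<N. complex_of_real (p j) * (Y \<kappa> j * cnj (Y \<kappa> j)))"
      by (simp add: complex_norm_square del: of_real_power)
    also have "\<dots> = (\<Sum>j<N. \<Sum>l\<in>?S. \<Sum>l'\<in>?S. (cnj (z l) * z l') * (complex_of_real (p j) * (X l j * cnj (X l' j))))"
      unfolding Y_def by (simp add: sum_product sum_distrib_left algebra_simps)
    also have "\<dots> = (\<Sum>l\<in>?S. \<Sum>j<N. \<Sum>l'\<in>?S. (cnj (z l) * z l') * (complex_of_real (p j) * (X l j * cnj (X l' j))))"
      by (rule sum.swap)
    also have "\<dots> = (\<Sum>l\<in>?S. \<Sum>l'\<in>?S. \<Sum>j<N. (cnj (z l) * z l') * (complex_of_real (p j) * (X l j * cnj (X l' j))))"
      by (intro sum.cong refl sum.swap)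
    also have "\<dots> = (\<Sum>l\<in>?S. \<Sum>l'\<in>?S. (cnj (z l) * z l') * (\<Sum>j<N. complex_of_real (p j) * (X l j * cnj (X l' j))))"
      by (simp add: sum_distrib_left)
    also have "\<dots> = (\<Sum>l\<in>?S. \<Sum>l'\<in>?S. if l' = l then (cnj (z l) * z l) * complex_of_real (r l) else 0)"
      using r off by (intro sum.cong refl) auto
    also have "\<dots> = (\<Sum>l\<in>?S. (cnj (z l) * z l) * complex_of_real (r l))"
      by (intro sum.cong refl) (simp add: sum.delta)
    also have "\<dots> = (\<Sum>l\<in>?S. complex_of_real ((cmod (X l i))\<^sup>2 / r l))"
    proof (intro sum.cong refl)
      fix l
      show "cnj (z l) * z l * complex_of_real (r l) = complex_of_real ((cmod (X l i))\<^sup>2 / r l)"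
        unfolding z_def by (cases "r l = 0") (simp_all add: complex_norm_square mult.commute del: of_real_power)
    qed
    finally have "complex_of_real (\<Sum>j<N. p j * (cmod (Y \<kappa> j))\<^sup>2)
       = complex_of_real (\<Sum>l\<in>?S. (cmod (X l i))\<^sup>2 / r l)" by simp
    then show ?thesis using of_real_eq_iff by blast
  qed
  have "p i * s\<^sup>2 = p i * (cmod (\<Sum>\<kappa><v. Y \<kappa> i))\<^sup>2" unfolding Yi by simp
  also have "\<dots> \<le> (\<Sum>j<N. p j * (cmod (\<Sum>\<kappa><v. Y \<kappa> j))\<^sup>2)"
    using i p by (intro member_le_sum) auto
  also have "\<dots> \<le> (\<Sum>j<N. p j * (real v * (\<Sum>\<kappa><v. (cmod (Y \<kappa> j))\<^sup>2)))"
  proof (intro sum_mono mult_left_mono)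
    fix j assume "j \<in> {..<N}"
    have "(cmod (\<Sum>\<kappa><v. Y \<kappa> j))\<^sup>2 \<le> (\<Sum>\<kappa><v. cmod (Y \<kappa> j))\<^sup>2"
      by (intro power_mono norm_sum) auto
    also have "\<dots> \<le> (\<Sum>\<kappa><v. (cmod (Y \<kappa> j))\<^sup>2) * real (card {..<v})"
      by (rule sum_squared_le_sum_of_squares)
    finally show "(cmod (\<Sum>\<kappa><v. Y \<kappa> j))\<^sup>2 \<le> real v * (\<Sum>\<kappa><v. (cmod (Y \<kappa> j))\<^sup>2)"
      by (simp add: mult.commute)
  qed (use p in auto)
  also have "\<dots> = real v * (\<Sum>j<N. \<Sum>\<kappa><v. p j * (cmod (Y \<kappa> j))\<^sup>2)"
    by (simp add: sum_distrib_left algebra_simps)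
  also have "(\<Sum>j<N. \<Sum>\<kappa><v. p j * (cmod (Y \<kappa> j))\<^sup>2) = (\<Sum>\<kappa><v. \<Sum>j<N. p j * (cmod (Y \<kappa> j))\<^sup>2)"
    by (rule sum.swap)
  also have "\<dots> = (\<Sum>\<kappa><v. \<Sum>l\<in>{l\<in>{..<N}. k l = \<kappa>}. (cmod (X l i))\<^sup>2 / r l)"
    by (simp add: block)
  also have "\<dots> = s" unfolding s_def using k by (intro sum.group) auto
  finally have main: "p i * s\<^sup>2 \<le> real v * s" .
  have "s \<ge> 0" unfolding s_def using r_nonneg by (auto intro!: sum_nonneg)
  then have "p i * s \<le> real v"
  proof (cases "s = 0")
    case False
    then have "s > 0" using \<open>s \<ge> 0\<close> by simp
    then show ?thesis using main by (simp add: power2_eq_square mult.assoc[symmetric])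
  qed simp
  then show ?thesis by (simp add: s_def)
qed

text \<open>Pinching into \<open>v\<close> blocks raises the entropy by at most
  \<open>log 2 v\<close>. For each eigenvector the logarithms are compared through
  \<open>ln y \<le> y - 1\<close>, averaged with the weights
  \<open>(cmod (X l i))\<^sup>2\<close>.\<close>

lemma pinching_entropy_bound:
  fixes X :: "nat \<Rightarrow> nat \<Rightarrow> complex" and p r :: "nat \<Rightarrow> real" and k :: "nat \<Rightarrow> nat"
  assumes p: "\<And>i. i < N \<Longrightarrow> p i \<ge> 0" "(\<Sum>i<N. p i) = 1"
    and r: "\<And>l. l < N \<Longrightarrow> (\<Sum>i<N. complex_of_real (p i) * (X l i * cnj (X l i))) = complex_of_real (r l)"
    and off: "\<And>l l'. l < N \<Longrightarrow> l' < N \<Longrightarrow> l \<noteq> l' \<Longrightarrow> k l = k l' \<Longrightarrow>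
       (\<Sum>i<N. complex_of_real (p i) * (X l i * cnj (X l' i))) = 0"
    and k: "\<And>l. l < N \<Longrightarrow> k l < v" and v: "v > 0"
    and X: "\<And>i. i < N \<Longrightarrow> (\<Sum>l<N. (cmod (X l i))\<^sup>2) = 1"
  shows "(\<Sum>i<N. p i * log 2 (p i)) \<le> (\<Sum>l<N. r l * log 2 (r l)) + log 2 (real v)"
proof -
  have r_eq: "r l = (\<Sum>i<N. p i * (cmod (X l i))\<^sup>2)" if "l < N" for l
  proof -
    have "complex_of_real (r l) = complex_of_real (\<Sum>i<N. p i * (cmod (X l i))\<^sup>2)"
      unfolding r[OF that, symmetric] by (simp add: complex_norm_square del: of_real_power)
    then show ?thesis using of_real_eq_iff by blast
  qed
  have row: "p i * log 2 (p i) \<le> (\<Sum>l<N. p i * (cmod (X l i))\<^sup>2 * log 2 (r l)) + p i * log 2 (real v)"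
    if i: "i < N" for i
  proof (cases "p i = 0")
    case False
    then have pi: "p i > 0" using p(1)[OF i] by simp
    have summand: "(cmod (X l i))\<^sup>2 * log 2 (p i) \<le> (cmod (X l i))\<^sup>2 * log 2 (r l) + (cmod (X l i))\<^sup>2 * log 2 (real v)
       + (p i / real v * ((cmod (X l i))\<^sup>2 / r l) - (cmod (X l i))\<^sup>2) / ln 2" if l: "l < N" for l
    proof (cases "X l i = 0")
      case False
      have "0 < p i * (cmod (X l i))\<^sup>2" using pi False by simp
      also have "\<dots> \<le> r l" unfolding r_eq[OF l] using i p(1) by (intro member_le_sum) auto
      finally have rl: "r l > 0" .
      \<comment> \<open>The weighted mean of this argument over \<open>l\<close> is at most 1 by
        \<open>pinching_coefficient_bound\<close>, so the linear remainders sum to something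
        nonpositive.\<close>
      have "ln (p i / (r l * real v)) \<le> p i / (r l * real v) - 1"
        using pi rl v by (intro ln_le_minus_one) auto
      moreover have "ln (p i / (r l * real v)) = ln (p i) - ln (r l) - ln (real v)"
        using pi rl v by (simp add: ln_div ln_mult)
      ultimately have "ln (p i) \<le> ln (r l) + ln (real v) + (p i / (r l * real v) - 1)" by simp
      then have "ln (p i) / ln 2 \<le> (ln (r l) + ln (real v) + (p i / (r l * real v) - 1)) / ln 2"
        by (rule divide_right_mono) simp
      then have "log 2 (p i) \<le> log 2 (r l) + log 2 (real v) + (p i / (r l * real v) - 1) / ln 2"
        by (simp only: log_def add_divide_distrib)
      then have "(cmod (X l i))\<^sup>2 * log 2 (p i)
         \<le> (cmod (X l i))\<^sup>2 * (log 2 (r l) + log 2 (real v) + (p i / (r l * real v) - 1) / ln 2)"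
        by (rule mult_left_mono) auto
      also have "\<dots> = (cmod (X l i))\<^sup>2 * log 2 (r l) + (cmod (X l i))\<^sup>2 * log 2 (real v)
         + ((cmod (X l i))\<^sup>2 * (p i / (r l * real v) - 1)) / ln 2"
        by (simp only: distrib_left times_divide_eq_right)
      also have "(cmod (X l i))\<^sup>2 * (p i / (r l * real v) - 1)
         = p i / real v * ((cmod (X l i))\<^sup>2 / r l) - (cmod (X l i))\<^sup>2"
        by (simp add: right_diff_distrib mult.commute)
      finally show ?thesis .
    qed simp
    have "log 2 (p i) = (\<Sum>l<N. (cmod (X l i))\<^sup>2 * log 2 (p i))"
      using X[OF i] by (simp flip: sum_distrib_right)
    also have "\<dots> \<le> (\<Sum>l<N. (cmod (X l i))\<^sup>2 * log 2 (r l) + (cmod (X l i))\<^sup>2 * log 2 (real v)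
       + (p i / real v * ((cmod (X l i))\<^sup>2 / r l) - (cmod (X l i))\<^sup>2) / ln 2)"
      using summand by (intro sum_mono) auto
    also have "\<dots> = (\<Sum>l<N. (cmod (X l i))\<^sup>2 * log 2 (r l)) + (\<Sum>l<N. (cmod (X l i))\<^sup>2) * log 2 (real v)
       + (p i / real v * (\<Sum>l<N. (cmod (X l i))\<^sup>2 / r l) - (\<Sum>l<N. (cmod (X l i))\<^sup>2)) / ln 2"
      by (simp only: sum.distrib sum_subtractf sum_distrib_left sum_distrib_right sum_divide_distrib[symmetric])
    also have "\<dots> \<le> (\<Sum>l<N. (cmod (X l i))\<^sup>2 * log 2 (r l)) + log 2 (real v)"
    proof -
      have "p i * (\<Sum>l<N. (cmod (X l i))\<^sup>2 / r l) \<le> real v"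
        by (rule pinching_coefficient_bound[of N p X r k v i, OF p(1) r off k i]) auto
      then have "p i / real v * (\<Sum>l<N. (cmod (X l i))\<^sup>2 / r l) \<le> 1" using v by (simp add: field_simps)
      then have "(p i / real v * (\<Sum>l<N. (cmod (X l i))\<^sup>2 / r l) - 1) / ln 2 \<le> 0"
        by (simp add: divide_nonpos_pos)
      then show ?thesis using X[OF i] by simp
    qed
    finally have "p i * log 2 (p i) \<le> p i * ((\<Sum>l<N. (cmod (X l i))\<^sup>2 * log 2 (r l)) + log 2 (real v))"
      using pi by (intro mult_left_mono) auto
    then show ?thesis by (simp add: distrib_left sum_distrib_left mult.assoc)
  qed simp
  have "(\<Sum>i<N. p i * log 2 (p i)) \<le> (\<Sum>i<N. (\<Sum>l<N. p i * (cmod (X l i))\<^sup>2 * log 2 (r l)) + p i * log 2 (real v))"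
    using row by (intro sum_mono) auto
  also have "\<dots> = (\<Sum>i<N. \<Sum>l<N. p i * (cmod (X l i))\<^sup>2 * log 2 (r l)) + log 2 (real v)"
    unfolding sum.distrib using p(2) by (simp flip: sum_distrib_right)
  also have "(\<Sum>i<N. \<Sum>l<N. p i * (cmod (X l i))\<^sup>2 * log 2 (r l)) = (\<Sum>l<N. \<Sum>i<N. p i * (cmod (X l i))\<^sup>2 * log 2 (r l))"
    by (rule sum.swap)
  also have "\<dots> = (\<Sum>l<N. r l * log 2 (r l))"
    by (intro sum.cong refl) (simp add: r_eq sum_distrib_right)
  finally show ?thesis .
qed

lemma triple_index:
  assumes "Y \<in> carrier_mat N N" "G \<in> carrier_mat N N" "l < N" "m < N"
  shows "(adj Y * G * Y) $$ (l,m) = (\<Sum>j<N. \<Sum>j'<N. cnj (Y $$ (j,l)) * G $$ (j,j') * Y $$ (j',m))"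
proof -
  have "(adj Y * G * Y) $$ (l,m) = (\<Sum>j'<N. (adj Y * G) $$ (l,j') * Y $$ (j',m))"
    using assms by (intro index_mult_mat_sum[of _ N _ _ N]) auto
  also have "\<dots> = (\<Sum>j'<N. \<Sum>j<N. cnj (Y $$ (j,l)) * G $$ (j,j') * Y $$ (j',m))"
  proof (intro sum.cong refl)
    fix j' assume "j' \<in> {..<N}"
    then have "(adj Y * G) $$ (l,j') = (\<Sum>j<N. adj Y $$ (l,j) * G $$ (j,j'))"
      using assms by (intro index_mult_mat_sum[of _ N _ _ N]) auto
    also have "\<dots> = (\<Sum>j<N. cnj (Y $$ (j,l)) * G $$ (j,j'))" using assms by (intro sum.cong) auto
    finally show "(adj Y * G) $$ (l,j') * Y $$ (j',m) = (\<Sum>j<N. cnj (Y $$ (j,l)) * G $$ (j,j') * Y $$ (j',m))"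
      by (simp add: sum_distrib_right)
  qed
  also have "\<dots> = (\<Sum>j<N. \<Sum>j'<N. cnj (Y $$ (j,l)) * G $$ (j,j') * Y $$ (j',m))" by (rule sum.swap)
  finally show ?thesis .
qed

text \<open>
  A basis adapted to the blocks of \<open>\<kappa>\<close> that diagonalises each diagonal block of \<open>G\<close>: shifting the
  block with label \<open>m\<close> by \<open>3 m\<close> makes the spectra of different blocks disjoint, so that every
  eigenvector of the shifted matrix lives in a single block.
\<close>

lemma block_diagonalisation:
  fixes \<kappa> :: "nat \<Rightarrow> nat"
  assumes G: "psd N G" and G1: "psd N (1\<^sub>m N - G)"
  shows "\<exists>Y k. unitary N Y \<and> (\<forall>j<N. \<forall>l<N. Y $$ (j,l) \<noteq> 0 \<longrightarrow> \<kappa> j = k l) \<and> (\<forall>l<N. \<exists>j<N. \<kappa> j = k l) \<and>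
     (\<forall>l<N. \<forall>l'<N. l \<noteq> l' \<longrightarrow> k l = k l' \<longrightarrow> (adj Y * G * Y) $$ (l,l') = 0)"
proof -
  note cG = psdD[OF G]
  define H where "H = mat N N (\<lambda>(i,j). if \<kappa> i = \<kappa> j then G $$ (i,j) + (if i = j then of_nat (3 * \<kappa> i) else 0) else 0)"
  have H: "H \<in> carrier_mat N N" by (simp add: H_def)
  have symG: "cnj (G $$ (j,i)) = G $$ (i,j)" if "i < N" "j < N" for i j
    using that cG adj_index[of i G j] by auto
  have "hermitian H" unfolding hermitian_def
    by (rule eq_matI) (auto simp: H_def symG)
  then obtain Y h where Y: "spec N Y h H" using hermitian_spec[OF H] by blast
  note cY = specD(2)[OF Y] and uY = unitaryD[OF specD(1)[OF Y]]
  note asc = assoc_mult_mat[of _ N N _ N _ N] mult_carrier_mat[of _ N N _ N]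
  have HY: "H * Y = Y * dg N h"
  proof -
    have "H * Y = Y * (adj Y * H * Y)" using cY H uY(2) by (simp add: asc flip: assoc_mult_mat[of Y N N "adj Y" N _ N])
    then show ?thesis using specD(5)[OF Y] by simp
  qed
  \<comment> \<open>The component of an eigenvector in one block, if nonzero, is again an
    eigenvector of the block-diagonal \<open>H\<close>. Its Rayleigh quotient is the shift plus a
    number between 0 and 1, because \<open>G\<close> lies between 0 and the identity.\<close>
  have range: "3 * real (\<kappa> j) \<le> h l \<and> h l \<le> 3 * real (\<kappa> j) + 1" if j: "j < N" and l: "l < N" and nz: "Y $$ (j,l) \<noteq> 0" for j l
  proof -
    define E where "E = dg N (\<lambda>i. if \<kappa> i = \<kappa> j then 1 else 0)"
    have E: "E \<in> carrier_mat N N" "adj E = E" by (auto simp: E_def)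
    have EE: "E * E = E" unfolding E_def by (auto intro!: dg_cong)
    have EHE: "E * H = E * G * E + complex_of_real (3 * real (\<kappa> j)) \<cdot>\<^sub>m E"
      unfolding E_def using cG H
      by (intro eq_matI)
        (auto simp: dg_mult_left_index[of _ N N] dg_mult_right_index[of _ N N] mult_carrier_mat[of _ N N _ N] H_def
          simp del: index_mult_mat(1))
    define Z where "Z = E * Y"
    have Z: "Z \<in> carrier_mat N N" unfolding Z_def using E cY by auto
    define n where "n = (\<Sum>i<N. (cmod (Z $$ (i,l)))\<^sup>2)"
    have nZ: "(adj Z * Z) $$ (l,l) = of_real n" unfolding n_def by (rule gram_diag[OF Z l])
    have "Z $$ (j,l) = Y $$ (j,l)"
      unfolding Z_def E_def using j l cY by (simp add: dg_mult_left_index[of _ N N] del: index_mult_mat(1))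
    then have "0 < (cmod (Z $$ (j,l)))\<^sup>2" using nz by simp
    also have "\<dots> \<le> n" unfolding n_def using j by (intro member_le_sum) auto
    finally have n: "n > 0" .
    have ZZ: "adj Z * Z = adj Y * E * Y"
    proof -
      have "adj Z * Z = adj Y * (E * E) * Y"
        unfolding Z_def using E cY by (simp add: adj_mult[of _ N N _ N] asc)
      then show ?thesis by (simp add: EE)
    qed
    have "adj Z * Z * dg N h = adj Y * E * (H * Y)"
      unfolding ZZ HY using E cY by (simp add: asc)
    also have "\<dots> = adj Y * (E * H) * Y" using E cY H by (simp add: asc)
    also have "\<dots> = adj Y * (E * G * E) * Y + adj Y * (complex_of_real (3 * real (\<kappa> j)) \<cdot>\<^sub>m E) * Y"
      unfolding EHE using E cY cG
      by (simp add: mult_add_distrib_mat[of _ N N _ N] add_mult_distrib_mat[of _ N N _ _ N] mult_carrier_mat[of _ N N _ N])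
    also have "adj Y * (E * G * E) * Y = adj Z * G * Z"
      unfolding Z_def using E cY cG by (simp add: adj_mult[of _ N N _ N] asc)
    also have "adj Y * (complex_of_real (3 * real (\<kappa> j)) \<cdot>\<^sub>m E) * Y = complex_of_real (3 * real (\<kappa> j)) \<cdot>\<^sub>m (adj Z * Z)"
      unfolding ZZ using E cY
      by (simp add: mult_smult_distrib[of _ N N _ N] mult_smult_assoc_mat[of _ N N _ N] mult_carrier_mat[of _ N N _ N])
    finally have eq: "adj Z * Z * dg N h = adj Z * G * Z + complex_of_real (3 * real (\<kappa> j)) \<cdot>\<^sub>m (adj Z * Z)" .
    define q where "q = Re ((adj Z * G * Z) $$ (l,l))"
    have cc: "adj Z * Z \<in> carrier_mat N N" "adj Z * G * Z \<in> carrier_mat N N" using Z cG by auto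
    have "Re ((adj Z * Z * dg N h) $$ (l,l)) = n * h l"
      using l cc nZ by (simp add: dg_mult_right_index[of _ N N] del: index_mult_mat(1))
    moreover have "Re ((adj Z * G * Z + complex_of_real (3 * real (\<kappa> j)) \<cdot>\<^sub>m (adj Z * Z)) $$ (l,l)) = q + 3 * real (\<kappa> j) * n"
      using l cc nZ carrier_matD[OF Z] by (simp add: q_def del: index_mult_mat(1))
    ultimately have nh: "n * h l = q + 3 * real (\<kappa> j) * n" using eq by simp
    have q0: "q \<ge> 0" unfolding q_def by (rule psd_diag_nonneg[OF psd_congruence[OF G Z] l])
    have "adj Z * (1\<^sub>m N - G) * Z = adj Z * Z - adj Z * G * Z"
      using Z cG
      by (simp add: mult_minus_distrib_mat[of _ N N _ N] minus_mult_distrib_mat[of _ N N _ _ N] mult_carrier_mat[of _ N N _ N])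
    then have q1: "q \<le> n"
      using psd_diag_nonneg[OF psd_congruence[OF G1 Z] l] l cc nZ carrier_matD[OF Z] by (simp add: q_def del: index_mult_mat(1))
    have "n * (h l - 3 * real (\<kappa> j)) \<ge> 0" "n * (h l - 3 * real (\<kappa> j)) \<le> n * 1"
      using nh q0 q1 by (auto simp: algebra_simps)
    then show ?thesis using n by (auto simp: zero_le_mult_iff)
  qed
  have ex: "\<exists>j<N. Y $$ (j,l) \<noteq> 0" if l: "l < N" for l
  proof (rule ccontr)
    assume "\<not> ?thesis"
    then have "(\<Sum>i<N. (cmod (Y $$ (i,l)))\<^sup>2) = 0" by (intro sum.neutral) auto
    then show False using gram_diag[OF cY l] uY(3) l by simp
  qed
  define k where "k l = \<kappa> (SOME j. j < N \<and> Y $$ (j,l) \<noteq> 0)" for l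
  have wit: "(SOME j. j < N \<and> Y $$ (j,l) \<noteq> 0) < N \<and> Y $$ (SOME j. j < N \<and> Y $$ (j,l) \<noteq> 0, l) \<noteq> 0" if "l < N" for l
    using someI_ex[OF ex[OF that, unfolded Bex_def]] by simp
  \<comment> \<open>The intervals from \<open>3 m\<close> to \<open>3 m + 1\<close> are disjoint for
    distinct \<open>m\<close>, so the eigenvalue determines the block.\<close>
  have k: "\<kappa> j = k l" if "j < N" "l < N" "Y $$ (j,l) \<noteq> 0" for j l
    using range[OF that] range[of "SOME j. j < N \<and> Y $$ (j,l) \<noteq> 0" l] wit[OF that(2)] that(2)
    unfolding k_def by linarith
  have off: "(adj Y * G * Y) $$ (l,m) = 0" if l: "l < N" and m: "m < N" and ne: "l \<noteq> m" and eq: "k l = k m" for l m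
  proof -
    have "(adj Y * G * Y) $$ (l,m) = (\<Sum>j<N. \<Sum>j'<N. cnj (Y $$ (j,l)) * G $$ (j,j') * Y $$ (j',m))"
      by (rule triple_index[OF cY cG(1) l m])
    \<comment> \<open>Both columns are supported in the same block, where \<open>G\<close> and
      \<open>H\<close> differ only by a multiple of the identity; that multiple does not affect the
      orthogonality of distinct columns.\<close>
    also have "\<dots> = (\<Sum>j<N. \<Sum>j'<N. cnj (Y $$ (j,l)) * (H $$ (j,j') - of_nat (3 * k l) * 1\<^sub>m N $$ (j,j')) * Y $$ (j',m))"
    proof (intro sum.cong refl)
      fix j j' assume jj: "j \<in> {..<N}" "j' \<in> {..<N}"
      show "cnj (Y $$ (j,l)) * G $$ (j,j') * Y $$ (j',m)
         = cnj (Y $$ (j,l)) * (H $$ (j,j') - of_nat (3 * k l) * 1\<^sub>m N $$ (j,j')) * Y $$ (j',m)"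
      proof (cases "Y $$ (j,l) = 0 \<or> Y $$ (j',m) = 0")
        case False
        then have "\<kappa> j = k l" "\<kappa> j' = k l" using k jj l m eq by auto
        then show ?thesis using jj by (simp add: H_def)
      qed auto
    qed
    also have "\<dots> = (\<Sum>j<N. \<Sum>j'<N. cnj (Y $$ (j,l)) * H $$ (j,j') * Y $$ (j',m))
       - of_nat (3 * k l) * (\<Sum>j<N. \<Sum>j'<N. cnj (Y $$ (j,l)) * 1\<^sub>m N $$ (j,j') * Y $$ (j',m))"
      by (simp add: algebra_simps sum_subtractf sum_distrib_left)
    also have "\<dots> = (adj Y * H * Y) $$ (l,m) - of_nat (3 * k l) * (adj Y * 1\<^sub>m N * Y) $$ (l,m)"
      using triple_index[OF cY H l m] triple_index[OF cY one_carrier_mat l m] by simp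
    also have "\<dots> = 0"
      unfolding specD(5)[OF Y] using uY l m ne cY by (simp add: right_mult_one_mat[of _ N N] del: index_mult_mat(1))
    finally show ?thesis .
  qed
  have surj: "\<exists>j<N. \<kappa> j = k l" if "l < N" for l
    using wit[OF that] unfolding k_def by blast
  show ?thesis
    by (intro exI[of _ Y] exI[of _ k] conjI allI impI) (rule specD(1)[OF Y] k surj off; assumption)+
qed

text \<open>\<open>W\<close> mixes only eigenvectors of \<open>\<tau>\<close> from the same bin, so
  bin labels survive for \<open>\<tau>\<close>, while the diagonal of \<open>\<rho>\<close> in this
  basis is the spectrum of the pinched state. Eigenvalues within a bin may differ, hence
  \<open>wt W \<tau>\<close> is only bounded from above.\<close>

lemma adapted_basis:
  fixes \<kappa> :: "nat \<Rightarrow> nat"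
  assumes \<rho>: "\<rho> \<in> density N" and U: "spec N U p \<rho>" and V: "spec N V t \<tau>"
    and \<kappa>: "\<And>j. j < N \<Longrightarrow> \<kappa> j < v" and t: "\<And>j. j < N \<Longrightarrow> t j \<le> 2 powr - real (\<kappa> j)"
  shows "\<exists>W k. unitary N W \<and> (\<forall>l<N. k l < v \<and> wt W \<tau> l \<le> 2 powr - real (k l)) \<and>
     (\<Sum>j<N. wt V \<rho> j * real (\<kappa> j)) = (\<Sum>l<N. wt W \<rho> l * real (k l)) \<and>
     (\<Sum>i<N. p i * log 2 (p i)) \<le> (\<Sum>l<N. wt W \<rho> l * log 2 (wt W \<rho> l)) + log 2 (real v)"
proof -
  note R = densityD[OF \<rho>]
  note cV = specD(2)[OF V] and uV = unitaryD[OF specD(1)[OF V]]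
  note cU = specD(2)[OF U]
  note asc = assoc_mult_mat[of _ N N _ N _ N] mult_carrier_mat[of _ N N _ N]
  have v: "v > 0" using \<kappa>[OF R(5)] by simp
  define G where "G = adj V * \<rho> * V"
  have G: "psd N G" unfolding G_def by (rule psd_congruence[OF R(1) cV])
  have "adj V * (1\<^sub>m N - \<rho>) * V = 1\<^sub>m N - G"
    unfolding G_def using cV R(2) uV(3)
    by (simp add: mult_minus_distrib_mat[of _ N N _ N] minus_mult_distrib_mat[of _ N N _ _ N] mult_carrier_mat[of _ N N _ N])
  then have G1: "psd N (1\<^sub>m N - G)" using psd_congruence[OF density_le_one[OF \<rho>] cV] by simp
  obtain Y k where Y: "unitary N Y" and nz': "\<forall>j<N. \<forall>l<N. Y $$ (j,l) \<noteq> 0 \<longrightarrow> \<kappa> j = k l"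
    and surj: "\<forall>l<N. \<exists>j<N. \<kappa> j = k l"
    and off': "\<forall>l<N. \<forall>l'<N. l \<noteq> l' \<longrightarrow> k l = k l' \<longrightarrow> (adj Y * G * Y) $$ (l,l') = 0"
    using block_diagonalisation[OF G G1, of \<kappa>] by (elim exE conjE) (rule that)
  have nz: "\<kappa> j = k l" if "j < N" "l < N" "Y $$ (j,l) \<noteq> 0" for j l
    using nz' that by blast
  have off: "(adj Y * G * Y) $$ (l,l') = 0" if "l < N" "l' < N" "l \<noteq> l'" "k l = k l'" for l l'
    using off' that by blast
  note uY = unitaryD[OF Y]
  have k: "k l < v" if "l < N" for l using surj that \<kappa> by fastforce
  define W where "W = V * Y"
  have W: "unitary N W" unfolding W_def by (rule unitary_mult[OF specD(1)[OF V] Y])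
  note uW = unitaryD[OF W]
  have conj_eq: "adj W * B * W = adj Y * (adj V * B * V) * Y" if "B \<in> carrier_mat N N" for B
    unfolding W_def using cV uY(1) that by (simp add: adj_mult[of _ N N _ N] asc)
  define r where "r = wt W \<rho>"
  define Xm where "Xm = adj W * U"
  have cX: "Xm \<in> carrier_mat N N" unfolding Xm_def using uW cU by auto
  have XX: "adj Xm * Xm = 1\<^sub>m N"
  proof -
    have "adj Xm * Xm = adj U * (W * adj W) * U"
      unfolding Xm_def using uW(1) cU by (simp add: adj_mult[of _ N N _ N] asc)
    also have "\<dots> = 1\<^sub>m N" unfolding uW(2) using cU unitaryD(3)[OF specD(1)[OF U]] by (simp add: right_mult_one_mat[of _ N N])
    finally show ?thesis .
  qed
  have R_idx: "(adj W * \<rho> * W) $$ (l,l') = (\<Sum>i<N. complex_of_real (p i) * (Xm $$ (l,i) * cnj (Xm $$ (l',i))))"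
    if "l < N" "l' < N" for l l'
  proof -
    have "adj W * \<rho> * W = (Xm * dg N p) * adj Xm"
      unfolding Xm_def by (subst specD(4)[OF U]) (use uW(1) cU in \<open>simp add: adj_mult[of _ N N _ N] asc\<close>)
    then have "(adj W * \<rho> * W) $$ (l,l') = (\<Sum>i<N. (Xm * dg N p) $$ (l,i) * adj Xm $$ (i,l'))"
      using index_mult_mat_sum[of "Xm * dg N p" N N "adj Xm" N l l'] cX that by simp
    also have "\<dots> = (\<Sum>i<N. complex_of_real (p i) * (Xm $$ (l,i) * cnj (Xm $$ (l',i))))"
      using cX that by (intro sum.cong) (auto simp: dg_mult_right_index[of _ N N] simp del: index_mult_mat(1))
    finally show ?thesis .
  qed
  have ent: "(\<Sum>i<N. p i * log 2 (p i)) \<le> (\<Sum>l<N. r l * log 2 (r l)) + log 2 (real v)"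
  proof (rule pinching_entropy_bound[where X = "\<lambda>l i. Xm $$ (l,i)" and k = k])
    show "(\<Sum>i<N. p i) = 1" by (rule density_spec(2)[OF \<rho> U])
    show "p i \<ge> 0" if "i < N" for i by (rule density_spec(1)[OF \<rho> U that])
    show "(\<Sum>i<N. complex_of_real (p i) * (Xm $$ (l, i) * cnj (Xm $$ (l, i)))) = complex_of_real (r l)" if "l < N" for l
      using R_idx[OF that that] wt_psd(2)[OF R(1) uW(1) that] by (simp add: r_def)
    show "(\<Sum>i<N. complex_of_real (p i) * (Xm $$ (l, i) * cnj (Xm $$ (l', i)))) = 0"
      if "l < N" "l' < N" "l \<noteq> l'" "k l = k l'" for l l'
      using R_idx[OF that(1,2)] off[OF that] conj_eq[OF R(2)] by (simp add: G_def)
    show "(\<Sum>l<N. (cmod (Xm $$ (l, i)))\<^sup>2) = 1" if "i < N" for i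
      using gram_diag[OF cX that] that unfolding XX
      by (metis (no_types, lifting) index_one_mat(1) of_real_eq_1_iff)
  qed (use k v in auto)
  \<comment> \<open>Both sides are the trace of \<open>G\<close> against the operator of bin labels,
    which is diagonal with matching labels in the old and in the new basis.\<close>
  have lab: "(\<Sum>j<N. wt V \<rho> j * real (\<kappa> j)) = (\<Sum>l<N. wt W \<rho> l * real (k l))"
  proof -
    have "dg N (\<lambda>j. real (\<kappa> j)) * Y = Y * dg N (\<lambda>l. real (k l))"
      using uY(1) nz
      by (intro eq_matI)
        (auto simp: dg_mult_right_index[of _ N N] dg_mult_left_index[of _ N N] simp del: index_mult_mat(1))
    then have "Y * dg N (\<lambda>l. real (k l)) * adj Y = dg N (\<lambda>j. real (\<kappa> j)) * (Y * adj Y)"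
      using uY(1) by (simp add: asc flip: assoc_mult_mat[of "dg N _" N N Y N _ N])
    then have s1: "spec N Y (\<lambda>l. real (k l)) (dg N (\<lambda>j. real (\<kappa> j)))"
      using Y uY(2) by (simp add: spec_def right_mult_one_mat[of _ N N])
    have s2: "spec N (1\<^sub>m N) (\<lambda>j. real (\<kappa> j)) (dg N (\<lambda>j. real (\<kappa> j)))"
      by (simp add: spec_def unitary_def right_mult_one_mat[of _ N N] left_mult_one_mat[of _ N N])
    have cG: "G \<in> carrier_mat N N" by (rule psdD(1)[OF G])
    have e: "adj (1\<^sub>m N) * G * 1\<^sub>m N = G" using cG by simp
    have "(\<Sum>j<N. real (\<kappa> j) * Re (G $$ (j,j))) = (\<Sum>l<N. real (k l) * Re ((adj Y * G * Y) $$ (l,l)))"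
      using rtr_spec_mult[OF s1 cG] rtr_spec_mult[OF s2 cG, unfolded e] by simp
    then show ?thesis
      unfolding wt_def conj_eq[OF R(2)] G_def[symmetric] by (simp add: mult.commute)
  qed
  \<comment> \<open>The value is a convex combination of eigenvalues of \<open>\<tau>\<close> from
    one bin.\<close>
  have wt_le: "wt W \<tau> l \<le> 2 powr - real (k l)" if l: "l < N" for l
  proof -
    have "wt W \<tau> l = Re ((adj Y * dg N t * Y) $$ (l,l))"
      unfolding wt_def conj_eq[OF specD(3)[OF V]] specD(5)[OF V] ..
    also have "(adj Y * dg N t * Y) $$ (l,l) = (\<Sum>j<N. \<Sum>j'<N. cnj (Y $$ (j,l)) * dg N t $$ (j,j') * Y $$ (j',l))"
      by (rule triple_index[OF uY(1) _ l l]) simp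
    also have "\<dots> = (\<Sum>j<N. complex_of_real (t j * (cmod (Y $$ (j,l)))\<^sup>2))"
    proof (intro sum.cong refl)
      fix j assume j: "j \<in> {..<N}"
      have "(\<Sum>j'<N. cnj (Y $$ (j,l)) * dg N t $$ (j,j') * Y $$ (j',l))
         = (\<Sum>j'<N. if j' = j then cnj (Y $$ (j,l)) * complex_of_real (t j) * Y $$ (j,l) else 0)"
        using j by (intro sum.cong) auto
      also have "\<dots> = cnj (Y $$ (j,l)) * complex_of_real (t j) * Y $$ (j,l)" using j by simp
      finally show "(\<Sum>j'<N. cnj (Y $$ (j,l)) * dg N t $$ (j,j') * Y $$ (j',l)) = complex_of_real (t j * (cmod (Y $$ (j,l)))\<^sup>2)"
        by (simp add: complex_norm_square mult.commute mult.left_commute del: of_real_power)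
    qed
    also have "Re \<dots> = (\<Sum>j<N. t j * (cmod (Y $$ (j,l)))\<^sup>2)" by simp
    also have "\<dots> \<le> (\<Sum>j<N. 2 powr - real (k l) * (cmod (Y $$ (j,l)))\<^sup>2)"
    proof (rule sum_mono)
      fix j assume j: "j \<in> {..<N}"
      show "t j * (cmod (Y $$ (j,l)))\<^sup>2 \<le> 2 powr - real (k l) * (cmod (Y $$ (j,l)))\<^sup>2"
      proof (cases "Y $$ (j,l) = 0")
        case False
        then show ?thesis using nz[of j l] t[of j] j l by (intro mult_right_mono) auto
      qed simp
    qed
    also have "\<dots> = 2 powr - real (k l) * (\<Sum>j<N. (cmod (Y $$ (j,l)))\<^sup>2)" by (simp add: sum_distrib_left)
    also have "(\<Sum>j<N. (cmod (Y $$ (j,l)))\<^sup>2) = 1"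
      using gram_diag[OF uY(1) l] l unfolding uY(3)
      by (metis (no_types, lifting) index_one_mat(1) of_real_eq_1_iff)
    finally show ?thesis by simp
  qed
  show ?thesis
    by (intro exI[of _ W] exI[of _ k] conjI allI impI W k wt_le lab ent[unfolded r_def])
qed

text \<open>Up to \<open>log 2 v\<close> for pinching and 1 for rounding to dyadic bins, the
  relative entropy is the mean of a classical log-likelihood ratio. The tests are its upper level
  sets, so the mean is controlled by their acceptance probabilities under \<open>\<rho>\<close>,
  while under \<open>\<tau>\<close> they are exponentially unlikely.\<close>

lemma rel_entropy_test_bound:
  fixes v :: nat and a\<^sub>1 a\<^sub>2 :: real
  assumes \<rho>: "\<rho> \<in> density N" and \<tau>: "\<tau> \<in> density N"
    and x: "psd N (\<tau> - complex_of_real x \<cdot>\<^sub>m 1\<^sub>m N)" "2 powr - real v < x" and a: "a\<^sub>1 \<le> a\<^sub>2"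
  shows "\<exists>T\<^sub>1 T\<^sub>2. povm_elem N T\<^sub>1 \<and> povm_elem N T\<^sub>2 \<and> rtr (T\<^sub>1 * \<tau>) \<le> 2 powr - a\<^sub>1 \<and> rtr (T\<^sub>2 * \<tau>) \<le> 2 powr - a\<^sub>2 \<and>
    rel_entropy N \<rho> \<tau> \<le> ereal (log 2 (real v) + 1 + a\<^sub>1 + (a\<^sub>2 - a\<^sub>1) * rtr (T\<^sub>1 * \<rho>) + (real v + \<bar>a\<^sub>2\<bar>) * rtr (T\<^sub>2 * \<rho>))"
proof -
  note R = densityD[OF \<rho>] and Tau = densityD[OF \<tau>]
  obtain U p where U: "spec N U p \<rho>" using psd_spec[OF R(1)] by metis
  obtain V t where V: "spec N V t \<tau>" using psd_spec[OF Tau(1)] by metis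
  have tx: "t j \<ge> x" if "j < N" for j
    using psd_spec_nonneg[OF x(1) spec_minus[OF V spec_smult[OF spec_one[OF specD(1)[OF V]]]] that] by simp
  have t0: "t j > 0" if "j < N" for j using tx[OF that] x(2) by (smt (verit) powr_gt_zero)
  have t1: "t j \<le> 1" if "j < N" for j by (rule density_spec(3)[OF \<tau> V that])
  define \<kappa> where "\<kappa> j = nat \<lfloor>- log 2 (t j)\<rfloor>" for j
  have lt: "0 \<le> - log 2 (t j)" if "j < N" for j using t0[OF that] t1[OF that] by simp
  have \<kappa>_le: "real (\<kappa> j) \<le> - log 2 (t j)" "- log 2 (t j) \<le> real (\<kappa> j) + 1" if "j < N" for j
    using lt[OF that] unfolding \<kappa>_def by linarith+
  have \<kappa>_v: "\<kappa> j < v" if "j < N" for j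
  proof -
    have "2 powr - real v < t j" using tx[OF that] x(2) by simp
    then have "- real v < log 2 (t j)" using t0[OF that] by (simp add: less_log_iff)
    then show ?thesis using \<kappa>_le(1)[OF that] by linarith
  qed
  have t\<kappa>: "t j \<le> 2 powr - real (\<kappa> j)" if "j < N" for j
    using \<kappa>_le(1)[OF that] t0[OF that] by (simp add: log_le_iff[symmetric])
  obtain W k where W: "unitary N W" and k: "\<And>l. l < N \<Longrightarrow> k l < v" "\<And>l. l < N \<Longrightarrow> wt W \<tau> l \<le> 2 powr - real (k l)"
    and k\<kappa>: "(\<Sum>j<N. wt V \<rho> j * real (\<kappa> j)) = (\<Sum>l<N. wt W \<rho> l * real (k l))"
    and ent: "(\<Sum>i<N. p i * log 2 (p i)) \<le> (\<Sum>l<N. wt W \<rho> l * log 2 (wt W \<rho> l)) + log 2 (real v)"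
    using adapted_basis[OF \<rho> U V \<kappa>_v t\<kappa>] by blast
  define r where "r = wt W \<rho>"
  have r0: "r l \<ge> 0" if "l < N" for l unfolding r_def by (rule wt_psd(1)[OF R(1) unitaryD(1)[OF W] that])
  have rsum: "(\<Sum>l<N. r l) = 1" using unitary_diag_sum[OF W R(2)] R(4) by (simp add: r_def wt_def)
  have r1: "r l \<le> 1" if "l < N" for l using member_le_sum[of l "{..<N}" r] r0 that rsum by auto
  \<comment> \<open>The log-likelihood ratio of the pinched state against the dyadic upper bound for
    \<open>\<tau>\<close>; it never exceeds \<open>v\<close>, since \<open>r l\<close> is at most 1
    and labels are below \<open>v\<close>.\<close>
  define L where "L l = log 2 (r l) + real (k l)" for l
  define T where "T a = W * dg N (\<lambda>l. if r l > 0 \<and> L l > a then 1 else 0) * adj W" for a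
  have Tspec: "spec N W (\<lambda>l. if r l > 0 \<and> L l > a then 1 else 0) (T a)" for a
    unfolding T_def by (rule spec_exists[OF W])
  have Tp: "povm_elem N (T a)" for a unfolding T_def by (rule povm_spec[OF W]) auto
  have T\<rho>: "rtr (T a * \<rho>) = (\<Sum>l<N. if r l > 0 \<and> L l > a then r l else 0)" for a
  proof -
    have "rtr (T a * \<rho>) = rtr (\<rho> * T a)" using povmD(3)[OF Tp] R by (intro rtr_mult_comm[of _ N N]) auto
    also have "\<dots> = (\<Sum>l<N. (if r l > 0 \<and> L l > a then 1 else 0) * r l)"
      unfolding r_def wt_def using rtr_spec_mult[OF Tspec R(2)] by (simp add: r_def wt_def)
    also have "\<dots> = (\<Sum>l<N. if r l > 0 \<and> L l > a then r l else 0)" by (intro sum.cong) auto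
    finally show ?thesis .
  qed
  have T\<tau>: "rtr (T a * \<tau>) \<le> 2 powr - a" for a
  proof -
    have "rtr (T a * \<tau>) = rtr (\<tau> * T a)" using povmD(3)[OF Tp] Tau by (intro rtr_mult_comm[of _ N N]) auto
    also have "\<dots> = (\<Sum>l<N. (if r l > 0 \<and> L l > a then 1 else 0) * wt W \<tau> l)"
      unfolding wt_def by (rule rtr_spec_mult[OF Tspec Tau(2)])
    also have "\<dots> \<le> (\<Sum>l<N. 2 powr - a * r l)"
    proof (rule sum_mono)
      fix l assume l: "l \<in> {..<N}"
      show "(if r l > 0 \<and> L l > a then 1 else 0) * wt W \<tau> l \<le> 2 powr - a * r l"
      proof (cases "r l > 0 \<and> L l > a")
        case True
        then have "- real (k l) \<le> - a + log 2 (r l)" by (simp add: L_def)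
        then have "2 powr - real (k l) \<le> 2 powr (- a + log 2 (r l))" by simp
        also have "\<dots> = 2 powr - a * r l" unfolding powr_add using True by simp
        finally show ?thesis using True k(2)[of l] l by simp
      next
        case False
        then show ?thesis using r0[of l] l by auto
      qed
    qed
    also have "\<dots> = 2 powr - a" using rsum by (simp flip: sum_distrib_left)
    finally show ?thesis .
  qed
  have rL: "(\<Sum>l<N. r l * L l) \<le> a\<^sub>1 + (a\<^sub>2 - a\<^sub>1) * rtr (T a\<^sub>1 * \<rho>) + (real v + \<bar>a\<^sub>2\<bar>) * rtr (T a\<^sub>2 * \<rho>)"
  proof -
    have "(\<Sum>l<N. r l * L l) \<le> (\<Sum>l<N. a\<^sub>1 * r l + (a\<^sub>2 - a\<^sub>1) * (if r l > 0 \<and> L l > a\<^sub>1 then r l else 0)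
        + (real v + \<bar>a\<^sub>2\<bar>) * (if r l > 0 \<and> L l > a\<^sub>2 then r l else 0))"
    proof (rule sum_mono)
      fix l assume l: "l \<in> {..<N}"
      show "r l * L l \<le> a\<^sub>1 * r l + (a\<^sub>2 - a\<^sub>1) * (if r l > 0 \<and> L l > a\<^sub>1 then r l else 0)
        + (real v + \<bar>a\<^sub>2\<bar>) * (if r l > 0 \<and> L l > a\<^sub>2 then r l else 0)"
      proof (cases "r l > 0")
        case True
        have "log 2 (r l) \<le> 0" using r1[of l] l True by simp
        then have Lv: "L l \<le> real v" using k(1)[of l] l unfolding L_def by simp
        \<comment> \<open>Three levels: at most \<open>a\<^sub>1\<close>, at most
          \<open>a\<^sub>2\<close>, and otherwise at most \<open>v\<close>. The absolute value keeps
          the bound valid when \<open>a\<^sub>2\<close> is negative.\<close>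
        have "L l \<le> a\<^sub>1 + (a\<^sub>2 - a\<^sub>1) * (if L l > a\<^sub>1 then 1 else 0) + (real v + \<bar>a\<^sub>2\<bar>) * (if L l > a\<^sub>2 then 1 else 0)"
          using Lv a by (auto split: if_splits)
        then have "r l * L l \<le> r l * (a\<^sub>1 + (a\<^sub>2 - a\<^sub>1) * (if L l > a\<^sub>1 then 1 else 0) + (real v + \<bar>a\<^sub>2\<bar>) * (if L l > a\<^sub>2 then 1 else 0))"
          using True by (intro mult_left_mono) auto
        also have "\<dots> = a\<^sub>1 * r l + (a\<^sub>2 - a\<^sub>1) * (if r l > 0 \<and> L l > a\<^sub>1 then r l else 0)
          + (real v + \<bar>a\<^sub>2\<bar>) * (if r l > 0 \<and> L l > a\<^sub>2 then r l else 0)"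
          using True by (simp add: algebra_simps)
        finally show ?thesis .
      next
        case False
        then have "r l = 0" using r0[of l] l by auto
        then show ?thesis by simp
      qed
    qed
    also have "\<dots> = a\<^sub>1 * (\<Sum>l<N. r l) + (a\<^sub>2 - a\<^sub>1) * rtr (T a\<^sub>1 * \<rho>) + (real v + \<bar>a\<^sub>2\<bar>) * rtr (T a\<^sub>2 * \<rho>)"
      unfolding T\<rho> by (simp only: sum.distrib sum_distrib_left)
    finally show ?thesis using rsum by simp
  qed
  have wtV: "wt V \<rho> j \<ge> 0" if "j < N" for j by (rule wt_psd(1)[OF R(1) specD(2)[OF V] that])
  have wtVsum: "(\<Sum>j<N. wt V \<rho> j) = 1"
    using unitary_diag_sum[OF specD(1)[OF V] R(2)] R(4) by (simp add: wt_def)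
  define b where "b = (\<Sum>j<N. wt V \<rho> j * log 2 (t j))"
  have "entropy_data N \<rho> \<tau> (\<Sum>i<N. p i * log 2 (p i)) b
     (\<Sum>i<N. p i * (log 2 (p i) - (\<Sum>i<N. p i * log 2 (p i)))\<^sup>2) (\<Sum>j<N. wt V \<rho> j * (log 2 (t j) - b)\<^sup>2)"
    unfolding entropy_data_def
    using U V t0 wtV wtVsum density_spec[OF \<rho> U] b_def
    by (intro exI[of _ U] exI[of _ p] exI[of _ V] exI[of _ t]) (auto simp: moments_def less_imp_le dest: t0)
  from rel_entropy_entropy_data[OF this]
  have "rel_entropy N \<rho> \<tau> = ereal ((\<Sum>i<N. p i * log 2 (p i)) - b)" .
  moreover have "- b \<le> (\<Sum>l<N. r l * real (k l)) + 1"
  proof -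
    have "- b = (\<Sum>j<N. wt V \<rho> j * (- log 2 (t j)))" by (simp add: b_def sum_negf)
    also have "\<dots> \<le> (\<Sum>j<N. wt V \<rho> j * (real (\<kappa> j) + 1))"
      using \<kappa>_le(2) wtV by (intro sum_mono mult_left_mono) auto
    also have "\<dots> = (\<Sum>j<N. wt V \<rho> j * real (\<kappa> j)) + (\<Sum>j<N. wt V \<rho> j)"
      by (simp add: distrib_left sum.distrib)
    finally show ?thesis using k\<kappa> wtVsum by (simp add: r_def)
  qed
  moreover have "(\<Sum>l<N. r l * L l) = (\<Sum>l<N. r l * log 2 (r l)) + (\<Sum>l<N. r l * real (k l))"
    by (simp add: L_def distrib_left sum.distrib)
  ultimately have "rel_entropy N \<rho> \<tau> \<le> ereal (log 2 (real v) + 1 + a\<^sub>1 + (a\<^sub>2 - a\<^sub>1) * rtr (T a\<^sub>1 * \<rho>) + (real v + \<bar>a\<^sub>2\<bar>) * rtr (T a\<^sub>2 * \<rho>))"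
    using ent rL by (simp add: r_def)
  then show ?thesis using Tp T\<tau> by blast
qed

subsection \<open>Regularised relative entropy\<close>

text \<open>Besides the limit, its role as a lower bound for every quotient is recorded; the direct
  part contradicts exactly this.\<close>

lemma fekete:
  fixes e :: "nat \<Rightarrow> real"
  assumes sub: "\<And>n m. n \<ge> 1 \<Longrightarrow> m \<ge> 1 \<Longrightarrow> e (n + m) \<le> e n + e m"
    and low: "\<And>n. n \<ge> 1 \<Longrightarrow> e n \<ge> real n * c"
  shows "\<exists>L. (\<lambda>n. e n / real n) \<longlonglongrightarrow> L \<and> (\<forall>n\<ge>1. L \<le> e n / real n)"
proof -
  define L where "L = (INF n\<in>{1..}. e n / real n)"
  have bdd: "bdd_below ((\<lambda>n. e n / real n) ` {1..})"
    using low by (intro bdd_belowI[of _ c]) (auto simp: field_simps)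
  have lower: "L \<le> e n / real n" if "n \<ge> 1" for n
    unfolding L_def using that by (intro cINF_lower[OF bdd]) auto
  have "(\<lambda>n. e n / real n) \<longlonglongrightarrow> L"
  proof (rule LIMSEQ_I)
    fix r :: real assume r: "r > 0"
    have "(INF n\<in>{1..}. e n / real n) < L + r / 2" unfolding L_def[symmetric] using r by simp
    then obtain m where m: "m \<ge> 1" "e m / real m < L + r / 2"
      by (subst (asm) cINF_less_iff[OF _ bdd]) auto
    define u where "u = e m / real m"
    \<comment> \<open>This absorbs the remainder after removing blocks of length \<open>m\<close>.
      The remainder lies between 1 and \<open>m\<close>, so no value of \<open>e\<close> at 0 is
      involved.\<close>
    define C where "C = (\<Sum>i\<in>{1..m}. \<bar>e i - real i * u\<bar>)"
    have mu: "e m = real m * u" using m by (simp add: u_def)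
    have C: "e n \<le> real n * u + C" if "n \<ge> 1" for n
      using that
    proof (induction n rule: less_induct)
      case (less n)
      show ?case
      proof (cases "n \<le> m")
        case True
        then have "\<bar>e n - real n * u\<bar> \<le> C" unfolding C_def using less.prems by (intro member_le_sum) auto
        then show ?thesis by simp
      next
        case False
        have "e n = e (m + (n - m))" using False by simp
        also have "\<dots> \<le> e m + e (n - m)" using False m by (intro sub) auto
        also have "\<dots> \<le> e m + (real (n - m) * u + C)" using less.IH[of "n - m"] False m by simp
        also have "\<dots> = real n * u + C" using False by (simp add: mu of_nat_diff algebra_simps)
        finally show ?thesis .
      qed
    qed
    obtain n0 where n0: "real n0 > C / (r / 2)" using reals_Archimedean2 by blast
    have "norm (e n / real n - L) < r" if n: "n \<ge> max 1 n0" for n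
    proof -
      have "C < r / 2 * real n0" using n0 r by (simp add: field_simps)
      also have "\<dots> \<le> r / 2 * real n" using n r by (intro mult_left_mono) auto
      finally have "C / real n < r / 2" using n by (simp add: field_simps)
      moreover have "e n / real n \<le> u + C / real n" using C[of n] n by (simp add: field_simps)
      ultimately have "e n / real n < L + r" using m(2) unfolding u_def by linarith
      then show ?thesis using lower[of n] n r by auto
    qed
    then show "\<exists>no. \<forall>n\<ge>no. norm (e n / real n - L) < r" by blast
  qed
  then show ?thesis using lower by blast
qed

text \<open>A zero eigenvalue would give a nonzero kernel vector, contradicting the nonvanishing
  determinant of a full-rank matrix.\<close>

lemma full_rank_spec_pos:
  assumes "\<sigma> \<in> density d" "full_rank d \<sigma>" "spec d V q \<sigma>" "j < d"
  shows "q j > 0"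
proof -
  note c = specD(2,3)[OF assms(3)]
  have "q j \<noteq> 0"
  proof
    assume q: "q j = 0"
    have "det \<sigma> \<noteq> 0"
      using vec_space.det_rank_iff[OF c(2)] assms(2) by (simp add: full_rank_def)
    moreover have "\<sigma> *\<^sub>v col V j = 0\<^sub>v d"
    proof -
      have "\<sigma> * V = V * (adj V * \<sigma> * V)"
        using c unitaryD(2)[OF specD(1)[OF assms(3)]]
        by (simp add: assoc_mult_mat[of _ d d _ d _ d] mult_carrier_mat[of _ d d _ d] flip: assoc_mult_mat[of V d d "adj V" d _ d])
      then have "\<sigma> * V = V * dg d q" unfolding specD(5)[OF assms(3)] .
      moreover have "\<sigma> *\<^sub>v col V j = col (\<sigma> * V) j" using c assms(4) by (intro col_mult2[of _ d d _ d, symmetric]) auto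
      ultimately show ?thesis
        using c assms(4) q by (intro eq_vecI) (auto simp: dg_mult_right_index[of _ d d] simp del: index_mult_mat(1))
    qed
    moreover have "col V j \<noteq> 0\<^sub>v d"
    proof
      assume z: "col V j = 0\<^sub>v d"
      have "V $$ (i,j) = 0" if "i < d" for i
        using arg_cong[OF z, of "\<lambda>v. v $ i"] that c assms(4) by simp
      then have "(\<Sum>i<d. (cmod (V $$ (i,j)))\<^sup>2) = 0" by simp
      then show False using gram_diag[OF c(1) assms(4)] unitaryD(3)[OF specD(1)[OF assms(3)]] assms(4) by simp
    qed
    moreover have "col V j \<in> carrier_vec d" using c by auto
    ultimately show False using det_0_iff_vec_prod_zero[OF c(2)] by blast
  qed
  then show ?thesis using density_spec(1)[OF assms(1,3,4)] by simp
qed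

text \<open>Stated through the spectrum rather than as an operator inequality, because eigenvalues
  simply multiply under Kronecker products.\<close>

definition eigen_lb :: "nat \<Rightarrow> complex mat \<Rightarrow> real \<Rightarrow> bool" where
  "eigen_lb N A x \<longleftrightarrow> (\<exists>V q. spec N V q A \<and> (\<forall>j<N. x \<le> q j))"

lemma eigen_lb_kron:
  assumes "eigen_lb n A x" "eigen_lb m B y" "0 \<le> x" "0 \<le> y"
  shows "eigen_lb (n * m) (kron A B) (x * y)"
proof -
  obtain V q where V: "spec n V q A" "\<forall>j<n. x \<le> q j" using assms(1) by (auto simp: eigen_lb_def)
  obtain W r where W: "spec m W r B" "\<forall>j<m. y \<le> r j" using assms(2) by (auto simp: eigen_lb_def)
  have "\<forall>j<n*m. x * y \<le> q (j div m) * r (j mod m)"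
  proof (intro allI impI mult_mono)
    fix j assume j: "j < n * m"
    show "x \<le> q (j div m)" "y \<le> r (j mod m)" using V(2) W(2) div_mod_less[OF j] by auto
    then show "0 \<le> q (j div m)" "0 \<le> y" using assms by auto
  qed
  then show ?thesis using spec_kron[OF V(1) W(1)] unfolding eigen_lb_def by blast
qed

lemma spec_one_one: "spec 1 (1\<^sub>m 1) (\<lambda>_. 1) (1\<^sub>m 1)"
  by (rule spec_one) (simp add: unitary_def)

lemma eigen_lb_tpow: "eigen_lb d A x \<Longrightarrow> 0 \<le> x \<Longrightarrow> eigen_lb (d ^ n) (tpow n A) (x ^ n)"
proof (induction n)
  case 0
  then show ?case using spec_one_one unfolding eigen_lb_def by auto
next
  case (Suc n)
  then show ?case using eigen_lb_kron[of d A x "d ^ n" "tpow n A" "x ^ n"] by simp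
qed

lemma eigen_lb_psd:
  assumes "eigen_lb N A x" shows "psd N (A - complex_of_real x \<cdot>\<^sub>m 1\<^sub>m N)"
proof -
  obtain V q where V: "spec N V q A" "\<forall>j<N. x \<le> q j" using assms by (auto simp: eigen_lb_def)
  show ?thesis
    using V(2) by (intro spec_psd[OF spec_minus[OF V(1) spec_smult[OF spec_one[OF specD(1)[OF V(1)]]]]]) auto
qed

lemma entropy_data_one: "entropy_data 1 (1\<^sub>m 1) (1\<^sub>m 1) 0 0 0 0"
proof -
  have "wt (1\<^sub>m 1) (1\<^sub>m 1) 0 = 1" by (simp add: wt_def)
  then show ?thesis unfolding entropy_data_def using spec_one_one
    by (intro exI[of _ "1\<^sub>m 1"] exI[of _ "\<lambda>_. 1"]) (auto simp: moments_def)
qed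

lemma entropy_data_tpow:
  assumes "entropy_data d \<rho> \<sigma> a b s t"
  shows "entropy_data (d ^ n) (tpow n \<rho>) (tpow n \<sigma>) (real n * a) (real n * b) (real n * s) (real n * t)"
proof (induction n)
  case 0
  then show ?case using entropy_data_one by simp
next
  case (Suc n)
  show ?case using entropy_data_kron[OF assms Suc] by (simp add: algebra_simps)
qed

lemma entropy_data_second_nonpos:
  assumes "entropy_data N \<rho> \<sigma> a b s t" "\<sigma> \<in> density N"
  shows "b \<le> 0"
proof -
  obtain V q where V: "spec N V q \<sigma>" and m: "moments N (wt V \<rho>) (\<lambda>j. log 2 (q j)) b t"
    using assms(1) unfolding entropy_data_def by blast
  have "wt V \<rho> j * log 2 (q j) \<le> 0" if "j < N" for j
  proof (rule mult_nonneg_nonpos)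
    show "0 \<le> wt V \<rho> j" using m that by (simp add: moments_def)
    show "log 2 (q j) \<le> 0"
      using density_spec(1,3)[OF assms(2) V that] by (cases "q j = 0") (auto simp: log_def divide_le_0_iff)
  qed
  then have "(\<Sum>j<N. wt V \<rho> j * log 2 (q j)) \<le> 0" by (intro sum_nonpos) auto
  then show ?thesis using m by (simp add: moments_def)
qed

section \<open>The setting with a fixed full-rank reference state, and the rate
  \<open>L\<close>\<close>

locale stein_setting =
  fixes d :: nat and M :: "nat \<Rightarrow> complex mat set" and \<rho> \<sigma> :: "complex mat"
  assumes M_density: "n \<ge> 1 \<Longrightarrow> M n \<subseteq> density (d ^ n)"
    and M_convex: "n \<ge> 1 \<Longrightarrow> convex_mat_set (M n)"
    and M_kron: "n \<ge> 1 \<Longrightarrow> m \<ge> 1 \<Longrightarrow> \<omega> \<in> M n \<Longrightarrow> \<nu> \<in> M m \<Longrightarrow> kron \<omega> \<nu> \<in> M (n + m)"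
    and \<sigma>: "\<sigma> \<in> density d" "full_rank d \<sigma>" and \<sigma>_M: "n \<ge> 1 \<Longrightarrow> tpow n \<sigma> \<in> M n"
    and \<rho>: "\<rho> \<in> density d"
begin

lemma \<rho>_density: "tpow n \<rho> \<in> density (d ^ n)"
  by (rule tpow_density[OF \<rho>])

lemma d_pos: "d > 0" by (rule densityD(5)[OF \<rho>])

lemma \<sigma>_eigen_lb: "\<exists>x>0. x \<le> 1 \<and> eigen_lb d \<sigma> x"
proof -
  obtain V q where V: "spec d V q \<sigma>" using psd_spec[OF densityD(1)[OF \<sigma>(1)]] by metis
  define x where "x = Min (q ` {..<d})"
  have ne: "q ` {..<d} \<noteq> {}" using d_pos by auto
  have "x > 0" unfolding x_def using ne full_rank_spec_pos[OF \<sigma> V] by (subst Min_gr_iff) auto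
  moreover have le: "x \<le> q j" if "j < d" for j unfolding x_def using that by (intro Min_le) auto
  moreover have "x \<le> 1" using le[OF d_pos] density_spec(3)[OF \<sigma>(1) V d_pos] by simp
  ultimately show ?thesis using V unfolding eigen_lb_def by blast
qed

lemma entropy_data_\<sigma>: "\<exists>a b s t. entropy_data d \<rho> \<sigma> a b s t"
proof -
  obtain U p where U: "spec d U p \<rho>" using psd_spec[OF densityD(1)[OF \<rho>]] by metis
  obtain V q where V: "spec d V q \<sigma>" using psd_spec[OF densityD(1)[OF \<sigma>(1)]] by metis
  show ?thesis
    using entropy_dataI[OF \<rho> U \<sigma>(1) V] full_rank_spec_pos[OF \<sigma> V] by (metis less_irrefl)
qed

text \<open>For \<open>n \<ge> 1\<close> the infimum is finite (\<open>E_ereal\<close>), so the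
  conversion to a real number loses nothing.\<close>

definition E :: "nat \<Rightarrow> real" where "E n = real_of_ereal (E_M d M n (tpow n \<rho>))"

text \<open>From above, the product of \<open>\<sigma>\<close> is a competitor. From below, the
  cross term is nonpositive, so the relative entropy is at least the negative entropy of the tensor
  power, which is linear in \<open>n\<close>.\<close>

lemma E_bounds:
  obtains a b where "\<And>n. n \<ge> 1 \<Longrightarrow> E_M d M n (tpow n \<rho>) \<le> ereal (real n * (a - b))"
    "\<And>n. n \<ge> 1 \<Longrightarrow> E_M d M n (tpow n \<rho>) \<ge> ereal (real n * a)"
proof -
  obtain a b s t where ed: "entropy_data d \<rho> \<sigma> a b s t" using entropy_data_\<sigma> by blast
  have "E_M d M n (tpow n \<rho>) \<le> ereal (real n * (a - b))" if n: "n \<ge> 1" for n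
  proof -
    have "E_M d M n (tpow n \<rho>) \<le> rel_entropy (d ^ n) (tpow n \<rho>) (tpow n \<sigma>)"
      unfolding E_M_def by (rule INF_lower[OF \<sigma>_M[OF n]])
    then show ?thesis
      using rel_entropy_entropy_data[OF entropy_data_tpow[OF ed, of n]] by (simp add: algebra_simps)
  qed
  moreover have "E_M d M n (tpow n \<rho>) \<ge> ereal (real n * a)" if n: "n \<ge> 1" for n
    unfolding E_M_def
  proof (rule INF_greatest)
    fix \<omega> assume \<omega>: "\<omega> \<in> M n"
    then have \<omega>d: "\<omega> \<in> density (d ^ n)" using M_density[OF n] by auto
    show "ereal (real n * a) \<le> rel_entropy (d ^ n) (tpow n \<rho>) \<omega>"
    proof (cases "supp (d ^ n) (tpow n \<rho>) \<subseteq> supp (d ^ n) \<omega>")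
      case True
      then obtain a' b' s' t' where ed': "entropy_data (d ^ n) (tpow n \<rho>) \<omega> a' b' s' t'"
        using entropy_data_exists[OF \<rho>_density \<omega>d] by blast
      have "a' = real n * a" using entropy_data_self[OF ed'] entropy_data_self[OF entropy_data_tpow[OF ed, of n]] by simp
      then show ?thesis
        using rel_entropy_entropy_data[OF ed'] entropy_data_second_nonpos[OF ed' \<omega>d] by simp
    qed (simp add: rel_entropy_def)
  qed
  ultimately show ?thesis using that by blast
qed

lemma E_ereal: "n \<ge> 1 \<Longrightarrow> E_M d M n (tpow n \<rho>) = ereal (E n)"
proof -
  assume n: "n \<ge> 1"
  obtain a b where "E_M d M n (tpow n \<rho>) \<le> ereal (real n * (a - b))" "E_M d M n (tpow n \<rho>) \<ge> ereal (real n * a)"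
    using E_bounds n by metis
  then show ?thesis unfolding E_def by (cases "E_M d M n (tpow n \<rho>)") auto
qed

lemma E_le: "n \<ge> 1 \<Longrightarrow> \<omega> \<in> M n \<Longrightarrow> ereal (E n) \<le> rel_entropy (d ^ n) (tpow n \<rho>) \<omega>"
  using E_ereal[of n] INF_lower[of \<omega> "M n" "rel_entropy (d ^ n) (tpow n \<rho>)"] by (simp add: E_M_def)

lemma E_near:
  assumes "n \<ge> 1" "E n < y"
  obtains \<omega> a b s t where "\<omega> \<in> M n" "entropy_data (d ^ n) (tpow n \<rho>) \<omega> a b s t" "a - b < y"
proof -
  have "(INF \<omega>\<in>M n. rel_entropy (d ^ n) (tpow n \<rho>) \<omega>) < ereal y"
    using E_ereal[OF assms(1)] assms(2) by (simp add: E_M_def)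
  then obtain \<omega> where \<omega>: "\<omega> \<in> M n" "rel_entropy (d ^ n) (tpow n \<rho>) \<omega> < ereal y"
    by (auto simp: INF_less_iff)
  then have "supp (d ^ n) (tpow n \<rho>) \<subseteq> supp (d ^ n) \<omega>" by (auto simp: rel_entropy_def split: if_splits)
  then obtain a b s t where ed: "entropy_data (d ^ n) (tpow n \<rho>) \<omega> a b s t"
    using entropy_data_exists[OF \<rho>_density, of \<omega> n] \<omega>(1) M_density[OF assms(1)] by blast
  then show ?thesis using that[OF \<omega>(1) ed] \<omega>(2) rel_entropy_entropy_data[OF ed] by simp
qed

lemma E_subadditive:
  assumes n: "n \<ge> 1" and m: "m \<ge> 1"
  shows "E (n + m) \<le> E n + E m"
proof (rule field_le_epsilon)
  fix \<eta> :: real assume "\<eta> > 0"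
  then have half: "E n < E n + \<eta> / 2" "E m < E m + \<eta> / 2" by auto
  obtain \<omega> a b s t where 1: "\<omega> \<in> M n" "entropy_data (d ^ n) (tpow n \<rho>) \<omega> a b s t" "a - b < E n + \<eta> / 2"
    using E_near[OF n, of "E n + \<eta> / 2"] half by blast
  obtain \<nu> a' b' s' t' where 2: "\<nu> \<in> M m" "entropy_data (d ^ m) (tpow m \<rho>) \<nu> a' b' s' t'" "a' - b' < E m + \<eta> / 2"
    using E_near[OF m, of "E m + \<eta> / 2"] half by blast
  have "ereal (E (n + m)) \<le> rel_entropy (d ^ (n + m)) (tpow (n + m) \<rho>) (kron \<omega> \<nu>)"
    using n m 1 2 by (intro E_le M_kron) auto
  also have "\<dots> = ereal ((a + a') - (b + b'))"
    using rel_entropy_entropy_data[OF entropy_data_kron[OF 1(2) 2(2)]] by (simp add: tpow_add power_add)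
  finally show "E (n + m) \<le> E n + E m + \<eta>" using 1(3) 2(3) by simp
qed

definition L :: real where "L = lim (\<lambda>n. E n / real n)"

lemma E_limit: "(\<lambda>n. E n / real n) \<longlonglongrightarrow> L" and L_le: "n \<ge> 1 \<Longrightarrow> L \<le> E n / real n"
proof -
  obtain a b where low: "\<And>n. n \<ge> 1 \<Longrightarrow> E_M d M n (tpow n \<rho>) \<ge> ereal (real n * a)"
    using E_bounds by metis
  have "E n \<ge> real n * a" if "n \<ge> 1" for n using low[OF that] E_ereal[OF that] by simp
  from fekete[of E, OF E_subadditive this] obtain l where
    l: "(\<lambda>n. E n / real n) \<longlonglongrightarrow> l" "\<forall>n\<ge>1. l \<le> E n / real n" by blast
  then have "L = l" unfolding L_def by (intro limI)
  then show "(\<lambda>n. E n / real n) \<longlonglongrightarrow> L" "n \<ge> 1 \<Longrightarrow> L \<le> E n / real n" using l by auto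
qed

lemma E_inf_eq: "E_inf d M \<rho> = ereal L"
proof -
  have "(\<lambda>n. ereal (E n / real n)) \<longlonglongrightarrow> ereal L" using E_limit by simp
  \<comment> \<open>At \<open>n = 0\<close> nothing is assumed about \<open>M\<close>, so the two
    sequences are compared from 1 on.\<close>
  moreover have "eventually (\<lambda>n. ereal (E n / real n) = E_M d M n (tpow n \<rho>) / ereal (real n)) sequentially"
    using eventually_ge_at_top[of 1] by eventually_elim (simp add: E_ereal)
  ultimately have "(\<lambda>n. E_M d M n (tpow n \<rho>) / ereal (real n)) \<longlonglongrightarrow> ereal L"
    by (rule Lim_transform_eventually)
  then show ?thesis unfolding E_inf_def by (rule limI)
qed

subsection \<open>The strong converse\<close>

text \<open>A near-optimal block of length \<open>m\<close> is repeated and the remaining 1 to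
  \<open>m\<close> factors are filled with \<open>\<sigma>\<close>. The block length is fixed, so
  the excess stays bounded while the variances grow linearly, as Chebyshev requires.\<close>

lemma product_states:
  assumes \<eta>: "\<eta> > 0"
  shows "\<exists>C\<ge>0. \<forall>n\<ge>1. \<exists>\<omega>\<in>M n. \<exists>a b s t. entropy_data (d ^ n) (tpow n \<rho>) \<omega> a b s t \<and>
     a - b \<le> real n * (L + \<eta>) + C \<and> s \<le> C * real n \<and> t \<le> C * real n"
proof -
  obtain m where m: "m \<ge> 1" "E m / real m < L + \<eta>"
  proof -
    have "eventually (\<lambda>n. E n / real n < L + \<eta>) sequentially"
      using order_tendstoD(2)[OF E_limit, of "L + \<eta>"] \<eta> by simp
    then have "eventually (\<lambda>n. n \<ge> 1 \<and> E n / real n < L + \<eta>) sequentially"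
      using eventually_ge_at_top[of 1] by eventually_elim simp
    then show ?thesis using that by (auto simp: eventually_at_top_linorder)
  qed
  then have "E m < real m * (L + \<eta>)" by (simp add: field_simps)
  then obtain \<omega>m am bm sm tm where wm: "\<omega>m \<in> M m" "entropy_data (d ^ m) (tpow m \<rho>) \<omega>m am bm sm tm"
      "am - bm < real m * (L + \<eta>)"
    using E_near[OF m(1)] by blast
  obtain a1 b1 s1 t1 where ed1: "entropy_data d \<rho> \<sigma> a1 b1 s1 t1" using entropy_data_\<sigma> by blast
  \<comment> \<open>It bounds the variances of both kinds of building blocks and the excess of at
    most \<open>m\<close> factors \<open>\<sigma>\<close> over the target rate.\<close>
  define C where "C = \<bar>s1\<bar> + \<bar>t1\<bar> + \<bar>sm\<bar> + \<bar>tm\<bar> + real m * (\<bar>a1 - b1\<bar> + \<bar>L + \<eta>\<bar>)"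
  have Cm: "0 \<le> real m * (\<bar>a1 - b1\<bar> + \<bar>L + \<eta>\<bar>)" by simp
  have C: "C \<ge> 0" "s1 \<le> C" "t1 \<le> C" "sm \<le> C" "tm \<le> C" unfolding C_def using Cm by linarith+
  have "\<exists>\<omega>\<in>M n. \<exists>a b s t. entropy_data (d ^ n) (tpow n \<rho>) \<omega> a b s t \<and>
     a - b \<le> real n * (L + \<eta>) + C \<and> s \<le> C * real n \<and> t \<le> C * real n" if "n \<ge> 1" for n
    using that
  proof (induction n rule: less_induct)
    case (less n)
    show ?case
    proof (cases "n \<le> m")
      case True
      have "real n * (a1 - b1) - real n * (L + \<eta>) \<le> real n * (\<bar>a1 - b1\<bar> + \<bar>L + \<eta>\<bar>)"
        unfolding right_diff_distrib[symmetric] by (intro mult_left_mono) auto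
      also have "\<dots> \<le> real m * (\<bar>a1 - b1\<bar> + \<bar>L + \<eta>\<bar>)" using True by (intro mult_right_mono) auto
      also have "\<dots> \<le> C" unfolding C_def by simp
      finally have "real n * a1 - real n * b1 \<le> real n * (L + \<eta>) + C" by (simp add: algebra_simps)
      moreover have "real n * s1 \<le> C * real n" "real n * t1 \<le> C * real n"
        using mult_left_mono[OF C(2), of "real n"] mult_left_mono[OF C(3), of "real n"] by (simp_all add: mult.commute)
      ultimately show ?thesis
        using entropy_data_tpow[OF ed1, of n] \<sigma>_M[OF less.prems] by blast
    next
      case False
      then have nm: "n - m < n" "n - m \<ge> 1" "m + (n - m) = n" using m by auto
      obtain \<omega> a b s t where w: "\<omega> \<in> M (n - m)" "entropy_data (d ^ (n - m)) (tpow (n - m) \<rho>) \<omega> a b s t"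
        "a - b \<le> real (n - m) * (L + \<eta>) + C" "s \<le> C * real (n - m)" "t \<le> C * real (n - m)"
        using less.IH[OF nm(1,2)] by blast
      have "kron \<omega>m \<omega> \<in> M n" using M_kron[OF m(1) nm(2) wm(1) w(1)] nm(3) by simp
      moreover have "entropy_data (d ^ n) (tpow n \<rho>) (kron \<omega>m \<omega>) (am + a) (bm + b) (sm + s) (tm + t)"
        using entropy_data_kron[OF wm(2) w(2)] nm(3) by (metis power_add tpow_add)
      moreover have "(am + a) - (bm + b) \<le> real n * (L + \<eta>) + C"
        using wm(3) w(3) False by (simp add: of_nat_diff algebra_simps)
      moreover have "C \<le> C * real m" using C(1) m(1) by (simp add: mult_le_cancel_left1)
      then have "sm + s \<le> C * real n" "tm + t \<le> C * real n"
        using w(4,5) C(4,5) False by (simp_all add: of_nat_diff algebra_simps)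
      ultimately show ?thesis by blast
    qed
  qed
  then show ?thesis using C(1) by blast
qed

lemma strong_converse_bound:
  assumes \<eta>: "\<eta> > 0"
  shows "\<exists>C\<ge>0. \<forall>n\<ge>1. \<exists>\<omega>\<in>M n. \<forall>A. povm_elem (d ^ n) A \<longrightarrow>
     rtr (A * tpow n \<rho>) \<le> C / real n + C * 2 powr (real n * (L + \<eta>)) * rtr (A * \<omega>)"
proof -
  obtain C where C: "C \<ge> 0" and st: "\<And>n. n \<ge> 1 \<Longrightarrow> \<exists>\<omega>\<in>M n. \<exists>a b s t. entropy_data (d ^ n) (tpow n \<rho>) \<omega> a b s t \<and>
     a - b \<le> real n * (L + \<eta> / 2) + C \<and> s \<le> C * real n \<and> t \<le> C * real n"
    using product_states[of "\<eta> / 2"] \<eta> by auto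
  \<comment> \<open>With \<open>x = n \<eta> / 4\<close> the error \<open>3 C n / x\<^sup>2\<close>
    equals \<open>48 C / (\<eta>\<^sup>2 n)\<close>; the second summand absorbs the bounded excess
    \<open>C\<close> in the exponent.\<close>
  define C' where "C' = 48 * C / \<eta>\<^sup>2 + 2 * 2 powr C"
  have C': "48 * C / \<eta>\<^sup>2 \<le> C'" "2 * 2 powr C \<le> C'" "C' \<ge> 0" unfolding C'_def using C by auto
  have "\<exists>\<omega>\<in>M n. \<forall>A. povm_elem (d ^ n) A \<longrightarrow>
     rtr (A * tpow n \<rho>) \<le> C' / real n + C' * 2 powr (real n * (L + \<eta>)) * rtr (A * \<omega>)" if n: "n \<ge> 1" for n
  proof -
    obtain \<omega> a b s t where w: "\<omega> \<in> M n" and ed: "entropy_data (d ^ n) (tpow n \<rho>) \<omega> a b s t"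
      and ab: "a - b \<le> real n * (L + \<eta> / 2) + C" and s: "s \<le> C * real n" and t: "t \<le> C * real n"
      using st[OF n] by blast
    have "rtr (A * tpow n \<rho>) \<le> C' / real n + C' * 2 powr (real n * (L + \<eta>)) * rtr (A * \<omega>)"
      if A: "povm_elem (d ^ n) A" for A
    proof -
      \<comment> \<open>Half of \<open>\<eta>\<close> is spent on the product state, the other half
        on \<open>2 * x\<close>.\<close>
      define x where "x = real n * \<eta> / 4"
      have x: "x > 0" using n \<eta> by (simp add: x_def)
      have A\<omega>: "rtr (A * \<omega>) \<ge> 0"
        using povm_rtr_bounds(1)[OF A densityD(1)] M_density[OF n] w by blast
      have "s / x\<^sup>2 + 2 * (t / x\<^sup>2) \<le> C * real n / x\<^sup>2 + 2 * (C * real n / x\<^sup>2)"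
        using s t by (intro add_mono mult_left_mono divide_right_mono) auto
      also have "\<dots> = (48 * C / \<eta>\<^sup>2) / real n"
        using n \<eta> by (simp add: x_def power2_eq_square field_simps)
      also have "\<dots> \<le> C' / real n" using C'(1) by (intro divide_right_mono) auto
      finally have 1: "s / x\<^sup>2 + 2 * (t / x\<^sup>2) \<le> C' / real n" .
      have "2 powr (a - b + 2 * x) \<le> 2 powr (C + real n * (L + \<eta>))"
        using ab by (intro powr_mono) (auto simp: x_def algebra_simps)
      also have "\<dots> = 2 powr C * 2 powr (real n * (L + \<eta>))" by (rule powr_add)
      finally have "2 * 2 powr (a - b + 2 * x) \<le> (2 * 2 powr C) * 2 powr (real n * (L + \<eta>))" by simp
      also have "\<dots> \<le> C' * 2 powr (real n * (L + \<eta>))" using C'(2) by (intro mult_right_mono) auto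
      finally have "2 * 2 powr (a - b + 2 * x) * rtr (A * \<omega>) \<le> C' * 2 powr (real n * (L + \<eta>)) * rtr (A * \<omega>)"
        using A\<omega> by (rule mult_right_mono)
      then show ?thesis using entropy_data_converse[OF ed A x] 1 by linarith
    qed
    then show ?thesis using w by blast
  qed
  then show ?thesis using C'(3) by blast
qed

lemma mtrace_povm_complement:
  assumes "povm_elem (d ^ n) A"
  shows "mtrace ((1\<^sub>m (d ^ n) - A) * tpow n \<rho>) = complex_of_real (1 - rtr (A * tpow n \<rho>))"
proof -
  note R = densityD[OF \<rho>_density[of n]] and cA = povmD[OF assms]
  have "mtrace ((1\<^sub>m (d ^ n) - A) * tpow n \<rho>) = complex_of_real (rtr ((1\<^sub>m (d ^ n) - A) * tpow n \<rho>))"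
    using R cA by (intro mtrace_hermitian_mult_real[of _ "d ^ n"]) (auto simp: adj_minus[of _ "d ^ n" "d ^ n"])
  also have "rtr ((1\<^sub>m (d ^ n) - A) * tpow n \<rho>) = 1 - rtr (A * tpow n \<rho>)"
    using R cA by (simp add: rtr_mult_left[of _ "d ^ n"])
  finally show ?thesis .
qed

lemma mtrace_povm:
  assumes "n \<ge> 1" "povm_elem (d ^ n) A" "\<omega> \<in> M n"
  shows "mtrace (A * \<omega>) = complex_of_real (rtr (A * \<omega>))" "rtr (A * \<omega>) \<ge> 0"
proof -
  have "\<omega> \<in> density (d ^ n)" using M_density assms by auto
  note W = densityD[OF this]
  show "mtrace (A * \<omega>) = complex_of_real (rtr (A * \<omega>))"
    using W povmD[OF assms(2)] by (intro mtrace_hermitian_mult_real[of _ "d ^ n"]) auto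
  show "rtr (A * \<omega>) \<ge> 0" by (rule povm_rtr_bounds(1)[OF assms(2) W(1)])
qed

text \<open>In the disjunct \<open>mtrace (A * \<omega>) = 0\<close> the exponent is \<open>\<infinity>\<close>, whereas \<open>log 2 0 = 0\<close>.\<close>

lemma exponent_iff:
  assumes "n \<ge> 1" "povm_elem (d ^ n) A" "\<omega> \<in> M n"
  shows "(mtrace (A * \<omega>) = 0 \<or> ereal (- log 2 (Re (mtrace (A * \<omega>))) / real n + x) \<ge> ereal L)
     \<longleftrightarrow> rtr (A * \<omega>) \<le> 2 powr (- (real n * (L - x)))"
proof (cases "rtr (A * \<omega>) = 0")
  case True
  then show ?thesis using mtrace_povm[OF assms] by simp
next
  case False
  then have pos: "rtr (A * \<omega>) > 0" using mtrace_povm(2)[OF assms] by simp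
  have "ereal (- log 2 (Re (mtrace (A * \<omega>))) / real n + x) \<ge> ereal L \<longleftrightarrow> log 2 (rtr (A * \<omega>)) \<le> - (real n * (L - x))"
    using assms(1) by (simp add: rtr_def field_simps)
  also have "\<dots> \<longleftrightarrow> rtr (A * \<omega>) \<le> 2 powr (- (real n * (L - x)))"
    using pos by (simp add: log_le_iff)
  finally show ?thesis using mtrace_povm(1)[OF assms] False by simp
qed

text \<open>Applying the uniform bound with \<open>\<epsilon> / 2\<close> leaves a factor
  \<open>2 powr (- (\<epsilon> / 2) * n)\<close> against the hypothesis.\<close>

lemma strong_converse:
  assumes \<epsilon>: "\<epsilon> > 0" and A: "\<And>n. n \<ge> 1 \<Longrightarrow> povm_elem (d ^ n) (A n)"
    and bound: "\<And>n \<omega>. n \<ge> 1 \<Longrightarrow> \<omega> \<in> M n \<Longrightarrow> rtr (A n * \<omega>) \<le> 2 powr (- (real n * (L + \<epsilon>)))"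
  shows "(\<lambda>n. mtrace ((1\<^sub>m (d ^ n) - A n) * tpow n \<rho>)) \<longlonglongrightarrow> 1"
proof -
  obtain C where C: "C \<ge> 0" and sc: "\<And>n. n \<ge> 1 \<Longrightarrow> \<exists>\<omega>\<in>M n. \<forall>A. povm_elem (d ^ n) A \<longrightarrow>
     rtr (A * tpow n \<rho>) \<le> C / real n + C * 2 powr (real n * (L + \<epsilon> / 2)) * rtr (A * \<omega>)"
    using strong_converse_bound[of "\<epsilon> / 2"] \<epsilon> by auto
  have up: "rtr (A n * tpow n \<rho>) \<le> C / real n + C * 2 powr (- (\<epsilon> / 2) * real n)" if n: "n \<ge> 1" for n
  proof -
    obtain \<omega> where \<omega>: "\<omega> \<in> M n"
      "rtr (A n * tpow n \<rho>) \<le> C / real n + C * 2 powr (real n * (L + \<epsilon> / 2)) * rtr (A n * \<omega>)"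
      using sc[OF n] A[OF n] by blast
    have "C * 2 powr (real n * (L + \<epsilon> / 2)) * rtr (A n * \<omega>)
       \<le> C * 2 powr (real n * (L + \<epsilon> / 2)) * 2 powr (- (real n * (L + \<epsilon>)))"
      using bound[OF n \<omega>(1)] C by (intro mult_left_mono) auto
    also have "\<dots> = C * 2 powr (- (\<epsilon> / 2) * real n)"
      by (simp add: powr_add[symmetric] algebra_simps)
    finally show ?thesis using \<omega>(2) by linarith
  qed
  have "(\<lambda>n. C / real n + C * 2 powr (- (\<epsilon> / 2) * real n)) \<longlonglongrightarrow> 0"
    using \<epsilon> by real_asymp
  then have "(\<lambda>n. rtr (A n * tpow n \<rho>)) \<longlonglongrightarrow> 0"
  proof (rule tendsto_sandwich[OF _ _ tendsto_const, rotated 2])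
    show "eventually (\<lambda>n. 0 \<le> rtr (A n * tpow n \<rho>)) sequentially"
      using eventually_ge_at_top[of 1]
      by eventually_elim (use A povm_rtr_bounds(1) densityD(1)[OF \<rho>_density] in blast)
    show "eventually (\<lambda>n. rtr (A n * tpow n \<rho>) \<le> C / real n + C * 2 powr (- (\<epsilon> / 2) * real n)) sequentially"
      using eventually_ge_at_top[of 1] by eventually_elim (rule up)
  qed
  then have "(\<lambda>n. complex_of_real (1 - rtr (A n * tpow n \<rho>))) \<longlonglongrightarrow> complex_of_real (1 - 0)"
    by (intro tendsto_intros)
  then have "(\<lambda>n. complex_of_real (1 - rtr (A n * tpow n \<rho>))) \<longlonglongrightarrow> 1" by simp
  then show ?thesis
    by (rule Lim_transform_eventually)
      (use eventually_ge_at_top[of 1] in \<open>eventually_elim, use mtrace_povm_complement A in simp\<close>)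
qed

subsection \<open>The direct part\<close>

text \<open>Two binary convex combinations give equal weights 1/3. Domination of each component up
  to the factor 3 is harmless on the exponential scale, and the \<open>\<sigma>\<close> component
  supplies the eigenvalue bound.\<close>

lemma mixture:
  assumes n: "n \<ge> 1" and \<omega>: "\<omega>\<^sub>1 \<in> M n" "\<omega>\<^sub>2 \<in> M n" and x: "eigen_lb (d ^ n) (tpow n \<sigma>) x"
  shows "\<exists>\<tau>\<in>M n. psd (d ^ n) (\<tau> - complex_of_real (x / 3) \<cdot>\<^sub>m 1\<^sub>m (d ^ n)) \<and>
     (\<forall>A. povm_elem (d ^ n) A \<longrightarrow> rtr (A * \<omega>\<^sub>1) \<le> 3 * rtr (A * \<tau>) \<and> rtr (A * \<omega>\<^sub>2) \<le> 3 * rtr (A * \<tau>))"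
proof -
  let ?N = "d ^ n" and ?s = "tpow n \<sigma>"
  have dens: "\<omega>\<^sub>1 \<in> density ?N" "\<omega>\<^sub>2 \<in> density ?N" "?s \<in> density ?N"
    using M_density[OF n] \<omega> \<sigma>_M[OF n] by auto
  note c = densityD(2)[OF dens(1)] densityD(2)[OF dens(2)] densityD(2)[OF dens(3)]
  define \<nu> where "\<nu> = complex_of_real (1 / 2) \<cdot>\<^sub>m \<omega>\<^sub>1 + complex_of_real (1 - 1 / 2) \<cdot>\<^sub>m \<omega>\<^sub>2"
  define \<tau> where "\<tau> = complex_of_real (2 / 3) \<cdot>\<^sub>m \<nu> + complex_of_real (1 - 2 / 3) \<cdot>\<^sub>m ?s"
  have conv: "complex_of_real t \<cdot>\<^sub>m B + complex_of_real (1 - t) \<cdot>\<^sub>m B' \<in> M n"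
    if "B \<in> M n" "B' \<in> M n" "0 \<le> t" "t \<le> 1" for B B' t
    using M_convex[OF n] that unfolding convex_mat_set_def by blast
  have \<nu>: "\<nu> \<in> M n" unfolding \<nu>_def by (rule conv) (use \<omega> in auto)
  have \<tau>: "\<tau> \<in> M n" unfolding \<tau>_def by (rule conv) (use \<nu> \<sigma>_M[OF n] in auto)
  have c\<nu>: "\<nu> \<in> carrier_mat ?N ?N" unfolding \<nu>_def using c by auto
  have psd\<nu>: "psd ?N \<nu>" using densityD(1) M_density[OF n] \<nu> by blast
  have "\<tau> - complex_of_real (x / 3) \<cdot>\<^sub>m 1\<^sub>m ?N
     = complex_of_real (2 / 3) \<cdot>\<^sub>m \<nu> + complex_of_real (1 / 3) \<cdot>\<^sub>m (?s - complex_of_real x \<cdot>\<^sub>m 1\<^sub>m ?N)"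
    unfolding \<tau>_def using c\<nu> c by (intro eq_matI) (auto simp: algebra_simps)
  moreover have "psd ?N \<dots>"
    by (intro psd_add psd_smult psd\<nu> eigen_lb_psd[OF x]) auto
  moreover have "rtr (A * \<omega>\<^sub>1) \<le> 3 * rtr (A * \<tau>) \<and> rtr (A * \<omega>\<^sub>2) \<le> 3 * rtr (A * \<tau>)" if A: "povm_elem ?N A" for A
  proof -
    note cA = povmD(3)[OF A]
    have "rtr (A * \<tau>) = rtr (A * (complex_of_real (2 / 3) \<cdot>\<^sub>m \<nu>)) + rtr (A * (complex_of_real (1 - 2 / 3) \<cdot>\<^sub>m ?s))"
      unfolding \<tau>_def using cA c\<nu> c by (intro rtr_mult_right(1)[of _ ?N]) auto
    also have "rtr (A * (complex_of_real (2 / 3) \<cdot>\<^sub>m \<nu>)) = 2 / 3 * rtr (A * \<nu>)"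
      using cA c\<nu> by (intro rtr_mult_right(3)[of _ ?N]) auto
    also have "rtr (A * (complex_of_real (1 - 2 / 3) \<cdot>\<^sub>m ?s)) = (1 - 2 / 3) * rtr (A * ?s)"
      using cA c by (intro rtr_mult_right(3)[of _ ?N]) auto
    also have "rtr (A * \<nu>) = rtr (A * (complex_of_real (1 / 2) \<cdot>\<^sub>m \<omega>\<^sub>1)) + rtr (A * (complex_of_real (1 - 1 / 2) \<cdot>\<^sub>m \<omega>\<^sub>2))"
      unfolding \<nu>_def using cA c by (intro rtr_mult_right(1)[of _ ?N]) auto
    also have "rtr (A * (complex_of_real (1 / 2) \<cdot>\<^sub>m \<omega>\<^sub>1)) = 1 / 2 * rtr (A * \<omega>\<^sub>1)"
      using cA c by (intro rtr_mult_right(3)[of _ ?N]) auto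
    also have "rtr (A * (complex_of_real (1 - 1 / 2) \<cdot>\<^sub>m \<omega>\<^sub>2)) = (1 - 1 / 2) * rtr (A * \<omega>\<^sub>2)"
      using cA c by (intro rtr_mult_right(3)[of _ ?N]) auto
    finally have "3 * rtr (A * \<tau>) = rtr (A * \<omega>\<^sub>1) + rtr (A * \<omega>\<^sub>2) + rtr (A * ?s)"
      by (simp add: field_simps)
    then show ?thesis
      using povm_rtr_bounds(1)[OF A densityD(1)[OF dens(1)]] povm_rtr_bounds(1)[OF A densityD(1)[OF dens(2)]]
        povm_rtr_bounds(1)[OF A densityD(1)[OF dens(3)]] by (intro conjI) linarith+
  qed
  ultimately show ?thesis using \<tau> by (intro bexI[of _ \<tau>]) auto
qed

text \<open>
  If no good test existed, mixing the minimax-optimal adversary \<open>\<omega>\<^sub>1\<close> with the near-optimal product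
  state \<open>\<omega>\<^sub>2\<close> would give a state whose relative entropy rate is below \<open>L\<close>: with probability at
  least \<open>\<delta>/2\<close> the log-likelihood ratio is at most about \<open>n (L - \<epsilon>)\<close> because of \<open>\<omega>\<^sub>1\<close>, and with
  probability close to \<open>1\<close> it is at most about \<open>n L\<close> because of \<open>\<omega>\<^sub>2\<close>.
\<close>

lemma eventually_good_test:
  assumes \<epsilon>: "\<epsilon> > 0" and \<delta>: "0 < \<delta>" "\<delta> \<le> 1 / 2"
  shows "eventually (\<lambda>n. \<exists>A. povm_elem (d ^ n) A \<and> rtr (A * tpow n \<rho>) \<ge> 1 - \<delta> \<and>
     (\<forall>\<omega>\<in>M n. 2 powr (real n * (L - \<epsilon>)) * rtr (A * \<omega>) \<le> 1)) sequentially"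
proof -
  \<comment> \<open>The total loss \<open>2 * \<eta> = \<epsilon> * \<delta> / 8\<close> must stay
    below the gain \<open>(\<epsilon> + \<eta>) * \<delta> / 2\<close>.\<close>
  define \<eta> where "\<eta> = \<epsilon> * \<delta> / 16"
  have \<eta>: "\<eta> > 0" using \<epsilon> \<delta> by (simp add: \<eta>_def)
  obtain C where C: "C \<ge> 0" and sc: "\<And>n. n \<ge> 1 \<Longrightarrow> \<exists>\<omega>\<in>M n. \<forall>A. povm_elem (d ^ n) A \<longrightarrow>
     rtr (A * tpow n \<rho>) \<le> C / real n + C * 2 powr (real n * (L + \<eta>)) * rtr (A * \<omega>)"
    using strong_converse_bound[OF \<eta>] by auto
  obtain x where x: "x > 0" "x \<le> 1" "eigen_lb d \<sigma> x" using \<sigma>_eigen_lb by blast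
  \<comment> \<open>\<open>B\<close> is the number of bins needed per tensor factor, read off from
    the smallest eigenvalue of \<open>\<sigma>\<close>.\<close>
  obtain B :: nat where B: "real B > - log 2 x" using reals_Archimedean2 by blast
  define b where "b = real B"
  have b: "b > 0" using B x unfolding b_def by (smt (verit) log_le_zero_cancel_iff)
  have xB: "2 powr - b \<le> x"
    using B x by (simp add: b_def le_log_iff[symmetric])
  define \<theta> where "\<theta> n = 2 powr (- \<eta> * real n)" for n :: nat
  \<comment> \<open>An upper bound for \<open>E n / n - L\<close> in the adversarial case: pinching
    and rounding, the slack, the gain from the adversary, and the contribution of the tail.\<close>
  define f where "f n = (log 2 (b * real n + 2) + 1) / real n + 2 * \<eta> - (\<epsilon> + \<eta>) * (\<delta> / 2 - 3 * \<theta> n)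
     + (b + 2 / real n + \<bar>L + 2 * \<eta>\<bar>) * (C / real n + 3 * C * \<theta> n)" for n :: nat
  have lims: "(\<lambda>n. (log 2 (b * real n + 2) + 1) / real n) \<longlonglongrightarrow> 0" "\<theta> \<longlonglongrightarrow> 0"
    "(\<lambda>n. 2 / real n) \<longlonglongrightarrow> 0" "(\<lambda>n. C / real n) \<longlonglongrightarrow> 0"
    unfolding \<theta>_def using b \<eta> by real_asymp+
  have "f \<longlonglongrightarrow> 0 + 2 * \<eta> - (\<epsilon> + \<eta>) * (\<delta> / 2 - 3 * 0) + (b + 0 + \<bar>L + 2 * \<eta>\<bar>) * (0 + 3 * C * 0)"
    unfolding f_def
    by (rule tendsto_add tendsto_diff tendsto_mult tendsto_const lims)+
  moreover have "0 + 2 * \<eta> - (\<epsilon> + \<eta>) * (\<delta> / 2 - 3 * 0) + (b + 0 + \<bar>L + 2 * \<eta>\<bar>) * (0 + 3 * C * 0) < 0"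
  proof -
    have "0 < \<epsilon> * \<delta>" "0 < \<eta> * \<delta>" using \<epsilon> \<delta> \<eta> by auto
    moreover have "(\<epsilon> + \<eta>) * (\<delta> / 2) = \<epsilon> * \<delta> / 2 + \<eta> * \<delta> / 2" by (simp add: algebra_simps)
    moreover have "2 * \<eta> = \<epsilon> * \<delta> / 8" by (simp add: \<eta>_def)
    ultimately show ?thesis by simp
  qed
  ultimately have "eventually (\<lambda>n. f n < 0) sequentially" by (rule order_tendstoD(2))
  then show ?thesis using eventually_ge_at_top[of 1]
  proof eventually_elim
    case (elim n)
    then have n: "n \<ge> 1" and fn: "f n < 0" by auto
    define c where "c = 2 powr (real n * (L - \<epsilon>))"
    have c: "c > 0" by (simp add: c_def)
    have "M n \<noteq> {}" using \<sigma>_M[OF n] by auto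
    from minimax_test[OF \<rho>_density M_density[OF n] this M_convex[OF n] c \<delta>]
    consider (test) "\<exists>A. povm_elem (d ^ n) A \<and> rtr (A * tpow n \<rho>) \<ge> 1 - \<delta> \<and> (\<forall>\<omega>\<in>M n. c * rtr (A * \<omega>) \<le> 1)"
      | (adversary) \<omega>\<^sub>1 where "\<omega>\<^sub>1 \<in> M n"
        "\<And>A. povm_elem (d ^ n) A \<Longrightarrow> rtr (A * tpow n \<rho>) \<le> 1 - \<delta> / 2 + c * rtr (A * \<omega>\<^sub>1)"
      by blast
    then show ?case
    proof cases
      case test
      then show ?thesis by (simp add: c_def)
    next
      case adversary
      obtain \<omega>\<^sub>2 where \<omega>\<^sub>2: "\<omega>\<^sub>2 \<in> M n" "\<And>A. povm_elem (d ^ n) A \<Longrightarrow>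
          rtr (A * tpow n \<rho>) \<le> C / real n + C * 2 powr (real n * (L + \<eta>)) * rtr (A * \<omega>\<^sub>2)"
        using sc[OF n] by blast
      obtain \<tau> where \<tau>: "\<tau> \<in> M n" "psd (d ^ n) (\<tau> - complex_of_real (x ^ n / 3) \<cdot>\<^sub>m 1\<^sub>m (d ^ n))"
        and \<tau>1: "\<And>A. povm_elem (d ^ n) A \<Longrightarrow> rtr (A * \<omega>\<^sub>1) \<le> 3 * rtr (A * \<tau>)"
        and \<tau>2: "\<And>A. povm_elem (d ^ n) A \<Longrightarrow> rtr (A * \<omega>\<^sub>2) \<le> 3 * rtr (A * \<tau>)"
        using mixture[OF n adversary(1) \<omega>\<^sub>2(1) eigen_lb_tpow[OF x(3)]] x(1) by (metis less_imp_le)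
      \<comment> \<open>The summand 2 contributes a factor 1/4, which beats the 1/3 lost in the
        mixture.\<close>
      define v where "v = B * n + 2"
      have v: "real v = b * real n + 2" by (simp add: v_def b_def)
      have "2 powr - real v < x ^ n / 3"
      proof -
        have "2 powr - real v = (2 powr - b) ^ n * (1 / 4)"
          unfolding v by (simp add: powr_realpow[symmetric] powr_powr powr_diff powr_minus field_simps)
        also have "\<dots> \<le> x ^ n * (1 / 4)" using xB by (intro mult_right_mono power_mono) auto
        also have "\<dots> < x ^ n / 3" using x(1) by simp
        finally show ?thesis .
      qed
      \<comment> \<open>Each threshold exceeds the exponent of the corresponding adversary,
        \<open>n (L - \<epsilon>)\<close> or \<open>n (L + \<eta>)\<close>, by
        \<open>n \<eta>\<close>; this leaves \<open>\<theta> n\<close> in both tests.\<close>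
      moreover define a\<^sub>1 where "a\<^sub>1 = real n * (L - \<epsilon> + \<eta>)"
      moreover define a\<^sub>2 where "a\<^sub>2 = real n * (L + 2 * \<eta>)"
      moreover have "a\<^sub>1 \<le> a\<^sub>2" unfolding a\<^sub>1_def a\<^sub>2_def using \<epsilon> \<eta> by (intro mult_left_mono) auto
      ultimately obtain T\<^sub>1 T\<^sub>2 where T: "povm_elem (d ^ n) T\<^sub>1" "povm_elem (d ^ n) T\<^sub>2"
        "rtr (T\<^sub>1 * \<tau>) \<le> 2 powr - a\<^sub>1" "rtr (T\<^sub>2 * \<tau>) \<le> 2 powr - a\<^sub>2"
        and S: "rel_entropy (d ^ n) (tpow n \<rho>) \<tau> \<le> ereal (log 2 (real v) + 1 + a\<^sub>1
           + (a\<^sub>2 - a\<^sub>1) * rtr (T\<^sub>1 * tpow n \<rho>) + (real v + \<bar>a\<^sub>2\<bar>) * rtr (T\<^sub>2 * tpow n \<rho>))"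
        using rel_entropy_test_bound[OF \<rho>_density subsetD[OF M_density[OF n] \<tau>(1)] \<tau>(2)] by blast
      have T1: "rtr (T\<^sub>1 * tpow n \<rho>) \<le> 1 - \<delta> / 2 + 3 * \<theta> n"
      proof -
        have "c * rtr (T\<^sub>1 * \<omega>\<^sub>1) \<le> c * (3 * 2 powr - a\<^sub>1)"
          using \<tau>1[OF T(1)] T(3) c by (intro mult_left_mono) auto
        also have "\<dots> = 3 * (2 powr (real n * (L - \<epsilon>)) * 2 powr - a\<^sub>1)" by (simp add: c_def)
        also have "2 powr (real n * (L - \<epsilon>)) * 2 powr - a\<^sub>1 = \<theta> n"
          by (simp add: \<theta>_def a\<^sub>1_def powr_add[symmetric] algebra_simps)
        finally show ?thesis using adversary(2)[OF T(1)] by linarith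
      qed
      have T2: "rtr (T\<^sub>2 * tpow n \<rho>) \<le> C / real n + 3 * C * \<theta> n"
      proof -
        have "C * 2 powr (real n * (L + \<eta>)) * rtr (T\<^sub>2 * \<omega>\<^sub>2) \<le> C * 2 powr (real n * (L + \<eta>)) * (3 * 2 powr - a\<^sub>2)"
          using \<tau>2[OF T(2)] T(4) C by (intro mult_left_mono) auto
        also have "\<dots> = 3 * C * (2 powr (real n * (L + \<eta>)) * 2 powr - a\<^sub>2)" by simp
        also have "2 powr (real n * (L + \<eta>)) * 2 powr - a\<^sub>2 = \<theta> n"
          by (simp add: \<theta>_def a\<^sub>2_def powr_add[symmetric] algebra_simps)
        finally show ?thesis using \<omega>\<^sub>2(2)[OF T(2)] by linarith
      qed
      have "ereal (E n) \<le> ereal (log 2 (real v) + 1 + a\<^sub>1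
           + (a\<^sub>2 - a\<^sub>1) * rtr (T\<^sub>1 * tpow n \<rho>) + (real v + \<bar>a\<^sub>2\<bar>) * rtr (T\<^sub>2 * tpow n \<rho>))"
        using order_trans[OF E_le[OF n \<tau>(1)] S] .
      then have "E n \<le> log 2 (real v) + 1 + a\<^sub>1
           + (a\<^sub>2 - a\<^sub>1) * rtr (T\<^sub>1 * tpow n \<rho>) + (real v + \<bar>a\<^sub>2\<bar>) * rtr (T\<^sub>2 * tpow n \<rho>)" by simp
      also have "\<dots> \<le> log 2 (real v) + 1 + a\<^sub>1
           + (a\<^sub>2 - a\<^sub>1) * (1 - \<delta> / 2 + 3 * \<theta> n) + (real v + \<bar>a\<^sub>2\<bar>) * (C / real n + 3 * C * \<theta> n)"
        using T1 T2 \<open>a\<^sub>1 \<le> a\<^sub>2\<close> by (intro add_mono mult_left_mono) auto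
      also have "\<dots> = real n * (L + f n)"
      proof -
        have abs_a: "\<bar>a\<^sub>2\<bar> = real n * \<bar>L + 2 * \<eta>\<bar>" by (simp add: a\<^sub>2_def abs_mult)
        have e1: "a\<^sub>1 + (a\<^sub>2 - a\<^sub>1) * (1 - \<delta> / 2 + 3 * \<theta> n)
            = real n * L + real n * (2 * \<eta>) - real n * ((\<epsilon> + \<eta>) * (\<delta> / 2 - 3 * \<theta> n))"
          by (simp add: a\<^sub>1_def a\<^sub>2_def field_simps)
        have e2: "real n * (L + f n) = real n * L + (log 2 (b * real n + 2) + 1) + real n * (2 * \<eta>)
            - real n * ((\<epsilon> + \<eta>) * (\<delta> / 2 - 3 * \<theta> n))
            + (b * real n + 2 + real n * \<bar>L + 2 * \<eta>\<bar>) * (C / real n + 3 * C * \<theta> n)"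
        proof -
          have "real n * ((log 2 (b * real n + 2) + 1) / real n) = log 2 (b * real n + 2) + 1" using n by simp
          moreover have "real n * (b + 2 / real n + \<bar>L + 2 * \<eta>\<bar>) = b * real n + 2 + real n * \<bar>L + 2 * \<eta>\<bar>"
            using n by (simp add: distrib_left)
          ultimately show ?thesis
            unfolding f_def by (simp only: distrib_left right_diff_distrib mult.assoc[symmetric])
        qed
        show ?thesis unfolding v abs_a e2 using e1 by linarith
      qed
      finally have "E n \<le> real n * (L + f n)" .
      also have "\<dots> < real n * L" using fn n by simp
      finally show ?thesis using L_le[OF n] n by (simp add: field_simps)
    qed
  qed
qed

text \<open>The tests of \<open>eventually_good_test\<close> depend on \<open>\<delta>\<close>.
  Choosing for each \<open>n\<close> an admissible test within \<open>1 / n\<close> of the best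
  success probability beats all of them at once, and yields a single sequence with error tending to
  0.\<close>

lemma direct_part:
  assumes \<epsilon>: "\<epsilon> > 0"
  shows "\<exists>A. (\<forall>n\<ge>1. povm_elem (d ^ n) (A n)) \<and>
     (\<lambda>n. mtrace ((1\<^sub>m (d ^ n) - A n) * tpow n \<rho>)) \<longlonglongrightarrow> 0 \<and>
     (\<forall>n\<ge>1. \<forall>\<omega>\<in>M n. rtr (A n * \<omega>) \<le> 2 powr (- (real n * (L - \<epsilon>))))"
proof -
  \<comment> \<open>The exponent constraint is imposed at every \<open>n\<close>, not only
    eventually; the zero test shows that it can always be met.\<close>
  define F where "F n = {A. povm_elem (d ^ n) A \<and> (\<forall>\<omega>\<in>M n. 2 powr (real n * (L - \<epsilon>)) * rtr (A * \<omega>) \<le> 1)}" for n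
  have le1: "rtr (A * tpow n \<rho>) \<le> 1" if "povm_elem (d ^ n) A" for A n
    using povm_rtr_bounds(2)[OF that densityD(1)[OF \<rho>_density]] densityD(4)[OF \<rho>_density] by simp
  have "\<exists>A\<in>F n. \<forall>A'\<in>F n. rtr (A' * tpow n \<rho>) - 1 / real n < rtr (A * tpow n \<rho>)" if n: "n \<ge> 1" for n
  proof -
    have "rtr (0\<^sub>m (d ^ n) (d ^ n) * \<omega>) = 0" if "\<omega> \<in> M n" for \<omega>
    proof -
      have "\<omega> \<in> carrier_mat (d ^ n) (d ^ n)" using densityD(2) M_density[OF n] that by blast
      then show ?thesis by (simp add: rtr_def mtrace_def)
    qed
    then have ne: "F n \<noteq> {}" using povm_zero[of "d ^ n"] unfolding F_def by force
    have bdd: "bdd_above ((\<lambda>A. rtr (A * tpow n \<rho>)) ` F n)"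
      using le1 by (intro bdd_aboveI[of _ 1]) (auto simp: F_def)
    have "(SUP A\<in>F n. rtr (A * tpow n \<rho>)) - 1 / real n < (SUP A\<in>F n. rtr (A * tpow n \<rho>))" using n by simp
    then obtain A where A: "A \<in> F n" "(SUP A\<in>F n. rtr (A * tpow n \<rho>)) - 1 / real n < rtr (A * tpow n \<rho>)"
      using less_cSUP_iff[OF ne bdd] by blast
    then show ?thesis using cSUP_upper[OF _ bdd] by (intro bexI[of _ A]) (auto intro: le_less_trans[rotated])
  qed
  then obtain A where A: "\<And>n. n \<ge> 1 \<Longrightarrow> A n \<in> F n"
    and sup: "\<And>n A'. n \<ge> 1 \<Longrightarrow> A' \<in> F n \<Longrightarrow> rtr (A' * tpow n \<rho>) - 1 / real n < rtr (A n * tpow n \<rho>)"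
    by metis
  have povm: "povm_elem (d ^ n) (A n)" if "n \<ge> 1" for n using A[OF that] by (simp add: F_def)
  have "(\<lambda>n. rtr (A n * tpow n \<rho>)) \<longlonglongrightarrow> 1"
  proof (rule LIMSEQ_I)
    fix r :: real assume r: "r > 0"
    define \<delta> where "\<delta> = min (1 / 2) (r / 2)"
    have \<delta>: "0 < \<delta>" "\<delta> \<le> 1 / 2" "\<delta> \<le> r / 2" using r by (auto simp: \<delta>_def)
    have "(\<lambda>n. 1 / real n) \<longlonglongrightarrow> 0" by real_asymp
    then have "eventually (\<lambda>n. 1 / real n < r / 2) sequentially"
      by (rule order_tendstoD(2)) (use r in simp)
    then have "eventually (\<lambda>n. norm (rtr (A n * tpow n \<rho>) - 1) < r) sequentially"
      using eventually_good_test[OF \<epsilon> \<delta>(1,2)] eventually_ge_at_top[of 1]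
    proof eventually_elim
      case (elim n)
      then obtain A' where A': "povm_elem (d ^ n) A'" "rtr (A' * tpow n \<rho>) \<ge> 1 - \<delta>"
        "\<forall>\<omega>\<in>M n. 2 powr (real n * (L - \<epsilon>)) * rtr (A' * \<omega>) \<le> 1" by blast
      have "rtr (A' * tpow n \<rho>) - 1 / real n < rtr (A n * tpow n \<rho>)"
        using sup[OF elim(3)] A' by (simp add: F_def)
      then show ?case using A'(2) elim(1) \<delta>(3) le1[OF povm[OF elim(3)]] by (simp add: abs_if)
    qed
    then show "\<exists>no. \<forall>n\<ge>no. norm (rtr (A n * tpow n \<rho>) - 1) < r" by (simp add: eventually_at_top_linorder)
  qed
  then have "(\<lambda>n. complex_of_real (1 - rtr (A n * tpow n \<rho>))) \<longlonglongrightarrow> complex_of_real (1 - 1)"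
    by (intro tendsto_intros)
  then have lim: "(\<lambda>n. complex_of_real (1 - rtr (A n * tpow n \<rho>))) \<longlonglongrightarrow> 0" by simp
  have "(\<lambda>n. mtrace ((1\<^sub>m (d ^ n) - A n) * tpow n \<rho>)) \<longlonglongrightarrow> 0"
    by (rule Lim_transform_eventually[OF lim])
      (use eventually_ge_at_top[of 1] in \<open>eventually_elim, use mtrace_povm_complement povm in simp\<close>)
  moreover have "rtr (A n * \<omega>) \<le> 2 powr (- (real n * (L - \<epsilon>)))" if "n \<ge> 1" "\<omega> \<in> M n" for n \<omega>
  proof -
    have "2 powr (real n * (L - \<epsilon>)) * rtr (A n * \<omega>) \<le> 1" using A[OF that(1)] that(2) by (simp add: F_def)
    then show ?thesis unfolding powr_minus_divide by (subst pos_le_divide_eq) (auto simp: mult.commute)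
  qed
  ultimately show ?thesis using povm by blast
qed

end

theorem theorem1:
  fixes d :: nat and M :: "nat \<Rightarrow> complex mat set" and \<rho> :: "complex mat"
  assumes "props_P1_P5 d M"
    and "\<rho> \<in> density d"
  shows "(\<forall>\<epsilon>>0. \<exists>A :: nat \<Rightarrow> complex mat.
            (\<forall>n\<ge>1. povm_elem (d ^ n) (A n))
          \<and> (\<lambda>n. mtrace ((1\<^sub>m (d ^ n) - A n) * tpow n \<rho>)) \<longlonglongrightarrow> 0
          \<and> (\<forall>n\<ge>1. \<forall>\<omega>\<in>M n. mtrace (A n * \<omega>) = 0 \<or>
               ereal (- log 2 (Re (mtrace (A n * \<omega>))) / real n + \<epsilon>) \<ge> E_inf d M \<rho>))
       \<and> (\<forall>\<epsilon>>0. \<forall>A :: nat \<Rightarrow> complex mat.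
            (\<forall>n\<ge>1. povm_elem (d ^ n) (A n))
          \<and> (\<forall>n\<ge>1. \<forall>\<omega>\<in>M n. mtrace (A n * \<omega>) = 0 \<or>
               ereal (- log 2 (Re (mtrace (A n * \<omega>))) / real n - \<epsilon>) \<ge> E_inf d M \<rho>)
          \<longrightarrow> (\<lambda>n. mtrace ((1\<^sub>m (d ^ n) - A n) * tpow n \<rho>)) \<longlonglongrightarrow> 1)"
proof -
  obtain \<sigma> where \<sigma>: "\<sigma> \<in> density d" "full_rank d \<sigma>" "\<forall>n\<ge>1. tpow n \<sigma> \<in> M n"
    using assms(1) unfolding props_P1_P5_def by blast
  interpret stein_setting d M \<rho> \<sigma>
    using assms \<sigma> unfolding props_P1_P5_def by unfold_locales auto
  show ?thesis
  proof (intro conjI allI impI)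
    fix \<epsilon> :: real assume "\<epsilon> > 0"
    then obtain A where A: "\<forall>n\<ge>1. povm_elem (d ^ n) (A n)"
      "(\<lambda>n. mtrace ((1\<^sub>m (d ^ n) - A n) * tpow n \<rho>)) \<longlonglongrightarrow> 0"
      "\<forall>n\<ge>1. \<forall>\<omega>\<in>M n. rtr (A n * \<omega>) \<le> 2 powr (- (real n * (L - \<epsilon>)))"
      using direct_part by blast
    show "\<exists>A :: nat \<Rightarrow> complex mat. (\<forall>n\<ge>1. povm_elem (d ^ n) (A n))
          \<and> (\<lambda>n. mtrace ((1\<^sub>m (d ^ n) - A n) * tpow n \<rho>)) \<longlonglongrightarrow> 0
          \<and> (\<forall>n\<ge>1. \<forall>\<omega>\<in>M n. mtrace (A n * \<omega>) = 0 \<or>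
               ereal (- log 2 (Re (mtrace (A n * \<omega>))) / real n + \<epsilon>) \<ge> E_inf d M \<rho>)"
    proof (intro exI[of _ A] conjI A(1,2) allI impI ballI)
      fix n \<omega> assume n: "1 \<le> n" and \<omega>: "\<omega> \<in> M n"
      show "mtrace (A n * \<omega>) = 0 \<or> ereal (- log 2 (Re (mtrace (A n * \<omega>))) / real n + \<epsilon>) \<ge> E_inf d M \<rho>"
        unfolding E_inf_eq using exponent_iff[OF n _ \<omega>] A n \<omega> by blast
    qed
  next
    fix \<epsilon> :: real and A :: "nat \<Rightarrow> complex mat"
    assume \<epsilon>: "\<epsilon> > 0" and hyp: "(\<forall>n\<ge>1. povm_elem (d ^ n) (A n)) \<and> (\<forall>n\<ge>1. \<forall>\<omega>\<in>M n. mtrace (A n * \<omega>) = 0 \<or>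
               ereal (- log 2 (Re (mtrace (A n * \<omega>))) / real n - \<epsilon>) \<ge> E_inf d M \<rho>)"
    show "(\<lambda>n. mtrace ((1\<^sub>m (d ^ n) - A n) * tpow n \<rho>)) \<longlonglongrightarrow> 1"
    proof (rule strong_converse[OF \<epsilon>])
      show povm: "povm_elem (d ^ n) (A n)" if "n \<ge> 1" for n using hyp that by blast
      fix n \<omega> assume n: "1 \<le> n" and \<omega>: "\<omega> \<in> M n"
      \<comment> \<open>Written as addition of \<open>- \<epsilon>\<close> so that
        \<open>exponent_iff\<close> serves both directions.\<close>
      have "mtrace (A n * \<omega>) = 0 \<or> ereal (- log 2 (Re (mtrace (A n * \<omega>))) / real n + - \<epsilon>) \<ge> ereal L"
        using hyp n \<omega> unfolding E_inf_eq by simp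
      then show "rtr (A n * \<omega>) \<le> 2 powr (- (real n * (L + \<epsilon>)))"
        using exponent_iff[OF n povm[OF n] \<omega>, of "- \<epsilon>"] by simp
    qed
  qed
qed

end
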